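(* The exceptional groups of type $E_8$ and $F_4$ admit no principal Hodge representations. That is, if $G$ is a $\mathbb{Q}$-algebraic group whose complex Lie algebra $\mathfrak{g}_{\mathbb C}$ is the exceptional simple Lie algebra of type $E_8$ or $F_4$, then there is no principal Hodge representation $(V,\varphi)$ of $G$.
   Context: Hodge representations. Let $V$ be a (finite-dimensional) rational vector space, $w\in\mathbb{Z}$, and $Q:V\times V\to\mathbb{Q}$ a nondegenerate bilinear form with $Q(u,v)=(-1)^wQ(v,u)$. A $Q$-polarized Hodge structure of weight $w$ on $V$ is a nonconstant homomorphism $\phi:S^1\to\mathrm{Aut}(V_{\mathbb R},Q)$ of $\mathbb{R}$-algebraic groups with $\phi(-1)=(-1)^w\mathrm{Id}$ and $Q(v,\phi(\mathbf{i})\overline v)>0$ for all $0\ne v\in V_{\mathbb C}$. Its Hodge decomposition is $V_{\mathbb C}=\bigoplus_{p+q=w}V^{p,q}$, $V^{p,q}=\{v\in V_{\mathbb C}\mid \phi(z)v=z^{p-q}v\ \forall z\in S^1\}$. Let $G$ be a $\mathbb{Q}$-algebraic group, $\pi:G\to\mathrm{Aut}(V,Q)$ a homomorphism of $\mathbb{Q}$-algebraic groups such that $\pi_*:\mathfrak{g}_{\mathbb C}\to\mathrm{End}(V_{\mathbb C},Q)$ is injective, and $\varphi:S^1\to G_{\mathbb R}$ a nonconstant homomorphism of $\mathbb{R}$-algebraic groups. Then $(V,Q,\pi,\varphi)$, abbreviated $(V,\varphi)$, is a Hodge representation of $G$ if $\pi\circ\varphi$ is a $Q$-polarized Hodge structure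 on $V$. Principal. Let $V_\ell\subset V_{\mathbb C}$ denote $V^{p,q}$ with $\ell=(p-q)/2\in\tfrac12\mathbb{Z}$, and let $m$ be the largest $\ell$ with $V_\ell\neq 0$, so $V_{\mathbb C}=V_m\oplus V_{m-1}\oplus\cdots\oplus V_{1-m}\oplus V_{-m}$. The Hodge representation is principal if its Hodge numbers are $(1,1,\dots,1)$, i.e. $\dim_{\mathbb C}V_\ell=1$ for $\ell=m,m-1,\dots,-m$. *)

theory Defs
  imports "HOL-Analysis.Analysis"
begin

text \<open>
  Algebraic groups are represented by their complex points inside some \<open>GL\<^sub>N\<close>, and a rational
  vector space of dimension \<open>n\<close> by \<open>\<rat>\<^sup>n\<close>, with complexification \<open>\<complex>\<^sup>n\<close>.
\<close>

section \<open>Linear algebraic groups\<close>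

definition mscale :: "complex \<Rightarrow> complex^'m^'n \<Rightarrow> complex^'m^'n" (infixr \<open>*\<^sub>M\<close> 75) where
  "c *\<^sub>M A = map_matrix ((*) c) A"

interpretation cmat: vector_space "(*\<^sub>M) :: complex \<Rightarrow> complex^'m^'n \<Rightarrow> complex^'m^'n"
  by unfold_locales (simp_all add: mscale_def vec_eq_iff algebra_simps)

text \<open>The coordinate ring \<open>K[g\<^sub>i\<^sub>j, 1/det g]\<close> of \<open>GL\<^sub>N\<close>, for a subfield \<open>K\<close> of the complex numbers.\<close>

inductive_set regular_fun :: "complex set \<Rightarrow> (complex^'m^'m \<Rightarrow> complex) set"
  for K :: "complex set" where
  const: "c \<in> K \<Longrightarrow> (\<lambda>g. c) \<in> regular_fun K"
| entry: "(\<lambda>g. g $ i $ j) \<in> regular_fun K"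
| inv_det: "(\<lambda>g. inverse (det g)) \<in> regular_fun K"
| add: "p \<in> regular_fun K \<Longrightarrow> q \<in> regular_fun K \<Longrightarrow> (\<lambda>g. p g + q g) \<in> regular_fun K"
| mult: "p \<in> regular_fun K \<Longrightarrow> q \<in> regular_fun K \<Longrightarrow> (\<lambda>g. p g * q g) \<in> regular_fun K"

definition rational_algebraic_group :: "(complex^'m^'m) set \<Rightarrow> bool" where
  "rational_algebraic_group G \<longleftrightarrow>
     (\<exists>S \<subseteq> regular_fun \<rat>. G = {g. invertible g \<and> (\<forall>f\<in>S. f g = 0)}) \<and>
     mat 1 \<in> G \<and> (\<forall>g\<in>G. \<forall>h\<in>G. g ** h \<in> G) \<and> (\<forall>g\<in>G. matrix_inv g \<in> G)"

definition rational_group_hom ::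
  "(complex^'m^'m) set \<Rightarrow> (complex^'n^'n) set \<Rightarrow> (complex^'m^'m \<Rightarrow> complex^'n^'n) \<Rightarrow> bool" where
  "rational_group_hom G H f \<longleftrightarrow>
     (\<forall>g\<in>G. f g \<in> H) \<and> (\<forall>g\<in>G. \<forall>h\<in>G. f (g ** h) = f g ** f h) \<and>
     (\<forall>i j. \<exists>F \<in> regular_fun \<rat>. \<forall>g\<in>G. f g $ i $ j = F g)"

text \<open>
  Homomorphisms of real algebraic groups from the circle to \<open>G\<^sub>\<real>\<close>, given on real points.
  A real polynomial function on the complex plane is a real polynomial in \<open>Re z\<close> and \<open>Im z\<close>.
  The real points of the circle are Zariski dense, so nothing is lost.
\<close>

definition circle_hom :: "(complex^'m^'m) set \<Rightarrow> (complex \<Rightarrow> complex^'m^'m) \<Rightarrow> bool" where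
  "circle_hom G \<phi> \<longleftrightarrow>
     (\<forall>z \<in> sphere 0 1. \<phi> z \<in> G) \<and>
     (\<forall>z \<in> sphere 0 1. \<forall>w \<in> sphere 0 1. \<phi> (z * w) = \<phi> z ** \<phi> w) \<and>
     (\<forall>i j. \<exists>p. real_polynomial_function p \<and> (\<forall>z \<in> sphere 0 1. \<phi> z $ i $ j = of_real (p z)))"

text \<open>The Zariski tangent space at the identity, i.e. the Lie algebra of \<open>G\<^sub>\<complex>\<close>.\<close>

definition lie_algebra_of :: "(complex^'m^'m) set \<Rightarrow> (complex^'m^'m) set" where
  "lie_algebra_of G =
     {X. \<forall>f \<in> regular_fun UNIV. (\<forall>g\<in>G. f g = 0) \<longrightarrow>
           ((\<lambda>t. f (mat 1 + t *\<^sub>M X)) has_field_derivative 0) (at 0)}"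

text \<open>
  The differential at the identity: \<open>X\<close> acts as a derivation on each matrix entry of \<open>f\<close>.
  For \<open>X\<close> in the Lie algebra the value does not depend on the regular extension \<open>F\<close>.
\<close>

definition differential_at_1 ::
  "(complex^'m^'m) set \<Rightarrow> (complex^'m^'m \<Rightarrow> complex^'n^'n) \<Rightarrow> complex^'m^'m \<Rightarrow> complex^'n^'n" where
  "differential_at_1 G f X =
     (\<chi> i j. THE c. \<exists>F \<in> regular_fun UNIV. (\<forall>g\<in>G. F g = f g $ i $ j) \<and>
               ((\<lambda>t. F (mat 1 + t *\<^sub>M X)) has_field_derivative c) (at 0))"


section \<open>Simple complex Lie algebras of type \<open>E\<^sub>8\<close> and \<open>F\<^sub>4\<close>\<close>

definition bracket :: "complex^'m^'m \<Rightarrow> complex^'m^'m \<Rightarrow> complex^'m^'m" where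
  "bracket X Y = X ** Y - Y ** X"

definition lie_subalgebra :: "(complex^'m^'m) set \<Rightarrow> bool" where
  "lie_subalgebra L \<longleftrightarrow> cmat.subspace L \<and> (\<forall>X\<in>L. \<forall>Y\<in>L. bracket X Y \<in> L)"

definition lie_ideal :: "(complex^'m^'m) set \<Rightarrow> (complex^'m^'m) set \<Rightarrow> bool" where
  "lie_ideal I L \<longleftrightarrow> I \<subseteq> L \<and> cmat.subspace I \<and> (\<forall>X\<in>L. \<forall>Y\<in>I. bracket X Y \<in> I)"

definition simple_lie_algebra :: "(complex^'m^'m) set \<Rightarrow> bool" where
  "simple_lie_algebra L \<longleftrightarrow>
     lie_subalgebra L \<and> (\<exists>X\<in>L. \<exists>Y\<in>L. bracket X Y \<noteq> 0) \<and>
     (\<forall>I. lie_ideal I L \<longrightarrow> I = {0} \<or> I = L)"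

text \<open>
  Cartan subalgebras of a semisimple complex Lie algebra: maximal commutative subalgebras
  all of whose elements are ad-diagonalizable.
\<close>

definition cartan_subalgebra :: "(complex^'m^'m) set \<Rightarrow> (complex^'m^'m) set \<Rightarrow> bool" where
  "cartan_subalgebra H L \<longleftrightarrow>
     H \<subseteq> L \<and> cmat.subspace H \<and>
     (\<forall>S\<in>H. \<forall>T\<in>H. bracket S T = 0) \<and>
     (\<forall>X\<in>L. (\<forall>T\<in>H. bracket T X = 0) \<longrightarrow> X \<in> H) \<and>
     (\<forall>T\<in>H. L \<subseteq> cmat.span {X\<in>L. \<exists>c. bracket T X = c *\<^sub>M X})"

definition root_space ::
  "(complex^'m^'m) set \<Rightarrow> (complex^'m^'m) set \<Rightarrow> (complex^'m^'m \<Rightarrow> complex) \<Rightarrow> (complex^'m^'m) set" where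
  "root_space L H \<alpha> = {X\<in>L. \<forall>T\<in>H. bracket T X = \<alpha> T *\<^sub>M X}"

text \<open>
  Only the values of a root on \<open>H\<close> matter; its linearity there is a consequence
  of the root space being nonzero.
\<close>

definition is_root ::
  "(complex^'m^'m) set \<Rightarrow> (complex^'m^'m) set \<Rightarrow> (complex^'m^'m \<Rightarrow> complex) \<Rightarrow> bool" where
  "is_root L H \<alpha> \<longleftrightarrow> (\<exists>T\<in>H. \<alpha> T \<noteq> 0) \<and> (\<exists>X\<in>root_space L H \<alpha>. X \<noteq> 0)"

definition is_coroot ::
  "(complex^'m^'m) set \<Rightarrow> (complex^'m^'m) set \<Rightarrow> (complex^'m^'m \<Rightarrow> complex) \<Rightarrow> complex^'m^'m \<Rightarrow> bool" where
  "is_coroot L H \<alpha> T \<longleftrightarrow>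
     T \<in> H \<and> \<alpha> T = 2 \<and>
     (\<exists>X \<in> root_space L H \<alpha>. \<exists>Y \<in> root_space L H (\<lambda>S. - \<alpha> S). bracket X Y = T)"

definition root_base ::
  "(complex^'m^'m) set \<Rightarrow> (complex^'m^'m) set \<Rightarrow> nat \<Rightarrow> (nat \<Rightarrow> complex^'m^'m \<Rightarrow> complex) \<Rightarrow> bool" where
  "root_base L H r \<alpha> \<longleftrightarrow>
     (\<forall>i<r. is_root L H (\<alpha> i)) \<and>
     (\<forall>c. (\<forall>T\<in>H. (\<Sum>i<r. c i * \<alpha> i T) = 0) \<longrightarrow> (\<forall>i<r. c i = 0)) \<and>
     (\<forall>\<beta>. is_root L H \<beta> \<longrightarrow>
        (\<exists>k :: nat \<Rightarrow> nat. (\<forall>T\<in>H. \<beta> T = (\<Sum>i<r. of_nat (k i) * \<alpha> i T)) \<or>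
                          (\<forall>T\<in>H. \<beta> T = - (\<Sum>i<r. of_nat (k i) * \<alpha> i T))))"

text \<open>
  The Cartan matrix has entries \<open>C\<^sub>i\<^sub>j = \<langle>\<alpha>\<^sub>i, \<alpha>\<^sub>j\<^sup>\<or>\<rangle>\<close>. Vertices of the
  Dynkin diagrams are numbered as in Bourbaki, starting from 0.
\<close>

definition simple_of_type :: "int list list \<Rightarrow> (complex^'m^'m) set \<Rightarrow> bool" where
  "simple_of_type C L \<longleftrightarrow>
     simple_lie_algebra L \<and>
     (\<exists>H \<alpha> T. cartan_subalgebra H L \<and> root_base L H (length C) \<alpha> \<and>
        (\<forall>j < length C. is_coroot L H (\<alpha> j) (T j)) \<and>
        (\<forall>i < length C. \<forall>j < length C. \<alpha> i (T j) = of_int (C ! i ! j)))"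

definition cartan_E8 :: "int list list" where
  "cartan_E8 =
    [[ 2,  0, -1,  0,  0,  0,  0,  0],
     [ 0,  2,  0, -1,  0,  0,  0,  0],
     [-1,  0,  2, -1,  0,  0,  0,  0],
     [ 0, -1, -1,  2, -1,  0,  0,  0],
     [ 0,  0,  0, -1,  2, -1,  0,  0],
     [ 0,  0,  0,  0, -1,  2, -1,  0],
     [ 0,  0,  0,  0,  0, -1,  2, -1],
     [ 0,  0,  0,  0,  0,  0, -1,  2]]"

definition cartan_F4 :: "int list list" where
  "cartan_F4 =
    [[ 2, -1,  0,  0],
     [-1,  2, -2,  0],
     [ 0, -1,  2, -1],
     [ 0,  0, -1,  2]]"


section \<open>Hodge representations\<close>

type_synonym 'n form = "rat^'n \<Rightarrow> rat^'n \<Rightarrow> rat"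

definition polarization_form :: "int \<Rightarrow> 'n::finite form \<Rightarrow> bool" where
  "polarization_form w Q \<longleftrightarrow>
     (\<forall>u. Vector_Spaces.linear (*s) (*) (\<lambda>v. Q u v)) \<and>
     (\<forall>v. Vector_Spaces.linear (*s) (*) (\<lambda>u. Q u v)) \<and>
     (\<forall>u v. Q u v = (-1) powi w * Q v u) \<and>
     (\<forall>u. (\<forall>v. Q u v = 0) \<longrightarrow> u = 0)"

definition complexify_form :: "'n::finite form \<Rightarrow> complex^'n \<Rightarrow> complex^'n \<Rightarrow> complex" where
  "complexify_form Q u v =
     (\<Sum>i\<in>UNIV. \<Sum>j\<in>UNIV. of_rat (Q (axis i 1) (axis j 1)) * u $ i * v $ j)"

text \<open>The complex points of \<open>Aut(V, Q)\<close>.\<close>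

definition form_aut :: "'n::finite form \<Rightarrow> (complex^'n^'n) set" where
  "form_aut Q = {A. invertible A \<and>
     (\<forall>u v. complexify_form Q (A *v u) (A *v v) = complexify_form Q u v)}"

definition polarized_hodge_structure ::
  "int \<Rightarrow> 'n::finite form \<Rightarrow> (complex \<Rightarrow> complex^'n^'n) \<Rightarrow> bool" where
  "polarized_hodge_structure w Q \<psi> \<longleftrightarrow>
     polarization_form w Q \<and>
     circle_hom (form_aut Q) \<psi> \<and> \<not> \<psi> constant_on sphere 0 1 \<and>
     \<psi> (-1) = (-1) powi w *\<^sub>M mat 1 \<and>
     (\<forall>v. v \<noteq> 0 \<longrightarrow>
        complexify_form Q v (\<psi> \<i> *v (\<chi> i. cnj (v $ i))) \<in> \<real> \<and>
        0 < Re (complexify_form Q v (\<psi> \<i> *v (\<chi> i. cnj (v $ i)))))"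

text \<open>The Hodge summand \<open>V\<^sup>p\<^sup>,\<^sup>q\<close>, to be used with \<open>p + q\<close> equal to the weight.\<close>

definition hodge_summand :: "(complex \<Rightarrow> complex^'n^'n) \<Rightarrow> int \<Rightarrow> int \<Rightarrow> (complex^'n) set" where
  "hodge_summand \<psi> p q = {v. \<forall>z \<in> sphere 0 1. \<psi> z *v v = z powi (p - q) *s v}"

definition hodge_representation ::
  "(complex^'m^'m) set \<Rightarrow> int \<Rightarrow> 'n::finite form \<Rightarrow>
   (complex^'m^'m \<Rightarrow> complex^'n^'n) \<Rightarrow> (complex \<Rightarrow> complex^'m^'m) \<Rightarrow> bool" where
  "hodge_representation G w Q \<pi> \<phi> \<longleftrightarrow>
     rational_algebraic_group G \<and>
     rational_group_hom G (form_aut Q) \<pi> \<and>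
     inj_on (differential_at_1 G \<pi>) (lie_algebra_of G) \<and>
     circle_hom G \<phi> \<and> \<not> \<phi> constant_on sphere 0 1 \<and>
     polarized_hodge_structure w Q (\<pi> \<circ> \<phi>)"

text \<open>
  With \<open>V\<^sub>l = V\<^sup>p\<^sup>,\<^sup>q\<close> for \<open>l = (p - q)/2\<close> and \<open>p + q = w\<close>, consecutive indices differ by 1, so the
  summands with \<open>\<bar>l\<bar> \<le> m\<close> are exactly those for \<open>l = m, m - 1, \<dots>, -m\<close>.
\<close>

definition highest_level :: "int \<Rightarrow> (complex \<Rightarrow> complex^'n^'n) \<Rightarrow> rat" where
  "highest_level w \<psi> =
     Max {of_int (p - q) / 2 | p q. p + q = w \<and> hodge_summand \<psi> p q \<noteq> {0}}"

definition principal_hodge :: "int \<Rightarrow> (complex \<Rightarrow> complex^'n^'n) \<Rightarrow> bool" where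
  "principal_hodge w \<psi> \<longleftrightarrow>
     (\<forall>p q. p + q = w \<and> \<bar>of_int (p - q) / 2\<bar> \<le> highest_level w \<psi> \<longrightarrow>
        vec.dim (hodge_summand \<psi> p q) = 1)"

end

theory Submission
  imports Defs "HOL-Computational_Algebra.Fundamental_Theorem_Algebra" "HOL-Complex_Analysis.Complex_Analysis"
begin

text \<open>
  The derivative of \<open>\<phi>\<close> at \<open>1\<close> is an element \<open>X\<close> of \<open>\<gg>\<close>, and principality says that its image in
  \<open>End(V)\<close> has simple spectrum. So it suffices that \<open>det(X + t)\<close> vanishes to order at least 2
  at \<open>t = 0\<close> for every \<open>X\<close> in the image of \<open>\<gg>\<close>. The first two coefficients of \<open>det(X + t)\<close> are
  conjugation invariant polynomials, and such a polynomial vanishes on \<open>\<gg>\<close> as soon as it vanishes on a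
  Cartan subalgebra: no conjugacy of Cartan subalgebras is needed. On the given Cartan
  subalgebra the claim is that the zero weight space \<open>V\<^sub>0\<close> has dimension at least 2.

  Since the Cartan matrix is unimodular and no fundamental weight is minuscule, every nontrivial
  representation has the short roots, hence also 0, among its weights. If \<open>V\<^sub>0\<close> were a line \<open>\<complex>u\<close>, then the
  weight spaces near 0 are lines too, and the Chevalley generators act on words in
  the \<open>e\<^sub>i\<close> applied to \<open>u\<close> through scalars. For an edge between \<open>i\<close> and \<open>j\<close> of the Dynkin diagram write
  \<open>e\<^sub>j e\<^sub>i u = a e\<^sub>i e\<^sub>j u\<close> and \<open>f\<^sub>i e\<^sub>i u = c u\<close>; the Serre relations give \<open>c (a - 1)\<^sup>2 = a\<close>,
  and they force the scalars of two edges into a common vertex to be inverse to each other. This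
  excludes the branch vertex of \<open>E\<^sub>8\<close>; a similar computation excludes the subdiagram \<open>C\<^sub>3\<close> of \<open>F\<^sub>4\<close>.
\<close>

text \<open>Nothing places \<open>X\<close> in the given Cartan subalgebra, and \<open>V\<close> is
  an arbitrary, possibly reducible representation. Only conditions that are polynomial in
  \<open>X\<close> and invariant under conjugation in \<open>End(V)\<close> can be transported from
  the Cartan subalgebra to \<open>X\<close>. The dimension of the kernel is not of this kind; the
  algebraic multiplicity of the eigenvalue 0, read off from \<open>det(X + t)\<close>, is. On the
  side of weights, one line at 0 controls its surroundings because \<open>f_i\<close> is injective
  on vectors whose weight is positive on \<open>h_i\<close>. At the branch vertex the three scalars
  are pairwise inverse, hence equal to 1 or -1. The value 1 contradicts
  \<open>c (a - 1)^2 = a\<close>, and -1 gives \<open>c = -1/4\<close>, whereas \<open>c\<close> is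
  a Casimir eigenvalue \<open>k (k + 1)\<close> of an \<open>sl2\<close>. In the \<open>C3\<close>
  diagram the long simple root need not be a weight, so its scalars may vanish and cannot be divided
  by; the missing equations come from the same computation with raising and lowering operators
  exchanged. Only the differential of the group representation enters, and that it respects brackets
  is proved from the tangent space definition by means of left invariant vector fields.\<close>

no_notation fps_nth (infixl "$" 75)

section \<open>Representations of \<open>sl\<^sub>2\<close>\<close>

lemma eigenvectors_scalars_zero:
  fixes A :: "'a::real_vector \<Rightarrow> 'a"
  assumes A: "linear A" and fin: "finite S"
    and eig: "\<And>k. k \<in> S \<Longrightarrow> A (x k) = c k *\<^sub>R x k" and inj: "inj_on c S"
    and nz: "\<And>k. k \<in> S \<Longrightarrow> x k \<noteq> 0" and sum0: "(\<Sum>k\<in>S. u k *\<^sub>R x k) = 0"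
  shows "\<forall>k\<in>S. u k = 0"
  using fin eig inj nz sum0
proof (induction S arbitrary: u rule: finite_induct)
  case empty then show ?case by simp
next
  case (insert a S)
  have s: "u a *\<^sub>R x a + (\<Sum>k\<in>S. u k *\<^sub>R x k) = 0" using insert by simp
  have "A (u a *\<^sub>R x a + (\<Sum>k\<in>S. u k *\<^sub>R x k)) = 0" using s linear_0[OF A] by simp
  then have "u a *\<^sub>R A (x a) + (\<Sum>k\<in>S. u k *\<^sub>R A (x k)) = 0"
    by (simp add: linear_add[OF A] linear_sum[OF A] linear_scale[OF A])
  then have 1: "(c a * u a) *\<^sub>R x a + (\<Sum>k\<in>S. (c k * u k) *\<^sub>R x k) = 0"
    using insert.prems(1) by (simp add: mult.commute)
  have "c a *\<^sub>R (u a *\<^sub>R x a + (\<Sum>k\<in>S. u k *\<^sub>R x k)) = 0" using s by simp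
  then have 2: "(c a * u a) *\<^sub>R x a + (\<Sum>k\<in>S. (c a * u k) *\<^sub>R x k) = 0"
    by (simp add: scaleR_add_right scaleR_sum_right)
  have "(\<Sum>k\<in>S. ((c k - c a) * u k) *\<^sub>R x k) = 0"
  proof -
    have "(\<Sum>k\<in>S. ((c k - c a) * u k) *\<^sub>R x k)
        = (\<Sum>k\<in>S. (c k * u k) *\<^sub>R x k) - (\<Sum>k\<in>S. (c a * u k) *\<^sub>R x k)"
      by (simp add: left_diff_distrib scaleR_diff_left sum_subtractf)
    then show ?thesis using 1 2 by (simp add: add_eq_0_iff)
  qed
  then have "\<forall>k\<in>S. (c k - c a) * u k = 0"
    using insert.prems insert.IH[of "\<lambda>k. (c k - c a) * u k"] by (auto simp: inj_on_def)
  then have "\<forall>k\<in>S. u k = 0" using insert.prems(2) insert.hyps(2) by (auto simp: inj_on_def)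
  then show ?case using s insert.prems(3)[of a] by simp
qed

text \<open>This is how finite dimension stops the strings of \<open>sl2\<close>: the vectors of a
  string belong to pairwise different eigenvalues, so one of them must be 0.\<close>

lemma eigenvector_sequence_vanishes:
  fixes A :: "'a::euclidean_space \<Rightarrow> 'a" and x :: "nat \<Rightarrow> 'a"
  assumes A: "linear A" and eig: "\<And>k. A (x k) = c k *\<^sub>R x k" and inj: "inj c"
  shows "\<exists>k. x k = 0"
proof (rule ccontr)
  assume nz: "\<not> ?thesis"
  define S where "S = {..<Suc DIM('a)}"
  have zero: "\<forall>k\<in>S. u k = 0" if "(\<Sum>k\<in>S. u k *\<^sub>R x k) = 0" for u
    using eigenvectors_scalars_zero[OF A _ _ _ _ that] eig nz inj by (auto simp: S_def inj_on_def)
  have injx: "inj_on x S"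
  proof (rule inj_onI, rule ccontr)
    fix j k assume jk: "j \<in> S" "k \<in> S" "x j = x k" "j \<noteq> k"
    have "c j *\<^sub>R x k = c k *\<^sub>R x k" using eig[of j] eig[of k] jk(3) by metis
    then have "c j = c k" using nz by simp
    then show False using jk(4) inj by (simp add: inj_def)
  qed
  have "independent (x ` S)"
  proof (rule independent_if_scalars_zero)
    show "finite (x ` S)" by (simp add: S_def)
    fix g v assume g: "(\<Sum>v\<in>x ` S. g v *\<^sub>R v) = 0" "v \<in> x ` S"
    have "(\<Sum>k\<in>S. (g \<circ> x) k *\<^sub>R x k) = 0" using g(1) by (simp add: sum.reindex[OF injx])
    then have "\<forall>k\<in>S. (g \<circ> x) k = 0" by (rule zero)
    then show "g v = 0" using g(2) by auto
  qed
  then have "card (x ` S) \<le> DIM('a)" using independent_bound by blast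
  then show False unfolding card_image[OF injx] by (simp add: S_def)
qed

text \<open>Real scalars and an arbitrary Euclidean space let the same results serve the action on
  \<open>V\<close> and the adjoint action on matrices.\<close>

locale sl2_action =
  fixes e f h :: "'a::euclidean_space \<Rightarrow> 'a"
  assumes lin: "linear e" "linear f" "linear h"
    and ef: "e (f v) = f (e v) + h v"
    and he: "h (e v) = e (h v) + 2 *\<^sub>R e v"
    and hf: "h (f v) = f (h v) - 2 *\<^sub>R f v"
begin

lemma weight_e_power:
  assumes "h v = c *\<^sub>R v"
  shows "h ((e ^^ k) v) = (c + 2 * real k) *\<^sub>R (e ^^ k) v"
  by (induction k) (auto simp: assms he linear_scale[OF lin(1)] linear_add[OF lin(1)] algebra_simps)

text \<open>Here \<open>d\<close> is the eigenvalue of \<open>e f\<close> on \<open>v\<close>. With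
  \<open>d = 0\<close> this is the usual formula for a lowest weight vector; a general
  \<open>d\<close> makes it usable in the middle of a string, in particular at weight 0.\<close>

lemma fe_power:
  assumes "h v = c *\<^sub>R v" "e (f v) = d *\<^sub>R v"
  shows "f ((e ^^ Suc k) v) = (d - real (Suc k) * (c + real k)) *\<^sub>R (e ^^ k) v"
proof (induction k)
  case 0
  have "f (e v) = e (f v) - h v" using ef[of v] by simp
  then show ?case using assms by (simp add: algebra_simps)
next
  case (Suc k)
  have "f ((e ^^ Suc (Suc k)) v) = e (f ((e ^^ Suc k) v)) - h ((e ^^ Suc k) v)"
    using ef[of "(e ^^ Suc k) v"] by simp
  also have "\<dots> = (d - real (Suc k) * (c + real k)) *\<^sub>R (e ^^ Suc k) v - (c + 2 * real (Suc k)) *\<^sub>R (e ^^ Suc k) v"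
    by (simp only: Suc.IH linear_scale[OF lin(1)] weight_e_power[OF assms(1)]) simp
  finally show ?case by (simp only: scaleR_diff_left[symmetric]) (simp add: algebra_simps)
qed

lemma e_power_vanishes:
  assumes "h v = c *\<^sub>R v" shows "\<exists>k. (e ^^ k) v = 0"
  by (rule eigenvector_sequence_vanishes[OF lin(3) weight_e_power[OF assms]])
    (simp add: inj_def)

lemma e_power_vanishes_first:
  assumes "h v = c *\<^sub>R v" "v \<noteq> 0" shows "\<exists>k. (e ^^ k) v \<noteq> 0 \<and> (e ^^ Suc k) v = 0"
proof -
  obtain k where k: "(e ^^ k) v = 0" "\<forall>j<k. (e ^^ j) v \<noteq> 0"
    using e_power_vanishes[OF assms(1)] exists_least_iff[of "\<lambda>k. (e ^^ k) v = 0"] by blast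
  with assms(2) obtain j where "k = Suc j" by (cases k) auto
  with k show ?thesis by blast
qed

text \<open>At the top of the \<open>e\<close>-string through \<open>v\<close>,
  \<open>fe_power\<close> gives \<open>(k + 1) * (c + k) = 0\<close>, impossible for positive
  \<open>c\<close>. In particular \<open>f\<close> is injective on eigenspaces of positive
  weight.\<close>

lemma ef_inj:
  assumes "h v = c *\<^sub>R v" "c > 0" "e (f v) = 0"
  shows "v = 0"
proof (rule ccontr)
  assume "v \<noteq> 0"
  then obtain k where k: "(e ^^ k) v \<noteq> 0" "(e ^^ Suc k) v = 0"
    using e_power_vanishes_first assms by blast
  then have "(0 - real (Suc k) * (c + real k)) *\<^sub>R (e ^^ k) v = 0"
    using fe_power[OF assms(1), of 0 k] assms(3) linear_0[OF lin(2)] by simp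
  then have "real (Suc k) * (c + real k) = 0" using k by simp
  then show False using assms(2) by (simp add: add_pos_nonneg)
qed

text \<open>The same evaluation at the top of the string, now at weight 0: \<open>d\<close> is the
  Casimir eigenvalue of the irreducible representation with highest weight
  \<open>2 * k\<close>.\<close>

lemma casimir_at_0:
  assumes "h v = 0" "v \<noteq> 0" "e (f v) = d *\<^sub>R v"
  shows "\<exists>k::nat. d = real k * real (Suc k)"
proof -
  obtain k where k: "(e ^^ k) v \<noteq> 0" "(e ^^ Suc k) v = 0"
    using e_power_vanishes_first[of v 0] assms by auto
  have "(d - real (Suc k) * (0 + real k)) *\<^sub>R (e ^^ k) v = 0"
    using fe_power[of v 0 d k] assms(1,3) k linear_0[OF lin(2)] by simp
  then have "d = real k * real (Suc k)" using k(1) by (simp add: mult.commute)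
  then show ?thesis by blast
qed

end

lemma (in sl2_action) swap: "sl2_action f e (\<lambda>v. - h v)"
proof (rule sl2_action.intro)
  show "linear f" by (rule lin)
  show "linear e" by (rule lin)
  show "linear (\<lambda>v. - h v)" by (rule linear_compose_neg[OF lin(3)])
  show "f (e v) = e (f v) + - h v" for v using ef[of v] by simp
  show "- h (f v) = f (- h v) + 2 *\<^sub>R f v" for v by (simp add: linear_neg[OF lin(2)] hf)
  show "- h (e v) = e (- h v) - 2 *\<^sub>R e v" for v by (simp add: linear_neg[OF lin(1)] he)
qed

context sl2_action
begin

lemma fe_inj: "h v = c *\<^sub>R v \<Longrightarrow> c < 0 \<Longrightarrow> f (e v) = 0 \<Longrightarrow> v = 0"
  using sl2_action.ef_inj[OF swap, of v "- c"] by simp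

text \<open>Descend from the top of the \<open>e\<close>-string through \<open>v\<close>.\<close>

lemma reflect_nonneg:
  assumes hv: "h v = real n *\<^sub>R v" and "v \<noteq> 0"
  shows "\<exists>p t. t = p + n \<and> (f ^^ t) ((e ^^ p) v) \<noteq> 0"
proof -
  obtain p where p: "(e ^^ p) v \<noteq> 0" "(e ^^ Suc p) v = 0"
    using e_power_vanishes_first assms by blast
  define w where "w = (e ^^ p) v"
  have hw: "h w = (real n + 2 * real p) *\<^sub>R w" unfolding w_def by (rule weight_e_power[OF hv])
  interpret s: sl2_action f e "\<lambda>v. - h v" by (rule swap)
  have few: "f (e w) = 0 *\<^sub>R w" using p linear_0[OF lin(2)] by (simp add: w_def)
  have "(f ^^ t) w \<noteq> 0" if "t \<le> p + n" for t using that
  proof (induction t)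
    case 0 then show ?case using p by (simp add: w_def)
  next
    case (Suc t)
    have "e ((f ^^ Suc t) w) = (0 - real (Suc t) * (- (real n + 2 * real p) + real t)) *\<^sub>R (f ^^ t) w"
      by (rule s.fe_power[OF _ few]) (simp only: hw scaleR_minus_left)
    moreover have "real (Suc t) * (- (real n + 2 * real p) + real t) \<noteq> 0" using Suc.prems by simp
    ultimately have "e ((f ^^ Suc t) w) \<noteq> 0" using Suc by simp
    then show ?case using linear_0[OF lin(1)] by metis
  qed
  then show ?thesis unfolding w_def by blast
qed

text \<open>The vector \<open>(e ^^ Suc n) v\<close> has weight \<open>n + 2\<close> and is
  annihilated by \<open>f\<close>, which no nonzero vector of positive weight is.\<close>

lemma serre_vanishing:
  assumes fv: "f v = 0" and hv: "h v = - real n *\<^sub>R v"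
  shows "(e ^^ Suc n) v = 0"
proof -
  have ef0: "e (f v) = 0 *\<^sub>R v" using fv linear_0[OF lin(1)] by simp
  have "f ((e ^^ Suc n) v) = 0" using fe_power[OF hv ef0, of n] by simp
  then show ?thesis using ef_inj[OF weight_e_power[OF hv, of "Suc n"]] linear_0[OF lin(1)] by simp
qed

end

section \<open>Representations of Chevalley generators\<close>

lemma mscale_component [simp]: "(c *\<^sub>M A) $ i $ j = c * A $ i $ j"
  by (simp add: mscale_def map_matrix_def)

lemma mscale_matrix_mult:
  "(c *\<^sub>M A) ** B = c *\<^sub>M (A ** B)" "A ** (c *\<^sub>M B) = c *\<^sub>M (A ** B)"
  by (simp_all add: vec_eq_iff matrix_matrix_mult_def sum_distrib_left mult_ac)

lemma mscale_vector_mult: "(c *\<^sub>M A) *v x = c *s (A *v x)"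
  by (simp add: vec_eq_iff matrix_vector_mult_def sum_distrib_left mult_ac)

lemma matrix_vector_mult_minus: "(- A) *v x = - (A *v (x :: complex^'n))"
  by (simp add: vec_eq_iff matrix_vector_mult_def sum_negf)

lemma mscale_of_real: "complex_of_real c *\<^sub>M A = c *\<^sub>R A"
  unfolding vec_eq_iff by (auto simp: scaleR_conv_of_real[where ?'a=complex])

lemma vector_scale_of_real: "complex_of_real c *s x = c *\<^sub>R x"
  unfolding vec_eq_iff by (auto simp: scaleR_conv_of_real[where ?'a=complex])

lemma vector_scale_of_int: "complex_of_int m *s x = real_of_int m *\<^sub>R x"
  using vector_scale_of_real[of "real_of_int m"] by simp

lemma matrix_diff_distribs:
  fixes A B C :: "'a::ring_1^'n^'n"
  shows "A ** (B - C) = A ** B - A ** C" "(A - B) ** C = A ** C - B ** C"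
    "A ** (B + C) = A ** B + A ** C" "(A + B) ** C = A ** C + B ** C"
    "A ** - B = - (A ** B)" "- A ** B = - (A ** B)"
  by (simp_all add: vec_eq_iff matrix_matrix_mult_def algebra_simps sum.distrib sum_subtractf sum_negf)

lemma linear_bracket: "linear (bracket A)"
  by (rule linearI)
    (simp_all add: bracket_def matrix_diff_distribs mscale_matrix_mult cmat.scale_right_diff_distrib flip: mscale_of_real)

lemma bracket_jacobi: "bracket A (bracket B X) = bracket B (bracket A X) + bracket (bracket A B) X"
  by (simp add: bracket_def matrix_diff_distribs matrix_mul_assoc)

lemma bracket_mscale: "bracket (c *\<^sub>M A) B = c *\<^sub>M bracket A B" "bracket A (c *\<^sub>M B) = c *\<^sub>M bracket A B"
  by (simp_all add: bracket_def mscale_matrix_mult cmat.scale_right_diff_distrib)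

lemma bracket_vector: "A *v (B *v x) = B *v (A *v x) + bracket A B *v x"
  by (simp add: bracket_def matrix_vector_mul_assoc matrix_vector_mult_diff_rdistrib)

lemmas vec_lin = vector_scalar_commute vector_smult_assoc

lemmas vector_linear_simps = matrix_vector_right_distrib vec.scale_right_distrib
  vector_scalar_commute vec.scale_left_commute

declare vector_sub_rdistrib [simp del] vector_sadd_rdistrib [simp del]

text \<open>\<open>E\<close>, \<open>F\<close>, \<open>K\<close> are the images of the Chevalley generators \<open>e\<^sub>i\<close>, \<open>f\<^sub>i\<close>, \<open>h\<^sub>i\<close>.\<close>

locale chevalley_rep =
  fixes r :: nat and C :: "nat \<Rightarrow> nat \<Rightarrow> int" and E F K :: "nat \<Rightarrow> complex^'n^'n"
  assumes C_diag: "i < r \<Longrightarrow> C i i = 2"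
    and KK: "i < r \<Longrightarrow> j < r \<Longrightarrow> bracket (K i) (K j) = 0"
    and KE: "i < r \<Longrightarrow> j < r \<Longrightarrow> bracket (K j) (E i) = of_int (C i j) *\<^sub>M E i"
    and KF: "i < r \<Longrightarrow> j < r \<Longrightarrow> bracket (K j) (F i) = of_int (- C i j) *\<^sub>M F i"
    and EF: "i < r \<Longrightarrow> j < r \<Longrightarrow> bracket (E i) (F j) = (if i = j then K i else 0)"
begin

text \<open>The Chevalley involution. The Cartan matrix stays the same, so every result on raising
  operators has a twin on lowering operators.\<close>

lemma swap: "chevalley_rep r C F E (\<lambda>i. - K i)"
proof (rule chevalley_rep.intro)
  have neg: "bracket (- A) B = - bracket A B" "bracket B (- A) = - bracket B A" "bracket A B = - bracket B A"
    for A B :: "complex^'n^'n" by (simp_all add: bracket_def matrix_diff_distribs)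
  show "bracket (- K i) (- K j) = 0" if "i < r" "j < r" for i j
    using KK[OF that] by (simp add: neg(1,2))
  show "bracket (- K j) (F i) = of_int (C i j) *\<^sub>M F i" if "i < r" "j < r" for i j
    using KF[OF that] by (simp add: neg(1,2))
  show "bracket (- K j) (E i) = of_int (- C i j) *\<^sub>M E i" if "i < r" "j < r" for i j
    using KE[OF that] by (simp add: neg(1,2))
  show "bracket (F i) (E j) = (if i = j then - K i else 0)" if "i < r" "j < r" for i j
    using EF[OF that(2,1)] neg(3)[of "F i" "E j"] by auto
qed (rule C_diag)

abbreviation "e i v \<equiv> E i *v v"
abbreviation "f i v \<equiv> F i *v v"

text \<open>A weight is given by its values on the simple coroots. Since \<open>C i j\<close> is the
  value of the simple root \<open>i\<close> on the coroot \<open>j\<close>, the row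
  \<open>C i\<close> is that root itself. The zero vector has every weight.\<close>

definition wt :: "(nat \<Rightarrow> int) \<Rightarrow> complex^'n \<Rightarrow> bool" where
  "wt m v \<longleftrightarrow> (\<forall>j<r. K j *v v = of_int (m j) *s v)"

lemma wt_cong: "wt m v \<Longrightarrow> (\<And>j. j < r \<Longrightarrow> m j = m' j) \<Longrightarrow> wt m' v"
  by (simp add: wt_def)

lemma wt_scale: "wt m v \<Longrightarrow> wt m (c *s v)"
  by (simp add: wt_def vector_scalar_commute mult.commute)

lemma wt_diff: "wt m v \<Longrightarrow> wt m w \<Longrightarrow> wt m (v - w)"
  by (simp add: wt_def matrix_vector_mult_diff_distrib vec.scale_right_diff_distrib)

lemma wt_e: "wt m v \<Longrightarrow> i < r \<Longrightarrow> wt (\<lambda>j. m j + C i j) (e i v)"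
  using bracket_vector[of _ "E i" v]
  by (auto simp: wt_def KE mscale_vector_mult vector_scalar_commute vec.scale_left_distrib)

lemma wt_f: "wt m v \<Longrightarrow> i < r \<Longrightarrow> wt (\<lambda>j. m j - C i j) (f i v)"
  using bracket_vector[of _ "F i" v]
  by (auto simp: wt_def KF mscale_vector_mult matrix_vector_mult_minus vector_scalar_commute vec.scale_left_diff_distrib)

lemma fe_comm: "i < r \<Longrightarrow> j < r \<Longrightarrow> i \<noteq> j \<Longrightarrow> f i (e j v) = e j (f i v)"
  using bracket_vector[of "E j" "F i" v] EF[of j i] by simp

lemma fe_same: "wt m v \<Longrightarrow> i < r \<Longrightarrow> f i (e i v) = e i (f i v) - of_int (m i) *s v"
  using bracket_vector[of "E i" "F i" v] EF[of i i] by (simp add: wt_def)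

lemma wt_real: "wt m v \<Longrightarrow> i < r \<Longrightarrow> K i *v v = real_of_int (m i) *\<^sub>R v"
  by (simp add: wt_def vector_scale_of_int)

lemma sl2: "i < r \<Longrightarrow> sl2_action ((*v) (E i)) ((*v) (F i)) ((*v) (K i))"
proof (rule sl2_action.intro)
  assume i: "i < r"
  show "e i (f i v) = f i (e i v) + K i *v v" for v
    using bracket_vector[of "E i" "F i" v] EF[of i i] i by simp
  show "K i *v e i v = e i (K i *v v) + 2 *\<^sub>R e i v" for v
    using bracket_vector[of "K i" "E i" v] KE[of i i] C_diag i
    by (simp add: mscale_vector_mult vector_scale_of_real[of 2, simplified])
  show "K i *v f i v = f i (K i *v v) - 2 *\<^sub>R f i v" for v
    using bracket_vector[of "K i" "F i" v] KF[of i i] C_diag i vector_scale_of_real[of "- 2" "f i v"]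
    by (simp add: mscale_vector_mult matrix_vector_mult_minus)
qed (rule matrix_vector_mul_linear)+

lemma ef_inj: "wt m v \<Longrightarrow> i < r \<Longrightarrow> m i > 0 \<Longrightarrow> e i (f i v) = 0 \<Longrightarrow> v = 0"
  by (rule sl2_action.ef_inj[OF sl2 wt_real]) auto

lemma fe_inj: "wt m v \<Longrightarrow> i < r \<Longrightarrow> m i < 0 \<Longrightarrow> f i (e i v) = 0 \<Longrightarrow> v = 0"
  by (rule sl2_action.fe_inj[OF sl2 wt_real]) auto

lemma f_inj: "wt m v \<Longrightarrow> i < r \<Longrightarrow> m i > 0 \<Longrightarrow> f i v = 0 \<Longrightarrow> v = 0"
  by (rule ef_inj) auto

lemma e_inj: "wt m v \<Longrightarrow> i < r \<Longrightarrow> m i < 0 \<Longrightarrow> e i v = 0 \<Longrightarrow> v = 0"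
  by (rule fe_inj) auto

text \<open>The Serre relations are consequences of the axioms of the locale: under the adjoint
  action of the \<open>i\<close>-th \<open>sl2\<close>, \<open>E j\<close> is a lowest weight vector
  of weight \<open>C j i\<close>, so \<open>serre_vanishing\<close> applies in the space of
  matrices.\<close>

lemma serre:
  assumes "i < r" "j < r" "i \<noteq> j" "C j i = - int n"
  shows "(bracket (E i) ^^ Suc n) (E j) = 0"
proof -
  have two: "2 *\<^sub>R bracket A B = bracket (2 *\<^sub>M A) B" for A B :: "complex^'n^'n"
    using mscale_of_real[of 2 "bracket A B"] by (simp add: bracket_mscale)
  have neg: "bracket (- A) B = - bracket A B" "bracket A B = - bracket B A" for A B :: "complex^'n^'n"
    by (simp_all add: bracket_def matrix_diff_distribs)
  interpret ad: sl2_action "bracket (E i)" "bracket (F i)" "bracket (K i)"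
  proof (rule sl2_action.intro)
    show "bracket (E i) (bracket (F i) X) = bracket (F i) (bracket (E i) X) + bracket (K i) X" for X
      using bracket_jacobi[of "E i" "F i" X] EF[of i i] assms by simp
    show "bracket (K i) (bracket (E i) X) = bracket (E i) (bracket (K i) X) + 2 *\<^sub>R bracket (E i) X" for X
      using bracket_jacobi[of "K i" "E i" X] KE[of i i] C_diag[of i] assms by (simp add: two)
    show "bracket (K i) (bracket (F i) X) = bracket (F i) (bracket (K i) X) - 2 *\<^sub>R bracket (F i) X" for X
      using bracket_jacobi[of "K i" "F i" X] KF[of i i] C_diag[of i] assms
      by (simp add: two bracket_mscale neg(1))
  qed (rule linear_bracket)+
  have "bracket (K i) (E j) = - real n *\<^sub>R E j"
    using KE[of j i] assms mscale_of_real[of "- real n" "E j"] by simp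
  moreover have "bracket (F i) (E j) = 0" using EF[of j i] assms neg(2)[of "F i" "E j"] by simp
  ultimately show ?thesis by (intro ad.serre_vanishing)
qed

lemma e_comm: "i < r \<Longrightarrow> j < r \<Longrightarrow> i \<noteq> j \<Longrightarrow> C j i = 0 \<Longrightarrow> e i (e j v) = e j (e i v)"
  using serre[of i j 0] bracket_vector[of "E i" "E j" v] by simp

lemma serre_simply_laced:
  assumes "i < r" "j < r" "i \<noteq> j" "C j i = -1"
  shows "e i (e i (e j v)) - 2 *s e i (e j (e i v)) + e j (e i (e i v)) = 0"
proof -
  have "bracket (E i) (bracket (E i) (E j)) *v v = 0" using serre[of i j 1] assms by simp
  then show ?thesis by (simp add: bracket_def matrix_diff_distribs matrix_vector_mult_diff_rdistrib
        vec.scale_left_distrib[of 1 1, simplified] algebra_simps flip: matrix_vector_mul_assoc)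
qed

text \<open>Multiplicity at most one, in the form that directly produces the scalar by which two
  words in the generators differ.\<close>

definition thin :: "(nat \<Rightarrow> int) \<Rightarrow> bool" where
  "thin m \<longleftrightarrow> (\<forall>v w. wt m v \<longrightarrow> wt m w \<longrightarrow> v \<noteq> 0 \<longrightarrow> (\<exists>c. w = c *s v))"

lemma thinD: "thin m \<Longrightarrow> wt m v \<Longrightarrow> wt m w \<Longrightarrow> v \<noteq> 0 \<Longrightarrow> \<exists>c. w = c *s v"
  unfolding thin_def by blast

text \<open>As \<open>f i\<close> is injective at weights positive on coroot \<open>i\<close>, the
  multiplicity of such a weight \<open>m\<close> is at most that of \<open>m\<close> minus the
  simple root \<open>i\<close>. Thinness thus spreads from 0 to simple roots and on to sums of
  them.\<close>

lemma thin_up: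
  assumes t: "thin (\<lambda>j. m j - C i j)" and i: "i < r" "m i > 0"
  shows "thin m"
  unfolding thin_def
proof (intro allI impI)
  fix v w assume v: "wt m v" "v \<noteq> 0" and w: "wt m w"
  have "f i v \<noteq> 0" using f_inj v i by blast
  then obtain c where c: "f i w = c *s f i v" using thinD[OF t wt_f wt_f] v w i by blast
  have "f i (w - c *s v) = 0" by (simp add: c matrix_vector_mult_diff_distrib vector_scalar_commute)
  then have "w - c *s v = 0" using f_inj[OF wt_diff[OF w wt_scale[OF v(1)]] i] by blast
  then show "\<exists>c. w = c *s v" by auto
qed

end

section \<open>One-dimensional zero weight spaces\<close>

text \<open>
  A representation with a one-dimensional zero weight space \<open>\<complex>u\<close>. The operators \<open>e\<^sub>i\<close>, \<open>f\<^sub>i\<close>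
  act on words applied to \<open>u\<close> by scalars, which the Serre relations tie together.
\<close>

locale zero_line = chevalley_rep r C E F K
  for r :: nat and C :: "nat \<Rightarrow> nat \<Rightarrow> int" and E F K :: "nat \<Rightarrow> complex^'n^'n" +
  fixes u :: "complex^'n"
  assumes wt_u: "wt (\<lambda>_. 0) u" and u_nz: "u \<noteq> 0" and thin_0: "thin (\<lambda>_. 0)"
begin

lemma swap_zero: "zero_line r C F E (\<lambda>i. - K i) u"
proof -
  interpret s: chevalley_rep r C F E "\<lambda>i. - K i" by (rule swap)
  have wt0: "s.wt (\<lambda>_. 0) v \<longleftrightarrow> wt (\<lambda>_. 0) v" for v
    by (simp add: wt_def s.wt_def matrix_vector_mult_minus)
  show ?thesis using wt_u u_nz thin_0 by unfold_locales (simp_all add: wt0 thin_def s.thin_def)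
qed

lemma ef_u: "i < r \<Longrightarrow> e i (f i u) = f i (e i u)"
  using fe_same[OF wt_u] by simp

lemma coef_ex: "i < r \<Longrightarrow> \<exists>c. f i (e i u) = c *s u"
  using thinD[OF thin_0 wt_u _ u_nz] wt_cong[OF wt_f[OF wt_e[OF wt_u]]] by force

text \<open>By \<open>casimir_at_0\<close> the scalar \<open>c\<close> has the form
  \<open>k * (k + 1)\<close>, hence is not negative. The value -1/4 is what
  \<open>c * (a - 1)^2 = a\<close> yields at \<open>a = -1\<close>.\<close>

lemma coef_neq_quarter:
  assumes "i < r" "f i (e i u) = c *s u" shows "c \<noteq> - 1/4"
proof
  assume "c = - 1/4"
  then have "e i (f i u) = (-1/4) *\<^sub>R u" using ef_u assms vector_scale_of_real[of "-1/4" u] by simp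
  moreover have "K i *v u = 0" using wt_u assms by (simp add: wt_def)
  ultimately obtain k :: nat where "-1/4 = real k * real (Suc k)"
    using sl2_action.casimir_at_0[OF sl2] assms u_nz by blast
  then show False using mult_nonneg_nonneg[of "real k" "real (Suc k)"] by linarith
qed

lemma coef_nz:
  assumes "i < r" "e i u \<noteq> 0" "f i (e i u) = c *s u" shows "c \<noteq> 0"
  using f_inj[OF wt_e[OF wt_u]] assms C_diag by force

lemma wt_eu: "i < r \<Longrightarrow> wt (C i) (e i u)"
  using wt_e[OF wt_u] by simp

lemma wt_eeu: "i < r \<Longrightarrow> j < r \<Longrightarrow> wt (\<lambda>k. C i k + C j k) (e j (e i u))"
  by (rule wt_e[OF wt_eu])

lemma thin_root: "i < r \<Longrightarrow> thin (C i)"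
  using thin_up[of "C i" i] thin_0 C_diag by simp

lemma fee_u:
  assumes "i < r" "f i (e i u) = c *s u"
  shows "f i (e i (e i u)) = (c - 2) *s e i u"
  using fe_same[OF wt_eu] assms C_diag
  by (simp add: vector_scalar_commute vec.scale_left_diff_distrib)

text \<open>The first equation results from applying \<open>f i\<close> to the relation defining
  \<open>a\<close>, as \<open>f i\<close> commutes with \<open>e j\<close>. For the second,
  \<open>f i\<close> is applied to the Serre relation on \<open>u\<close>; each of its three terms
  becomes a multiple of \<open>P\<close>.\<close>

lemma edge_half:
  assumes ij: "i < r" "j < r" "i \<noteq> j" "C j i = -1"
    and nz: "e j u \<noteq> 0" and a: "e j (e i u) = a *s e i (e j u)" "a \<noteq> 0"
    and c: "f i (e i u) = c *s u"
  shows "f i (e i (e j u)) = (c/a) *s e j u" "c * (a - 1)\<^sup>2 = a"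
proof -
  define P where "P = e i (e j u)"
  have wP: "wt (\<lambda>k. C j k + C i k) P" unfolding P_def using wt_eeu ij by blast
  have P: "P \<noteq> 0" unfolding P_def using e_inj[OF wt_eu] nz ij by fastforce
  have "a *s f i P = f i (e j (e i u))" by (simp add: a P_def vector_scalar_commute)
  also have "\<dots> = c *s e j u" using fe_comm[of i j "e i u"] c ij by (simp add: vector_scalar_commute)
  finally have "(1/a) *s (a *s f i P) = (1/a) *s (c *s e j u)" by simp
  then show fP: "f i (e i (e j u)) = (c/a) *s e j u" using a(2) by (simp add: P_def vector_smult_assoc)
  have feP: "f i (e i P) = (c/a - 1) *s P" using fe_same[OF wP, of i] fP ij C_diag
    by (simp add: P_def vector_scalar_commute vec.scale_left_diff_distrib)
  have "f i (e i P) - 2 *s f i (e i (e j (e i u))) + f i (e j (e i (e i u))) = 0"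
    using arg_cong[OF serre_simply_laced[of i j u], of "\<lambda>v. f i v"] ij
    by (simp add: P_def matrix_vector_right_distrib matrix_vector_mult_diff_distrib vector_scalar_commute)
  moreover have "f i (e i (e j (e i u))) = (a * (c/a - 1)) *s P"
    by (simp only: a(1) vec_lin feP flip: P_def)
  moreover have "f i (e j (e i (e i u))) = ((c - 2) * a) *s P"
    using fe_comm[of i j] fee_u[OF _ c] ij a(1)
    by (simp add: vec_lin P_def)
  ultimately have "((c/a - 1) - 2 * (a * (c/a - 1)) + (c - 2) * a) *s P = 0"
    by (simp add: feP vec.scale_left_distrib vec.scale_left_diff_distrib vector_smult_assoc)
  then have "(c/a - 1) - 2 * (a * (c/a - 1)) + (c - 2) * a = 0" using P by simp
  then show "c * (a - 1)\<^sup>2 = a" using a(2) by (simp add: field_simps power2_eq_square) algebra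
qed

text \<open>Seen from \<open>j\<close>, the edge has the scalar \<open>1/a\<close>, and
  \<open>c' * (1/a - 1)^2 = 1/a\<close> is the same as \<open>c' * (a - 1)^2 = a\<close>. So both
  ends share one \<open>c\<close>.\<close>

lemma edge:
  assumes ij: "i < r" "j < r" "i \<noteq> j" "C i j = -1" "C j i = -1"
    and nz: "e i u \<noteq> 0" "e j u \<noteq> 0"
  obtains c a where "f i (e i u) = c *s u" "f j (e j u) = c *s u" "c \<noteq> 0"
    "e j (e i u) = a *s e i (e j u)" "a \<noteq> 0" "c * (a - 1)\<^sup>2 = a"
proof -
  obtain c c' where c: "f i (e i u) = c *s u" "f j (e j u) = c' *s u" using coef_ex ij by metis
  have P: "e i (e j u) \<noteq> 0" "e j (e i u) \<noteq> 0"
    using e_inj[OF wt_eu, of j i] e_inj[OF wt_eu, of i j] nz ij by auto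
  have "thin (\<lambda>k. C j k + C i k)"
    using thin_up[of "\<lambda>k. C j k + C i k" i] thin_root[of j] ij C_diag by simp
  from thinD[OF this wt_eeu wt_cong[OF wt_eeu] P(1)] ij
  obtain a where a: "e j (e i u) = a *s e i (e j u)" by (metis add.commute)
  then have a0: "a \<noteq> 0" using P by auto
  have 1: "c * (a - 1)\<^sup>2 = a" using edge_half(2)[of i j a c] ij nz a a0 c by simp
  have "e i (e j u) = (1/a) *s e j (e i u)" using a a0 by (simp add: vector_smult_assoc)
  then have 2: "c' * (1/a - 1)\<^sup>2 = 1/a" using edge_half(2)[of j i "1/a" c'] ij nz a0 c by simp
  have m: "(1/a - 1) * a = 1 - a" using a0 by (simp add: left_diff_distrib)
  have "c' * (a - 1)\<^sup>2 = c' * ((1/a - 1) * a)\<^sup>2" unfolding m by (simp add: power2_commute)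
  also have "\<dots> = (c' * (1/a - 1)\<^sup>2) * a\<^sup>2" by (simp add: power_mult_distrib)
  also have "\<dots> = a" unfolding 2 using a0 by (simp add: power2_eq_square)
  finally have "c' * (a - 1)\<^sup>2 = a" .
  then have "c = c'" using 1 a0 by (metis mult_eq_0_iff mult_right_cancel)
  then show thesis using that c a a0 1 coef_nz[OF ij(1) nz(1)] by blast
qed

text \<open>The scalars of two edges meeting in \<open>j\<close> are inverse to each other, so three edges cannot meet.\<close>

lemma edges_inverse:
  assumes lt: "i < r" "j < r" "l < r" "i \<noteq> j" "l \<noteq> j" "i \<noteq> l"
    and C: "C i j = -1" "C j i = -1" "C l j = -1" "C j l = -1" "C i l = 0" "C l i = 0"
    and nz: "e j u \<noteq> 0" and c: "f i (e i u) = c *s u" "f j (e j u) = c *s u" "c \<noteq> 0"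
    and a: "e j (e i u) = a *s e i (e j u)" "a \<noteq> 0" "c * (a - 1)\<^sup>2 = a"
    and b: "e j (e l u) = b *s e l (e j u)" "b \<noteq> 0"
  shows "a * b = 1"
proof -
  have il: "e i (e l v) = e l (e i v)" for v using e_comm lt C by blast
  define x where "x = e i (e l (e j u))"
  have "e l (e j u) \<noteq> 0" using e_inj[OF wt_eu, of j l] lt C nz by auto
  then have x: "x \<noteq> 0" unfolding x_def using e_inj[OF wt_eeu, of j l i] lt C by auto
  have wx: "wt (\<lambda>k. C j k + C l k + C i k) x"
    unfolding x_def by (rule wt_e[OF wt_eeu]) (use lt in auto)
  have "thin (\<lambda>k. C j k + C l k)"
    using thin_up[of "\<lambda>k. C j k + C l k" l] thin_root[of j] lt C C_diag by simp
  then have "thin (\<lambda>k. C j k + C l k + C i k)"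
    using thin_up[of "\<lambda>k. C j k + C l k + C i k" i] lt C C_diag by simp
  moreover have "wt (\<lambda>k. C j k + C l k + C i k) (e j (e i (e l u)))"
    by (rule wt_cong[OF wt_e[OF wt_eeu]]) (use lt in auto)
  ultimately obtain y where y: "e j (e i (e l u)) = y *s x" using thinD wx x by blast
  have fij: "f i (e i (e j u)) = (c/a) *s e j u" using edge_half(1)[of i j a c] lt C nz a c by simp
  have "f i (e j (e i (e l u))) = (c * b) *s e l (e j u)" using lt b by (simp add: fe_comm il c vec_lin)
  moreover have "f i x = (c/a) *s e l (e j u)"
    unfolding x_def il using lt by (simp add: fe_comm fij vec_lin)
  ultimately have "(c * b) *s e l (e j u) = (y * (c/a)) *s e l (e j u)"
    using y by (metis vec_lin)
  then have yab: "y = a * b" using \<open>e l (e j u) \<noteq> 0\<close> c(3) a(2) by (simp add: field_simps)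
  have fjx: "f j x = c *s e i (e l u)" unfolding x_def using lt by (simp add: fe_comm c vec_lin)
  have fejx: "f j (e j x) = (c * y) *s x"
    using fe_same[OF wx, of j] lt C C_diag fjx y by (simp add: vec_lin)
  have ibx: "e i (e j (e l u)) = b *s x" by (simp add: b vec_lin x_def)
  have "f j (e j (e l u)) = (b * c) *s e l u" unfolding b using lt by (simp add: fe_comm c vec_lin)
  then have fje: "f j (e j (e j (e l u))) = (b * c - 1) *s e j (e l u)"
    using fe_same[OF wt_eeu[of l j], of j] lt C C_diag by (simp add: vec_lin vec.scale_left_diff_distrib)
  \<comment> \<open>The Serre relation between \<open>e j\<close> and \<open>e i\<close> on
    \<open>e l u\<close>, with \<open>f j\<close> applied to make every term a multiple of
    \<open>x\<close>. It says \<open>c * (y - b)^2 = b\<close>; with \<open>y = a * b\<close> and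
    \<open>c * (a - 1)^2 = a\<close> this becomes \<open>a * b = 1\<close>.\<close>
  have "f j (e j (e j (e i (e l u)))) - 2 *s f j (e j (e i (e j (e l u)))) + f j (e i (e j (e j (e l u)))) = 0"
    using arg_cong[OF serre_simply_laced[of j i "e l u"], of "\<lambda>v. f j v"] lt C
    by (simp add: matrix_vector_right_distrib matrix_vector_mult_diff_distrib vec_lin)
  moreover have "f j (e j (e j (e i (e l u)))) = (y * (c * y)) *s x" by (simp add: y vec_lin fejx)
  moreover have "f j (e j (e i (e j (e l u)))) = (b * (c * y)) *s x" by (simp add: ibx vec_lin fejx)
  moreover have "f j (e i (e j (e j (e l u)))) = ((b * c - 1) * b) *s x"
    using lt by (simp add: fe_comm fje vec_lin ibx)
  ultimately have "(y * (c * y) - 2 * (b * (c * y)) + (b * c - 1) * b) *s x = 0"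
    by (simp add: vec.scale_left_distrib vec.scale_left_diff_distrib vec_lin)
  then have "y * (c * y) - 2 * (b * (c * y)) + (b * c - 1) * b = 0" using x by simp
  then have "b * (b * (c * (a - 1)\<^sup>2) - 1) = 0" unfolding yab by (simp add: algebra_simps power2_eq_square)
  then show ?thesis using b(2) a(3) by (simp add: mult.commute)
qed

text \<open>By \<open>edge\<close> the three edges share the \<open>c\<close> of the centre.
  Pairwise inverse scalars have square 1; the value 1 violates \<open>c * (a - 1)^2 = a\<close>, and
  -1 forces \<open>c = -1/4\<close>.\<close>

lemma no_D4:
  assumes lt: "j < r" "i1 < r" "i2 < r" "i3 < r"
    and d: "distinct [j, i1, i2, i3]"
    and C: "\<And>i. i \<in> {i1, i2, i3} \<Longrightarrow> C i j = -1 \<and> C j i = -1"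
      "\<And>i l. i \<in> {i1, i2, i3} \<Longrightarrow> l \<in> {i1, i2, i3} \<Longrightarrow> i \<noteq> l \<Longrightarrow> C i l = 0"
    and nz: "e j u \<noteq> 0" "\<And>i. i \<in> {i1, i2, i3} \<Longrightarrow> e i u \<noteq> 0"
  shows False
proof -
  obtain c where c: "f j (e j u) = c *s u" using coef_ex lt by blast
  have ex: "\<exists>a. f i (e i u) = c *s u \<and> c \<noteq> 0 \<and> e j (e i u) = a *s e i (e j u) \<and> a \<noteq> 0 \<and> c * (a - 1)\<^sup>2 = a"
    if i: "i \<in> {i1, i2, i3}" for i
  proof -
    obtain c' a where *: "f i (e i u) = c' *s u" "f j (e j u) = c' *s u" "c' \<noteq> 0"
      "e j (e i u) = a *s e i (e j u)" "a \<noteq> 0" "c' * (a - 1)\<^sup>2 = a"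
      by (rule edge[of i j]) (use i lt d C nz in auto)
    then have "c' = c" using c u_nz by simp
    then show ?thesis using * by blast
  qed
  obtain a where a: "\<And>i. i \<in> {i1, i2, i3} \<Longrightarrow> f i (e i u) = c *s u \<and> c \<noteq> 0 \<and>
      e j (e i u) = a i *s e i (e j u) \<and> a i \<noteq> 0 \<and> c * (a i - 1)\<^sup>2 = a i" using ex by metis
  have inv: "a i * a l = 1" if "i \<in> {i1, i2, i3}" "l \<in> {i1, i2, i3}" "i \<noteq> l" for i l
    by (rule edges_inverse[of i j l c]) (use that lt d C nz a c in auto)
  have "a i1 * a i2 = 1" "a i1 * a i3 = 1" "a i2 * a i3 = 1" using inv d by auto
  then have "(a i1)\<^sup>2 = 1" by algebra
  moreover have "a i1 \<noteq> 1" using a[of i1] by auto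
  ultimately have "a i1 = -1" by (simp add: power2_eq_1_iff)
  then have "c * 4 = -1" using a[of i1] by auto
  then have "c = -1/4" by (simp add: field_simps)
  then show False using coef_neq_quarter[OF lt(1) c] by simp
qed

text \<open>The word \<open>e i (f j (e j (f i u)))\<close> is evaluated twice: once with
  \<open>e i\<close> moved inwards, which brings in \<open>a\<close>, and once through
  \<open>e j (f j (f i u))\<close>, which brings in \<open>a'\<close>.\<close>

lemma edge_dual:
  assumes ij: "i < r" "j < r" "i \<noteq> j" "C i j = -1" "C j i = -1"
    and nz: "e j u \<noteq> 0" and c: "f i (e i u) = c *s u" "f j (e j u) = c *s u" "c \<noteq> 0"
    and a: "e j (e i u) = a *s e i (e j u)" "a \<noteq> 0"
    and a': "f j (f i u) = a' *s f i (f j u)"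
  shows "a * a' = 1"
proof -
  have "e i (e j (f i u)) = f i (e i (e j u)) - e j u"
    using fe_same[OF wt_eu[of j], of i] ij by (simp add: fe_comm)
  also have "\<dots> = (c/a - 1) *s e j u"
    using edge_half(1)[of i j a c] ij nz a c by (simp add: vector_sub_rdistrib)
  finally have "f j (e i (e j (f i u))) = f j ((c/a - 1) *s e j u)" by simp
  then have 1: "e i (f j (e j (f i u))) = ((c/a - 1) * c) *s u"
    using ij c by (simp add: fe_comm vec_lin)
  have "e j (f j (f i u)) = (a' * c) *s f i u"
    unfolding a' using ij c by (simp add: fe_comm[symmetric] ef_u vec_lin)
  then have "f j (e j (f i u)) = (a' * c - 1) *s f i u"
    using fe_same[OF wt_f[OF wt_u], of i j] ij by (simp add: vector_sub_rdistrib)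
  then have "((a' * c - 1) * c) *s u = ((c/a - 1) * c) *s u" using 1 ij c by (simp add: vec_lin ef_u)
  then have "a' * c - 1 = c/a - 1" using u_nz c(3) by (simp only: vector_mul_rcancel) simp
  then have "a * a' * c = c" using a(2) by (simp add: field_simps)
  then show ?thesis using c(3) by simp
qed

text \<open>The counterpart of \<open>edge_half\<close> where \<open>p\<close> is long and
  \<open>q\<close> short; the Serre relation with \<open>e p\<close> twice and \<open>e q\<close>
  once is still the simply laced one. As \<open>e p u\<close> may be 0, \<open>b\<close> may vanish,
  and \<open>y\<close> takes the place of the quotient \<open>c / b\<close>.\<close>

lemma double_edge:
  assumes pq: "p < r" "q < r" "p \<noteq> q" "C p q = -2" "C q p = -1" and nz: "e q u \<noteq> 0"
    and c: "f p (e p u) = c *s u"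
  obtains b y where "e p (e q u) \<noteq> 0" "e q (e p u) = b *s e p (e q u)"
    "f p (e p (e q u)) = y *s e q u" "b * y = c" "y - 1 - 2 * c + c * b = 0"
proof -
  define P where "P = e p (e q u)"
  have wP: "wt (\<lambda>k. C q k + C p k) P" unfolding P_def using wt_eeu pq by blast
  have P: "P \<noteq> 0" unfolding P_def using e_inj[OF wt_eu, of q p] nz pq by auto
  have "thin (\<lambda>k. C q k + C p k)"
    using thin_up[of "\<lambda>k. C q k + C p k" p] thin_root[of q] pq C_diag by simp
  from thinD[OF this wP wt_cong[OF wt_eeu] P] pq
  obtain b where b: "e q (e p u) = b *s P" by (metis add.commute)
  have "wt (C q) (f p P)" by (rule wt_cong[OF wt_f[OF wP]]) (use pq in auto)
  then obtain y where y: "f p P = y *s e q u" using thinD[OF thin_root wt_eu] nz pq by blast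
  have "b *s f p P = c *s e q u"
    using arg_cong[OF b, of "\<lambda>v. f p v"] pq c by (simp add: fe_comm vec_lin)
  then have by_c: "b * y = c" using nz by (simp add: y vec_lin)
  have feP: "f p (e p P) = (y - 1) *s P"
    using fe_same[OF wP, of p] pq C_diag y by (simp add: vec_lin P_def vector_sub_rdistrib)
  have "f p (e p P) - 2 *s f p (e p (e q (e p u))) + f p (e q (e p (e p u))) = 0"
    using arg_cong[OF serre_simply_laced[of p q u], of "\<lambda>v. f p v"] pq
    by (simp add: P_def matrix_vector_right_distrib matrix_vector_mult_diff_distrib vec_lin)
  moreover have "f p (e p (e q (e p u))) = (b * (y - 1)) *s P" by (simp add: b vec_lin feP)
  moreover have "f p (e q (e p (e p u))) = ((c - 2) * b) *s P"
    using fee_u[OF _ c] pq by (simp add: fe_comm b vec_lin)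
  ultimately have "((y - 1) - 2 * (b * (y - 1)) + (c - 2) * b) *s P = 0"
    by (simp add: feP vec.scale_left_distrib vec.scale_left_diff_distrib vec_lin)
  then have "(y - 1) - 2 * (b * (y - 1)) + (c - 2) * b = 0"
    using P by (simp only: vector_mul_eq_0) simp
  then have "y - 1 - 2 * (b * y) + c * b = 0" by (simp add: algebra_simps)
  then show thesis by (intro that[of b y]) (use P b y by_c in \<open>simp_all add: P_def\<close>)
qed

text \<open>The same double evaluation as in \<open>edge_dual\<close>, of the word
  \<open>e p (f q (e q (f p u)))\<close>. The 2 is the value of the weight of \<open>f p u\<close>
  on coroot \<open>q\<close>.\<close>

lemma double_edge_dual:
  assumes pq: "p < r" "q < r" "p \<noteq> q" "C p q = -2" "C q p = -1"
    and c: "f p (e p u) = c1 *s u" "f q (e q u) = c *s u"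
    and y: "f p (e p (e q u)) = y *s e q u"
    and b': "f q (f p u) = b' *s f p (f q u)"
  shows "(b' * c - 2) * c1 = (y - 1) * c"
proof -
  have "e p (e q (f p u)) = f p (e p (e q u)) - e q u"
    using fe_same[OF wt_eu[of q], of p] pq by (simp add: fe_comm)
  also have "\<dots> = (y - 1) *s e q u" using y by (simp add: vector_sub_rdistrib)
  finally have "f q (e p (e q (f p u))) = f q ((y - 1) *s e q u)" by simp
  then have 1: "e p (f q (e q (f p u))) = ((y - 1) * c) *s u" using pq c by (simp add: fe_comm vec_lin)
  have "e q (f q (f p u)) = (b' * c) *s f p u"
    unfolding b' using pq c by (simp add: fe_comm[symmetric] ef_u vec_lin)
  then have "f q (e q (f p u)) = (b' * c - 2) *s f p u"
    using fe_same[OF wt_f[OF wt_u], of p q] pq by (simp add: vector_sub_rdistrib)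
  then have "((b' * c - 2) * c1) *s u = ((y - 1) * c) *s u" using 1 pq c by (simp add: vec_lin ef_u)
  then show ?thesis using u_nz by (simp only: vector_mul_rcancel) simp
qed

text \<open>For the first claim, the Serre relation between \<open>e q\<close> and
  \<open>e s\<close> on \<open>e p u\<close>, followed by \<open>f q\<close>, becomes a quadratic
  equation for the scalar \<open>y\<close> with \<open>y * a = b\<close>; its roots are the two
  alternatives.\<close>

lemma double_edge_chain:
  assumes lt: "p < r" "q < r" "s < r" "p \<noteq> q" "q \<noteq> s" "p \<noteq> s"
    and C: "C p q = -2" "C q p = -1" "C q s = -1" "C s q = -1" "C p s = 0" "C s p = 0"
    and nz: "e q u \<noteq> 0" "e s u \<noteq> 0"
    and c: "f q (e q u) = c *s u" "f s (e s u) = c *s u" "c \<noteq> 0"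
    and a: "e s (e q u) = a *s e q (e s u)" "a \<noteq> 0" "c * (a - 1)\<^sup>2 = a"
    and b: "e q (e p u) = b *s e p (e q u)"
  shows "b = 0 \<or> b = 2 * a - 1"
    and "b = 0 \<Longrightarrow> a * c = 1"
proof -
  define P where "P = e p (e q u)"
  define x where "x = e s P"
  have wP: "wt (\<lambda>k. C q k + C p k) P" unfolding P_def using wt_eeu lt by blast
  have wx: "wt (\<lambda>k. C q k + C p k + C s k) x" unfolding x_def by (rule wt_e[OF wP]) (rule lt)
  have P: "P \<noteq> 0" unfolding P_def using e_inj[OF wt_eu, of q p] nz lt C by auto
  have x: "x \<noteq> 0" unfolding x_def using e_inj[OF wP, of s] P lt C by auto
  have sp: "e s (e p v) = e p (e s v)" for v using e_comm lt C by metis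
  have bP: "e q (e p u) = b *s P" using b by (simp add: P_def)
  have fqP: "f q P = c *s e p u" unfolding P_def using lt c by (simp add: fe_comm vec_lin)
  have fsx: "f s x = (a * c) *s P"
    unfolding x_def P_def sp using lt c a(1) by (simp add: fe_comm vec_lin)
  have feP: "f q (e q P) = (b * c) *s P"
    using fe_same[OF wP, of q] lt C C_diag by (simp add: fqP bP vec_lin mult.commute)
  have "thin (\<lambda>k. C q k + C p k)"
    using thin_up[of "\<lambda>k. C q k + C p k" p] thin_root[of q] lt C C_diag by simp
  then have "thin (\<lambda>k. C q k + C p k + C s k)"
    using thin_up[of "\<lambda>k. C q k + C p k + C s k" s] lt C C_diag by simp
  moreover have "wt (\<lambda>k. C q k + C p k + C s k) (e q (e s (e p u)))"
    by (rule wt_cong[OF wt_e[OF wt_eeu]]) (use lt in auto)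
  ultimately obtain y where y: "e q (e s (e p u)) = y *s x" using thinD wx x by blast
  have "f s (e q (e s (e p u))) = (c * b) *s P" unfolding sp using lt c bP by (simp add: fe_comm vec_lin)
  then have "(y * (a * c)) *s P = (c * b) *s P" using y fsx by (metis vec_lin)
  then have yab: "y * a = b" using P c(3) by (simp only: vector_mul_rcancel) simp
  have fqx: "f q x = c *s e s (e p u)" unfolding x_def using lt by (simp add: fe_comm fqP vec_lin)
  have fex: "f q (e q x) = (c * y + 1) *s x"
    using fe_same[OF wx, of q] lt C C_diag fqx y by (simp add: vec_lin vector_sadd_rdistrib)
  show "b = 0 \<or> b = 2 * a - 1"
  proof -
    have "f q (e q (e q (e s (e p u)))) - 2 *s f q (e q (e s (e q (e p u)))) + f q (e s (e q (e q (e p u)))) = 0"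
      using arg_cong[OF serre_simply_laced[of q s "e p u"], of "\<lambda>v. f q v"] lt C
      by (simp add: matrix_vector_right_distrib matrix_vector_mult_diff_distrib vec_lin)
    moreover have "f q (e q (e q (e s (e p u)))) = (y * (c * y + 1)) *s x" by (simp add: y vec_lin fex)
    moreover have "f q (e q (e s (e q (e p u)))) = (b * (c * y + 1)) *s x"
      by (simp add: bP vec_lin fex flip: x_def)
    moreover have "f q (e s (e q (e q (e p u)))) = (b * (b * c)) *s x"
      using lt by (simp add: bP vec_lin feP fe_comm flip: x_def)
    ultimately have "(y * (c * y + 1) - 2 * (b * (c * y + 1)) + b * (b * c)) *s x = 0"
      by (simp add: vec.scale_left_distrib vec.scale_left_diff_distrib vec_lin)
    then have "y * (c * y + 1) - 2 * (b * (c * y + 1)) + b * (b * c) = 0"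
      using x by (simp only: vector_mul_eq_0) simp
    then have "y * (y * (c * (a - 1)\<^sup>2) + 1 - 2 * a) = 0"
      unfolding yab[symmetric] by (simp add: algebra_simps power2_eq_square)
    then have "y = 0 \<or> y * a + 1 - 2 * a = 0" by (simp add: a(3))
    then show ?thesis using yab by (auto simp: algebra_simps)
  qed
  assume b0: "b = 0"
  \<comment> \<open>With \<open>b = 0\<close> the vectors \<open>e q P\<close> and
    \<open>e s (e q x)\<close> vanish: their weights are positive on coroots \<open>q\<close> and
    \<open>s\<close>, and \<open>f q\<close> and \<open>f s\<close> annihilate them. The Serre
    relation between \<open>e s\<close> and \<open>e q\<close> on \<open>P\<close> then leaves only
    \<open>e q (e s x) = 0\<close>, and applying \<open>f s\<close> turns this into
    \<open>(a * c - 1) *s e q x = 0\<close>.\<close>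
  have wqP: "wt (\<lambda>k. C q k + C p k + C q k) (e q P)" by (rule wt_e[OF wP]) (rule lt)
  have qP: "e q P = 0" using f_inj[OF wqP, of q] lt C C_diag feP b0 by simp
  have fesx: "f s (e s x) = (a * c - 1) *s x"
    using fe_same[OF wx, of s] lt C C_diag fsx by (simp add: vec_lin x_def vector_sub_rdistrib)
  have wqx: "wt (\<lambda>k. C q k + C p k + C s k + C q k) (e q x)" by (rule wt_e[OF wx]) (rule lt)
  have wsqx: "wt (\<lambda>k. C q k + C p k + C s k + C q k + C s k) (e s (e q x))"
    by (rule wt_e[OF wqx]) (rule lt)
  have "f s (e s (e q x)) = 0"
    using fe_same[OF wqx, of s] lt C C_diag fsx qP by (simp add: fe_comm vec_lin)
  then have sqx: "e s (e q x) = 0" using f_inj[OF wsqx, of s] lt C C_diag by simp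
  have "e q (e s x) = 0" using serre_simply_laced[of s q P] lt C sqx qP by (simp add: flip: x_def)
  then have "(a * c - 1) *s e q x = 0" using fe_comm[of s q "e s x"] lt fesx by (simp add: vec_lin)
  moreover have "e q x \<noteq> 0" using e_inj[OF wx, of q] x lt C C_diag by auto
  ultimately show "a * c = 1" by simp
qed

text \<open>The equations for raising and for lowering operators share \<open>c\<close> and
  \<open>c1\<close> and are tied together by \<open>edge_dual\<close> and
  \<open>double_edge_dual\<close>; only jointly are they contradictory.\<close>

lemma no_double_edge_chain:
  assumes lt: "p < r" "q < r" "s < r" "p \<noteq> q" "q \<noteq> s" "p \<noteq> s"
    and C: "C p q = -2" "C q p = -1" "C q s = -1" "C s q = -1" "C p s = 0" "C s p = 0"
    and nz: "e q u \<noteq> 0" "e s u \<noteq> 0"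
  shows False
proof -
  interpret n: zero_line r C F E "\<lambda>i. - K i" u by (rule swap_zero)
  obtain c a where c: "f q (e q u) = c *s u" "f s (e s u) = c *s u" "c \<noteq> 0"
    and a: "e s (e q u) = a *s e q (e s u)" "a \<noteq> 0" "c * (a - 1)\<^sup>2 = a"
    by (rule edge[of q s]) (use assms in auto)
  have c': "e q (f q u) = c *s u" "e s (f s u) = c *s u" using c ef_u lt by auto
  then have nz': "f q u \<noteq> 0" "f s u \<noteq> 0" using c(3) u_nz by auto
  obtain d a' where d: "e q (f q u) = d *s u" "e s (f s u) = d *s u" "d \<noteq> 0"
    and a': "f s (f q u) = a' *s f q (f s u)" "a' \<noteq> 0" "d * (a' - 1)\<^sup>2 = a'"
    by (rule n.edge[of q s]) (use assms nz' in auto)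
  have [simp]: "d = c" using d(1) c'(1) u_nz by simp
  have aa': "a * a' = 1" by (rule edge_dual[of q s c]) (use assms c a a' in auto)
  obtain c1 where c1: "f p (e p u) = c1 *s u" using coef_ex lt by blast
  then have c1': "e p (f p u) = c1 *s u" using ef_u lt by simp
  obtain b y where b: "e q (e p u) = b *s e p (e q u)" "f p (e p (e q u)) = y *s e q u"
    and by_c: "b * y = c1" and y: "y - 1 - 2 * c1 + c1 * b = 0"
    by (rule double_edge[of p q c1]) (use assms c1 in auto)
  obtain b' y' where b': "f q (f p u) = b' *s f p (f q u)" "e p (f p (f q u)) = y' *s f q u"
    and by_c': "b' * y' = c1" and y': "y' - 1 - 2 * c1 + c1 * b' = 0"
    by (rule n.double_edge[of p q c1]) (use assms c1' nz' in auto)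
  show False
  proof (cases "c1 = 0")
    case True
    \<comment> \<open>With \<open>c1 = 0\<close> the equations give \<open>y = 1\<close> and so
      \<open>b = 0\<close>, likewise \<open>b' = 0\<close>. Then \<open>a\<close> and
      \<open>a'\<close> are both inverse to \<open>c\<close>, and \<open>a * a' = 1\<close> leaves
      only 1 and -1 for \<open>a\<close>.\<close>
    then have "b = 0" "b' = 0" using by_c y by_c' y' by auto
    then have "a * c = 1" "a' * c = 1"
      using double_edge_chain(2)[of p q s c a b] n.double_edge_chain(2)[of p q s c a' b'] assms c a b c' nz' d a' b'
      by auto
    then have "a = a'" using c(3) by (metis mult_right_cancel)
    then have "a = 1 \<or> a = -1" using aa' by (simp add: power2_eq_1_iff flip: power2_eq_square)
    then show False
    proof
      assume "a = -1"
      moreover from this have "c = -1" using \<open>a * c = 1\<close> by (simp add: minus_equation_iff)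
      ultimately show False using a(3) by simp
    qed (use a(3) in simp)
  next
    case False
    then have nzb: "b \<noteq> 0" "b' \<noteq> 0" using by_c by_c' by auto
    have ba: "b = 2 * a - 1" using double_edge_chain(1)[of p q s c a b] assms c a b nzb by auto
    have 1: "(b' * c - 2) * c1 = (y - 1) * c"
      by (rule double_edge_dual[of p q]) (use assms c1 c b b' in auto)
    have 2: "(b * c - 2) * c1 = (y' - 1) * c"
      by (rule n.double_edge_dual[of p q]) (use assms c1' c' b b' in auto)
    have cb: "c1 * (1 - b)\<^sup>2 = b" using y by_c by algebra
    \<comment> \<open>Multiplying \<open>1\<close> by \<open>b\<close> and \<open>2\<close> by
      \<open>b'\<close> eliminates \<open>y\<close> and \<open>y'\<close>. The left sides share the
      term with \<open>b * b'\<close>, so the difference factors.\<close>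
    have "b * b' * c * c1 - 2 * b * c1 = c1 * c - b * c" using 1 by_c by algebra
    moreover have "b * b' * c * c1 - 2 * b' * c1 = c1 * c - b' * c" using 2 by_c' by algebra
    ultimately have "(b' - b) * (2 * c1 - c) = 0" by algebra
    then consider "2 * c1 = c" | "b' = b" by auto
    then show False
    proof cases
      case 1
      \<comment> \<open>As \<open>1 - b\<close> is \<open>2 * (1 - a)\<close>, the equations for the
        two edges agree up to the factor 2 between \<open>c\<close> and \<open>c1\<close>; they give
        \<open>2 * a = b\<close>, while \<open>b\<close> is \<open>2 * a - 1\<close>.\<close>
      have "2 * a = 2 * (c * (a - 1)\<^sup>2)" using a(3) by simp
      also have "\<dots> = c1 * (1 - b)\<^sup>2" unfolding ba 1[symmetric] by algebra
      finally show False using cb ba by simp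
    next
      case 2
      have eq: "b\<^sup>2 * c * c1 - 2 * b * c1 = c1 * c - b * c" using 1 by_c \<open>b' = b\<close> by algebra
      have "4 * c1 * (a - 1)\<^sup>2 = c1 * (1 - b)\<^sup>2" unfolding ba by algebra
      then have 4: "4 * c1 * (a - 1)\<^sup>2 = b" using cb by simp
      \<comment> \<open>In terms of \<open>t\<close>, \<open>c\<close> is \<open>a / t\<close> and
        \<open>c1\<close> is \<open>b / (4 * t)\<close>; the factor \<open>4 * t^2\<close> clears
        these denominators in \<open>eq\<close>. What remains is a cubic in \<open>a\<close> with
        roots 1, 1/2 and -1, and 1/2 would mean \<open>b = 0\<close>.\<close>
      define t where "t = (a - 1)\<^sup>2"
      have t: "c * t = a" "4 * c1 * t = b" using a(3) 4 by (simp_all add: t_def)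
      have "4 * t\<^sup>2 * (b\<^sup>2 * c * c1 - 2 * b * c1) = 4 * t\<^sup>2 * (c1 * c - b * c)" using eq by simp
      then have "b * (b\<^sup>2 * a - 2 * b * t) = b * (a - 4 * t * a)" using t by algebra
      then have "b\<^sup>2 * a - 2 * b * t = a - 4 * t * a" using nzb by simp
      then have "2 * (a - 1) * ((2 * a - 1) * (a + 1)) = 0" unfolding ba t_def by algebra
      moreover have "a \<noteq> 1" using a by auto
      ultimately have "a + 1 = 0" using nzb ba by auto
      then have "a = -1" by (simp add: eq_neg_iff_add_eq_0)
      then have "c = -1/4" using a(3) by (simp add: field_simps)
      then show False using coef_neq_quarter lt c by blast
    qed
  qed
qed

end

section \<open>Common eigenvectors\<close>

lemma nontrivial_combination:
  fixes x :: "nat \<Rightarrow> complex^'n"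
  shows "\<exists>c. (\<exists>k\<le>CARD('n). c k \<noteq> 0) \<and> (\<Sum>k\<le>CARD('n). c k *s x k) = 0"
proof (cases "inj_on x {..CARD('n)}")
  case True
  have "\<not> vec.independent (x ` {..CARD('n)})"
  proof
    assume "vec.independent (x ` {..CARD('n)})"
    then have "card (x ` {..CARD('n)}) \<le> CARD('n)"
      using vec.independent_card_le_dim[of "x ` {..CARD('n)}" UNIV] by (simp add: vec_dim_card card_cart_basis)
    then show False by (simp add: card_image[OF True])
  qed
  then obtain q where q: "(\<Sum>v\<in>x ` {..CARD('n)}. q v *s v) = 0" "\<exists>v\<in>x ` {..CARD('n)}. q v \<noteq> 0"
    by (auto simp: vec.dependent_finite)
  then show ?thesis by (intro exI[of _ "q \<circ> x"]) (auto simp: sum.reindex[OF True])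
next
  case False
  then obtain j k where jk: "j \<le> CARD('n)" "k \<le> CARD('n)" "x j = x k" "j \<noteq> k"
    by (auto simp: inj_on_def)
  define c where "c l = (if l = j then 1 else if l = k then - 1 else 0 :: complex)" for l
  have "(\<Sum>l\<le>CARD('n). c l *s x l) = (\<Sum>l\<in>{j, k}. c l *s x l)"
    by (rule sum.mono_neutral_right) (use jk in \<open>auto simp: c_def\<close>)
  also have "\<dots> = 0" using jk by (simp add: c_def)
  finally show ?thesis using jk by (intro exI[of _ c]) (auto simp: c_def)
qed

text \<open>For a root \<open>l\<close> of \<open>p\<close>, with \<open>q\<close> the cofactor,
  \<open>p(A) v = (A - l) (q(A) v)\<close>. Either \<open>q(A) v\<close> is an eigenvector, or it is
  0 and the degree has dropped.\<close>

lemma annihilated_imp_eigenvector: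
  fixes A :: "complex^'n^'n" and p :: "complex poly"
  assumes S: "vec.subspace S" "\<And>v. v \<in> S \<Longrightarrow> A *v v \<in> S"
    and v: "v \<in> S" "v \<noteq> 0"
    and p: "p \<noteq> 0" "(\<Sum>k\<le>degree p. coeff p k *s ((*v) A ^^ k) v) = 0"
  shows "\<exists>w\<in>S. w \<noteq> 0 \<and> (\<exists>l. A *v w = l *s w)"
  using p
proof (induction "degree p" arbitrary: p rule: less_induct)
  case less
  define ev where "ev q = (\<Sum>k\<le>degree q. coeff q k *s ((*v) A ^^ k) v)" for q :: "complex poly"
  have ev_bound: "ev q = (\<Sum>k\<le>N. coeff q k *s ((*v) A ^^ k) v)" if "degree q \<le> N" for q N
    unfolding ev_def by (rule sum.mono_neutral_left) (use that in \<open>auto intro: coeff_eq_0\<close>)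
  have Ak: "((*v) A ^^ k) v \<in> S" for k by (induction k) (auto simp: v S(2))
  have evS: "ev q \<in> S" for q unfolding ev_def by (intro vec.subspace_sum vec.subspace_scale S Ak)
  have "degree p \<noteq> 0"
  proof
    assume "degree p = 0"
    then obtain a where "p = [:a:]" by (metis degree_eq_zeroE)
    then show False using less.prems v by simp
  qed
  then obtain l where "poly p l = 0"
    using Fundamental_Theorem_Algebra.fundamental_theorem_of_algebra[of p] by (auto simp: constant_degree)
  then obtain q where pq: "p = [:- l, 1:] * q" by (auto simp: poly_eq_0_iff_dvd dvd_def)
  have q0: "q \<noteq> 0" using less.prems pq by auto
  have dq: "degree p = Suc (degree q)" unfolding pq using q0 by (subst degree_mult_eq) auto
  have "p = pCons 0 q - smult l q" using pq by (simp add: algebra_simps)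
  have "ev p = (\<Sum>k\<le>Suc (degree q). coeff p k *s ((*v) A ^^ k) v)" by (simp add: ev_def dq)
  also have "\<dots> = (\<Sum>k\<le>Suc (degree q). coeff (pCons 0 q) k *s ((*v) A ^^ k) v)
      - (\<Sum>k\<le>Suc (degree q). (l * coeff q k) *s ((*v) A ^^ k) v)"
    unfolding \<open>p = pCons 0 q - smult l q\<close> by (simp add: vec.scale_left_diff_distrib sum_subtractf)
  also have "(\<Sum>k\<le>Suc (degree q). coeff (pCons 0 q) k *s ((*v) A ^^ k) v)
      = (\<Sum>k\<le>degree q. coeff q k *s (A *v ((*v) A ^^ k) v))" by (subst sum.atMost_Suc_shift) simp
  also have "\<dots> = A *v ev q" by (simp add: ev_def linear_sum[OF matrix_vector_mul_linear] vector_scalar_commute)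
  also have "(\<Sum>k\<le>Suc (degree q). (l * coeff q k) *s ((*v) A ^^ k) v) = l *s ev q"
    using ev_bound[of q "Suc (degree q)"] by (simp add: vec.scale_sum_right vector_smult_assoc)
  finally have "A *v ev q = l *s ev q" using less.prems by (simp add: ev_def)
  show ?case
  proof (cases "ev q = 0")
    case True
    then show ?thesis using less.hyps[of q] dq q0 by (simp add: ev_def)
  next
    case False
    then show ?thesis using evS \<open>A *v ev q = l *s ev q\<close> by blast
  qed
qed

lemma eigenvector_in_subspace:
  fixes A :: "complex^'n^'n"
  assumes S: "vec.subspace S" "\<And>v. v \<in> S \<Longrightarrow> A *v v \<in> S" and v: "v \<in> S" "v \<noteq> 0"
  shows "\<exists>w\<in>S. w \<noteq> 0 \<and> (\<exists>l. A *v w = l *s w)"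
proof -
  let ?N = "CARD('n)"
  obtain c where c: "\<exists>k\<le>?N. c k \<noteq> 0" "(\<Sum>k\<le>?N. c k *s ((*v) A ^^ k) v) = 0"
    using nontrivial_combination[of "\<lambda>k. ((*v) A ^^ k) v"] by blast
  define p where "p = Poly (map c [0..<Suc ?N])"
  have cp: "coeff p k = (if k \<le> ?N then c k else 0)" for k
    by (auto simp: p_def nth_default_def simp del: upt_Suc)
  then have "p \<noteq> 0" using c(1) by (auto simp: poly_eq_iff)
  have "degree p \<le> ?N" by (rule degree_le) (simp add: cp)
  then have "(\<Sum>k\<le>degree p. coeff p k *s ((*v) A ^^ k) v) = (\<Sum>k\<le>?N. coeff p k *s ((*v) A ^^ k) v)"
    by (intro sum.mono_neutral_left) (auto intro: coeff_eq_0)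
  also have "\<dots> = 0" using c(2) by (simp add: cp)
  finally show ?thesis using annihilated_imp_eigenvector[OF S v \<open>p \<noteq> 0\<close>] by blast
qed

lemma common_eigenvector:
  fixes K :: "nat \<Rightarrow> complex^'n^'n"
  assumes comm: "\<And>i j. i < r \<Longrightarrow> j < r \<Longrightarrow> bracket (K i) (K j) = 0"
    and S: "vec.subspace S" "\<And>i v. i < r \<Longrightarrow> v \<in> S \<Longrightarrow> K i *v v \<in> S" and v: "v \<in> S" "v \<noteq> 0"
  shows "\<exists>w\<in>S. w \<noteq> 0 \<and> (\<exists>l. \<forall>i<r. K i *v w = l i *s w)"
proof -
  have "\<exists>w l. w \<in> S \<and> w \<noteq> 0 \<and> (\<forall>i<k. K i *v w = l i *s w)" if "k \<le> r" for k using that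
  proof (induction k)
    case 0 then show ?case using v by auto
  next
    case (Suc k)
    then obtain w l where w: "w \<in> S" "w \<noteq> 0" "\<forall>i<k. K i *v w = l i *s w" by auto
    define T where "T = {x \<in> S. \<forall>i<k. K i *v x = l i *s x}"
    have T: "vec.subspace T" using S(1) unfolding T_def vec.subspace_def
      by (auto simp: vector_linear_simps)
    have "K k *v x \<in> T" if x: "x \<in> T" for x
    proof -
      have "K i *v (K k *v x) = l i *s (K k *v x)" if "i < k" for i
        using bracket_vector[of "K i" "K k" x] comm[of i k] Suc.prems x that
        by (simp add: T_def vector_scalar_commute)
      then show ?thesis using S(2) Suc.prems x by (auto simp: T_def)
    qed
    then obtain y m where y: "y \<in> T" "y \<noteq> 0" "K k *v y = m *s y"
      using eigenvector_in_subspace[OF T, of "K k" w] w by (auto simp: T_def)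
    then show ?case by (intro exI[of _ y] exI[of _ "l(k := m)"]) (auto simp: T_def less_Suc_eq)
  qed
  then show ?thesis by blast
qed

section \<open>Weights and short roots\<close>

text \<open>Here \<open>a\<close> lists the coordinates of an element of the root lattice in the
  simple roots; the pairing is its value on coroot \<open>j\<close>.\<close>

definition pairing :: "nat \<Rightarrow> (nat \<Rightarrow> nat \<Rightarrow> int) \<Rightarrow> (nat \<Rightarrow> int) \<Rightarrow> nat \<Rightarrow> int" where
  "pairing r C a j = (\<Sum>i<r. a i * C i j)"

definition reflection :: "nat \<Rightarrow> (nat \<Rightarrow> nat \<Rightarrow> int) \<Rightarrow> nat \<Rightarrow> (nat \<Rightarrow> int) \<Rightarrow> nat \<Rightarrow> int" where
  "reflection r C i a = a(i := a i - pairing r C a i)"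

text \<open>The simple reflection on the coroot lattice, in coordinates with respect to the simple
  coroots. Lists make concrete words computable by simplification.\<close>

definition coreflection :: "int list list \<Rightarrow> nat \<Rightarrow> int list \<Rightarrow> int list" where
  "coreflection M i m = m[i := m ! i - sum_list (map2 (*) m (M ! i))]"

definition unit_root :: "nat \<Rightarrow> nat \<Rightarrow> int" where
  "unit_root i = (\<lambda>k. if k = i then 1 else 0)"

lemma pairing_update:
  "i < r \<Longrightarrow> pairing r C (a(i := a i + t)) j = pairing r C a j + t * C i j"
  by (simp add: pairing_def sum.remove[of "{..<r}" i] algebra_simps)

lemma pairing_unit: "i < r \<Longrightarrow> pairing r C (unit_root i) j = C i j"
  using pairing_update[of i r C "\<lambda>_. 0" 1 j] by (simp add: pairing_def unit_root_def fun_upd_def)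

lemma pairing_reflection:
  "i < r \<Longrightarrow> pairing r C (reflection r C i a) j = pairing r C a j - pairing r C a i * C i j"
  using pairing_update[of i r C a "- pairing r C a i" j] by (simp add: reflection_def)

lemma length_coreflection [simp]: "length (coreflection M i m) = length m"
  by (simp add: coreflection_def)

lemma sum_list_map2: "length xs = length ys \<Longrightarrow> sum_list (map2 (*) xs ys) = (\<Sum>j<length xs. xs ! j * ys ! j)"
  for xs ys :: "int list"
  by (induction xs ys rule: list_induct2) (simp_all add: sum.lessThan_Suc_shift del: sum.lessThan_Suc)

text \<open>
  \<open>D\<close> is the inverse of the Cartan matrix \<open>M\<close>, \<open>d i\<close> is half the squared length of \<open>\<alpha>\<^sub>i\<close>, and
  the word \<open>ws\<close> in the simple reflections carries the coroot of the short root \<open>\<alpha>\<close> with index \<open>i0\<close> to the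
  highest coroot in its orbit. That all coefficients of the latter are at least 2 excludes minuscule weights.
\<close>

locale cartan_datum =
  fixes M D :: "int list list" and d :: "nat \<Rightarrow> int" and r i0 :: nat and ws :: "nat list"
    and C :: "nat \<Rightarrow> nat \<Rightarrow> int"
  defines "r \<equiv> length M" and "C \<equiv> (\<lambda>i j. M ! i ! j)"
  assumes len: "\<And>i. i < r \<Longrightarrow> length (M ! i) = r"
    and diag: "\<And>i. i < r \<Longrightarrow> C i i = 2"
    and inv: "\<And>i j. i < r \<Longrightarrow> j < r \<Longrightarrow> (\<Sum>k<r. C i k * D ! k ! j) = (if i = j then 1 else 0)"
      "\<And>i j. i < r \<Longrightarrow> j < r \<Longrightarrow> (\<Sum>k<r. D ! i ! k * C k j) = (if i = j then 1 else 0)"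
    and d_pos: "\<And>i. i < r \<Longrightarrow> d i > 0"
    and d_sym: "\<And>i j. i < r \<Longrightarrow> j < r \<Longrightarrow> C i j * d j = C j i * d i"
    and i0: "i0 < r" and ws: "\<And>i. i \<in> set ws \<Longrightarrow> i < r"
    and word: "\<And>j. j < r \<Longrightarrow> foldr (coreflection M) ws ((replicate r 0)[i0 := 1]) ! j \<ge> 2"
begin

abbreviation "pr \<equiv> pairing r C"
abbreviation "rfl \<equiv> reflection r C"

lemma from_pairing: "i < r \<Longrightarrow> a i = (\<Sum>j<r. pr a j * D ! j ! i)"
proof -
  assume i: "i < r"
  have "(\<Sum>j<r. pr a j * D ! j ! i) = (\<Sum>k<r. a k * (\<Sum>j<r. C k j * D ! j ! i))"
    unfolding pairing_def sum_distrib_right sum_distrib_left mult.assoc by (rule sum.swap)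
  also have "\<dots> = (\<Sum>k<r. a k * (if k = i then 1 else 0))" using i inv(1) by simp
  also have "\<dots> = a i" using i by (simp add: if_distrib cong: if_cong)
  finally show ?thesis by simp
qed

text \<open>This is where unimodularity enters: as \<open>D\<close> is integral, every integral
  weight has integer coordinates in the simple roots.\<close>

lemma to_pairing: "j < r \<Longrightarrow> pr (\<lambda>i. \<Sum>k<r. m k * D ! k ! i) j = m j"
proof -
  assume j: "j < r"
  have "pr (\<lambda>i. \<Sum>k<r. m k * D ! k ! i) j = (\<Sum>k<r. m k * (\<Sum>i<r. D ! k ! i * C i j))"
    unfolding pairing_def sum_distrib_right sum_distrib_left mult.assoc by (rule sum.swap)
  also have "\<dots> = (\<Sum>k<r. m k * (if k = j then 1 else 0))" using j inv(2) by simp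
  finally show ?thesis using j by (simp add: if_distrib cong: if_cong)
qed

text \<open>The Weyl group invariant form \<open>(a, a)\<close>.\<close>

definition nrm :: "(nat \<Rightarrow> int) \<Rightarrow> int" where
  "nrm a = (\<Sum>j<r. d j * a j * pr a j)"

lemma nrm_update:
  assumes i: "i < r"
  shows "nrm (a(i := a i + t)) = nrm a + 2 * t * d i * (pr a i + t)"
proof -
  have s: "(\<Sum>j<r. d j * a j * C i j) = d i * pr a i" unfolding pairing_def sum_distrib_left
    by (rule sum.cong) (use i d_sym in \<open>auto simp: algebra_simps\<close>)
  have "nrm (a(i := a i + t)) = (\<Sum>j<r. d j * (a(i := a i + t)) j * (pr a j + t * C i j))"
    by (simp only: nrm_def pairing_update[OF i])
  also have "\<dots> = (\<Sum>j<r. d j * a j * (pr a j + t * C i j)) + d i * t * (pr a i + t * C i i)"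
    using i by (simp add: sum.remove[of "{..<r}" i] algebra_simps)
  also have "\<dots> = nrm a + t * (\<Sum>j<r. d j * a j * C i j) + d i * t * (pr a i + 2 * t)"
    using i diag by (simp add: nrm_def sum.distrib sum_distrib_left algebra_simps)
  finally show ?thesis unfolding s by (simp add: algebra_simps)
qed

lemma nrm_refl: "i < r \<Longrightarrow> nrm (rfl i a) = nrm a"
  using nrm_update[of i a "- pr a i"] by (simp add: reflection_def)

lemma refl_refl: "i < r \<Longrightarrow> rfl i (rfl i a) = a"
  using pairing_reflection[of i r C a i] diag by (simp add: reflection_def fun_eq_iff)

lemma refl_0: "rfl i (\<lambda>_. 0) = (\<lambda>_. 0)"
  by (simp add: reflection_def pairing_def fun_eq_iff)

lemma coreflection_adjoint:
  assumes "i < r" "length m = r"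
  shows "(\<Sum>j<r. m ! j * pr (rfl i a) j) = (\<Sum>j<r. coreflection M i m ! j * pr a j)"
proof -
  define s where "s = (\<Sum>j<r. m ! j * C i j)"
  have c: "coreflection M i m ! j = m ! j - (if j = i then s else 0)" if "j < r" for j
    using assms that len by (simp add: coreflection_def sum_list_map2 s_def C_def)
  have "(\<Sum>j<r. coreflection M i m ! j * pr a j) = (\<Sum>j<r. m ! j * pr a j - (if j = i then s * pr a j else 0))"
    by (rule sum.cong) (auto simp: c algebra_simps)
  also have "\<dots> = (\<Sum>j<r. m ! j * pr a j) - s * pr a i" using assms by (simp add: sum_subtractf)
  also have "\<dots> = (\<Sum>j<r. m ! j * pr (rfl i a) j)"
    using assms by (simp add: pairing_reflection algebra_simps sum_subtractf s_def sum_distrib_left)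
  finally show ?thesis ..
qed

text \<open>Passing to the adjoint reverses a product of reflections, hence \<open>foldl\<close> on
  the roots and \<open>foldr\<close> on the coroots.\<close>

lemma word_adjoint:
  assumes "\<And>i. i \<in> set vs \<Longrightarrow> i < r" "length m = r"
  shows "length (foldr (coreflection M) vs m) = r \<and>
    (\<Sum>j<r. m ! j * pr (foldl (\<lambda>a i. rfl i a) a vs) j) = (\<Sum>j<r. foldr (coreflection M) vs m ! j * pr a j)"
  using assms
proof (induction vs arbitrary: a)
  case Nil then show ?case by simp
next
  case (Cons i vs)
  then have IH: "length (foldr (coreflection M) vs m) = r"
    "\<And>a. (\<Sum>j<r. m ! j * pr (foldl (\<lambda>a i. rfl i a) a vs) j) = (\<Sum>j<r. foldr (coreflection M) vs m ! j * pr a j)"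
    by auto
  then show ?case using coreflection_adjoint[of i "foldr (coreflection M) vs m" a] Cons.prems
    by simp
qed

text \<open>
  A nonzero weight of minimal norm can be moved to a dominant one, where it pairs to at least 2
  with the highest short coroot; minimality then forces it to be a short root.
\<close>

lemma short_root_in_saturated:
  assumes fin: "finite W" and supp: "\<And>a i. a \<in> W \<Longrightarrow> i \<ge> r \<Longrightarrow> a i = 0"
    and rfl: "\<And>a i. a \<in> W \<Longrightarrow> i < r \<Longrightarrow> rfl i a \<in> W"
    and low: "\<And>a i. a \<in> W \<Longrightarrow> i < r \<Longrightarrow> pr a i \<ge> 1 \<Longrightarrow> a(i := a i - 1) \<in> W"
    and nonzero: "a0 \<in> W" "a0 \<noteq> (\<lambda>_. 0)"
  shows "unit_root i0 \<in> W"
proof -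
  define S where "S = W - {\<lambda>_. 0}"
  have S: "finite S" "S \<noteq> {}" using fin nonzero by (auto simp: S_def)
  define q where "q = Min (nrm ` S)"
  have q: "q \<le> nrm a" if "a \<in> S" for a using S that by (simp add: q_def)
  define S1 where "S1 = {a \<in> S. nrm a = q}"
  have "q \<in> nrm ` S" unfolding q_def using S by (intro Min_in) auto
  then have S1: "finite S1" "S1 \<noteq> {}" using S by (auto simp: S1_def)
  have refl_S1: "rfl i a \<in> S1" if "a \<in> S1" "i < r" for a i
    using that rfl nrm_refl refl_refl[OF that(2), of a] refl_0[of i] by (auto simp: S1_def S_def)
  \<comment> \<open>Among the weights of minimal norm one of maximal height is dominant: reflecting
    at a negative pairing would raise the height and preserve the norm.\<close>
  define ht where "ht a = (\<Sum>k<r. a k)" for a :: "nat \<Rightarrow> int"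
  have "Max (ht ` S1) \<in> ht ` S1" using S1 by (intro Max_in) auto
  then obtain a where a: "a \<in> S1" "ht a = Max (ht ` S1)" by auto
  have dom: "pr a i \<ge> 0" if i: "i < r" for i
  proof -
    have "ht (rfl i a) = ht a - pr a i"
      using i by (simp add: ht_def reflection_def sum.remove[of "{..<r}" i])
    moreover have "ht (rfl i a) \<le> ht a" using refl_S1[OF a(1) i] S1 a(2) by simp
    ultimately show ?thesis by simp
  qed
  have "\<exists>j<r. pr a j \<ge> 1"
  proof (rule ccontr)
    assume "\<not> ?thesis"
    then have "\<forall>j<r. pr a j = 0" using dom by force
    then have "a i = 0" for i
      using from_pairing[of i a] supp[of a i] a(1) by (cases "i < r") (auto simp: S1_def S_def)
    then show False using a(1) by (auto simp: S1_def S_def)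
  qed
  then obtain j where j: "j < r" "pr a j \<ge> 1" by blast
  \<comment> \<open>\<open>b\<close> is the element of the Weyl orbit of \<open>a\<close> whose
    value on coroot \<open>i0\<close> equals the value of \<open>a\<close> on the coroot with
    coordinates \<open>m\<close>. As \<open>a\<close> is dominant and the coordinates of
    \<open>m\<close> are at least 2, that value is at least 2.\<close>
  define b where "b = foldl (\<lambda>a i. rfl i a) a ws"
  define m where "m = foldr (coreflection M) ws ((replicate r 0)[i0 := 1])"
  have "foldl (\<lambda>a i. rfl i a) x vs \<in> S1" if "x \<in> S1" "\<forall>i\<in>set vs. i < r" for x vs
    using that by (induction vs arbitrary: x) (auto intro: refl_S1)
  then have b: "b \<in> S1" using a ws by (simp add: b_def)
  have "pr b i0 = (\<Sum>j<r. (replicate r 0)[i0 := 1] ! j * pr b j)"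
    using i0 by (subst sum.remove[of _ i0]) (auto simp: nth_list_update)
  also have "\<dots> = (\<Sum>j<r. m ! j * pr a j)"
    unfolding b_def m_def using word_adjoint[of ws "(replicate r 0)[i0 := 1]" a] ws by simp
  also have "\<dots> \<ge> m ! j * pr a j"
  proof (rule member_le_sum)
    fix k assume "k \<in> {..<r} - {j}"
    then show "0 \<le> m ! k * pr a k" using dom[of k] word[of k] by (simp add: m_def)
  qed (use j in auto)
  finally have "m ! j * pr a j \<le> pr b i0" .
  moreover have "2 * 1 \<le> m ! j * pr a j" using j word[OF j(1)] by (intro mult_mono) (auto simp: m_def)
  ultimately have b2: "pr b i0 \<ge> 2" by simp
  then have bW: "b(i0 := b i0 - 1) \<in> W" using low[of b i0] b i0 by (auto simp: S1_def S_def)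
  \<comment> \<open>Subtracting the simple root \<open>i0\<close> from \<open>b\<close> lowers the
    norm strictly below the minimum over nonzero weights, so the result is 0.\<close>
  have "nrm (b(i0 := b i0 - 1)) = nrm b - 2 * d i0 * (pr b i0 - 1)"
    using nrm_update[OF i0, of b "- 1"] by simp
  moreover have "2 * d i0 * (pr b i0 - 1) > 0" using d_pos[OF i0] b2 by simp
  ultimately have "nrm (b(i0 := b i0 - 1)) < q" using b by (simp add: S1_def)
  then have "b(i0 := b i0 - 1) \<notin> S" using q by force
  then have z: "b(i0 := b i0 - 1) = (\<lambda>_. 0)" using bW by (simp add: S_def)
  have "b k = unit_root i0 k" for k
    using fun_cong[OF z, of k] by (simp add: unit_root_def split: if_splits)
  then have "b = unit_root i0" by blast
  then show ?thesis using b by (simp add: S1_def S_def)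
qed

end

section \<open>Weights of a representation: finiteness, reflections, integrality\<close>

lemma finite_integer_eigenvalues:
  "finite {m :: int. \<exists>v. v \<noteq> 0 \<and> A *v v = of_int m *s (v :: complex^'n)}" (is "finite ?S")
proof (rule ccontr)
  assume "infinite ?S"
  then obtain g :: "nat \<Rightarrow> int" where g: "inj g" "range g \<subseteq> ?S"
    using infinite_countable_subset by blast
  then have "\<forall>k. \<exists>v. v \<noteq> 0 \<and> A *v v = of_int (g k) *s (v :: complex^'n)" by auto
  then obtain x where x: "\<And>k. x k \<noteq> 0" "\<And>k. A *v x k = of_int (g k) *s (x k :: complex^'n)" by metis
  have "\<exists>k. x k = 0" by (rule eigenvector_sequence_vanishes[of "(*v) A" x "\<lambda>k. real_of_int (g k)"])
      (use x g in \<open>auto simp: vector_scale_of_int inj_def\<close>)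
  then show False using x by blast
qed

context chevalley_rep
begin

lemma wt_e_power: "wt m v \<Longrightarrow> i < r \<Longrightarrow> wt (\<lambda>j. m j + int k * C i j) ((e i ^^ k) v)"
proof (induction k)
  case (Suc k)
  then show ?case using wt_cong[OF wt_e[OF Suc.IH]] by (auto simp: algebra_simps)
qed simp

lemma wt_f_power: "wt m v \<Longrightarrow> i < r \<Longrightarrow> wt (\<lambda>j. m j - int k * C i j) ((f i ^^ k) v)"
proof (induction k)
  case (Suc k)
  then show ?case using wt_cong[OF wt_f[OF Suc.IH]] by (auto simp: algebra_simps)
qed simp

text \<open>The vector comes from \<open>reflect_nonneg\<close>: going up \<open>p\<close> steps to
  the top of the string and down \<open>p + n\<close> steps subtracts the simple root
  \<open>n\<close> times. For negative \<open>m i\<close> the roles of \<open>e\<close> and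
  \<open>f\<close> are exchanged.\<close>

lemma weight_reflection:
  assumes v: "wt m v" "v \<noteq> 0" and i: "i < r"
  shows "\<exists>w. w \<noteq> 0 \<and> wt (\<lambda>j. m j - m i * C i j) w"
proof (cases "m i \<ge> 0")
  case True
  then have "K i *v v = real (nat (m i)) *\<^sub>R v" using wt_real[OF v(1) i] by simp
  then obtain p t where pt: "t = p + nat (m i)" "(f i ^^ t) ((e i ^^ p) v) \<noteq> 0"
    using sl2_action.reflect_nonneg[OF sl2[OF i]] v by blast
  then show ?thesis using wt_cong[OF wt_f_power[OF wt_e_power[OF v(1) i] i, of p t]] True
    by (intro exI[of _ "(f i ^^ t) ((e i ^^ p) v)"]) (auto simp: algebra_simps)
next
  case False
  then have "- (K i *v v) = real (nat (- m i)) *\<^sub>R v" using wt_real[OF v(1) i] by simp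
  then obtain p t where pt: "t = p + nat (- m i)" "(e i ^^ t) ((f i ^^ p) v) \<noteq> 0"
    using sl2_action.reflect_nonneg[OF sl2_action.swap[OF sl2[OF i]]] v by blast
  then show ?thesis using wt_cong[OF wt_e_power[OF wt_f_power[OF v(1) i] i, of p t]] False
    by (intro exI[of _ "(e i ^^ t) ((f i ^^ p) v)"]) (auto simp: algebra_simps)
qed

text \<open>Climb from \<open>v\<close> to the top of the \<open>e\<close>-string, \<open>p\<close>
  steps up, and descend along \<open>f\<close>. Where the descent ends after \<open>s\<close>
  nonzero steps, \<open>(s + 1) * (N - s) = 0\<close>, so the top eigenvalue \<open>N\<close> is
  \<open>s\<close> and \<open>l\<close> is \<open>s - 2 * p\<close>.\<close>

lemma integral_eigenvalue:
  assumes i: "i < r" and v: "v \<noteq> 0" "K i *v v = l *s v"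
  shows "\<exists>m. l = of_int m"
proof -
  interpret sl2_action "(*v) (E i)" "(*v) (F i)" "(*v) (K i)" by (rule sl2[OF i])
  have two: "2 *\<^sub>R x = (2::complex) *s x" for x :: "complex^'n"
    using vector_scale_of_real[of 2 x] by simp
  have we: "K i *v (e i ^^ k) v = (l + 2 * of_nat k) *s (e i ^^ k) v" for k
    by (induction k) (simp_all add: v he two matrix_vector_right_distrib vector_scalar_commute vec.scale_left_distrib distrib_left)
  \<comment> \<open>\<open>l\<close> may be any complex number at this point; subtracting it makes
    the eigenvalues along the string real, as \<open>eigenvector_sequence_vanishes\<close>
    requires.\<close>
  have "linear (\<lambda>x. K i *v x - l *s x)"
    by (rule linearI) (simp_all add: vector_linear_simps vec.scale_right_diff_distrib flip: vector_scale_of_real)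
  moreover have "K i *v (e i ^^ k) v - l *s (e i ^^ k) v = (2 * real k) *\<^sub>R (e i ^^ k) v" for k
    unfolding we using vector_scale_of_real[of "2 * real k" "(e i ^^ k) v"]
    by (simp add: vec.scale_left_distrib)
  ultimately have "\<exists>k. (e i ^^ k) v = 0" by (rule eigenvector_sequence_vanishes) (simp add: inj_def)
  then obtain k where k: "(e i ^^ k) v = 0" "\<forall>j<k. (e i ^^ j) v \<noteq> 0"
    using exists_least_iff[of "\<lambda>k. (e i ^^ k) v = 0"] by blast
  with v(1) obtain p where p: "k = Suc p" by (cases k) auto
  define w where "w = (e i ^^ p) v"
  define N where "N = l + 2 * of_nat p"
  have w: "w \<noteq> 0" "e i w = 0" "K i *v w = N *s w" using k p we[of p] by (auto simp: w_def N_def)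
  have wf: "K i *v (f i ^^ t) w = (N - 2 * of_nat t) *s (f i ^^ t) w" for t
    by (induction t) (simp_all add: w hf two matrix_vector_mult_diff_distrib vector_scalar_commute vec.scale_left_diff_distrib
        vec.scale_left_distrib distrib_left)
  have ef: "e i ((f i ^^ Suc t) w) = (of_nat (Suc t) * (N - of_nat t)) *s (f i ^^ t) w" for t
  proof (induction t)
    case 0
    then show ?case using ef[of w] w by simp
  next
    case (Suc t)
    have "e i ((f i ^^ Suc (Suc t)) w) = f i (e i ((f i ^^ Suc t) w)) + K i *v ((f i ^^ Suc t) w)"
      using ef[of "(f i ^^ Suc t) w"] by simp
    also have "\<dots> = (of_nat (Suc t) * (N - of_nat t) + (N - 2 * of_nat (Suc t))) *s (f i ^^ Suc t) w"
      unfolding Suc.IH wf by (simp add: vector_scalar_commute vec.scale_left_distrib)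
    also have "of_nat (Suc t) * (N - of_nat t) + (N - 2 * of_nat (Suc t)) = of_nat (Suc (Suc t)) * (N - of_nat (Suc t))"
      by (simp add: algebra_simps)
    finally show ?case .
  qed
  have "linear (\<lambda>x. K i *v x - N *s x)"
    by (rule linearI) (simp_all add: vector_linear_simps vec.scale_right_diff_distrib flip: vector_scale_of_real)
  moreover have "K i *v (f i ^^ t) w - N *s (f i ^^ t) w = (- 2 * real t) *\<^sub>R (f i ^^ t) w" for t
    unfolding wf using vector_scale_of_real[of "- 2 * real t" "(f i ^^ t) w"]
    by (simp add: vec.scale_left_diff_distrib)
  ultimately have "\<exists>t. (f i ^^ t) w = 0" by (rule eigenvector_sequence_vanishes) (simp add: inj_def)
  then obtain t where t: "(f i ^^ t) w = 0" "\<forall>j<t. (f i ^^ j) w \<noteq> 0"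
    using exists_least_iff[of "\<lambda>t. (f i ^^ t) w = 0"] by blast
  with w(1) obtain s where s: "t = Suc s" by (cases t) auto
  then have "(of_nat (Suc s) * (N - of_nat s)) *s (f i ^^ s) w = 0" using ef[of s] t by simp
  then have "of_nat (Suc s) * (N - of_nat s) = 0" using t s by (simp only: vector_mul_eq_0) simp
  moreover have "(of_nat (Suc s) :: complex) \<noteq> 0" by (rule of_nat_neq_0)
  ultimately have "N = of_nat s" by simp
  then have "l = of_int (int s - 2 * int p)" by (simp add: N_def algebra_simps)
  then show ?thesis by blast
qed

text \<open>If 0 were the only eigenvalue of \<open>K i\<close>, an eigenvector of
  \<open>K i\<close> in the image of \<open>E i\<close> would have a preimage that turns out to lie
  in the kernel. A nonzero eigenspace is stable under all \<open>K j\<close> and contains a common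
  eigenvector.\<close>

lemma nonzero_weight_exists:
  assumes i: "i < r" and E: "E i \<noteq> 0"
  shows "\<exists>m v. v \<noteq> 0 \<and> wt m v \<and> m i \<noteq> 0"
proof -
  have "\<exists>v l. v \<noteq> 0 \<and> K i *v v = l *s v \<and> l \<noteq> 0"
  proof (rule ccontr)
    assume none: "\<not> ?thesis"
    have eh: "e i (K i *v v) = K i *v e i v - 2 *s e i v" for v
      using bracket_vector[of "K i" "E i" v] KE[OF i i] C_diag[OF i] by (simp add: mscale_vector_mult)
    define S where "S = {e i v | v. True}"
    have S: "vec.subspace S"
      unfolding S_def vec.subspace_def by (auto simp flip: matrix_vector_right_distrib vector_scalar_commute
          intro: exI[of _ 0])
    have SK: "K i *v x \<in> S" if x: "x \<in> S" for x
    proof -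
      obtain v where "x = e i v" using x by (auto simp: S_def)
      then have "K i *v x = e i (K i *v v + 2 *s v)"
        by (simp add: eh matrix_vector_right_distrib vector_scalar_commute)
      then show ?thesis by (auto simp: S_def)
    qed
    obtain v0 where "e i v0 \<noteq> 0" using E matrix_eq[of "E i" 0] by auto
    then obtain x l where x: "e i x \<noteq> 0" "K i *v e i x = l *s e i x"
      using eigenvector_in_subspace[OF S SK, of "e i v0"] by (auto simp: S_def)
    then have "l = 0" using none by blast
    then have "e i (K i *v x + 2 *s x) = 0"
      using x by (simp add: eh matrix_vector_right_distrib vector_scalar_commute)
    \<comment> \<open>\<open>K i\<close> plus 2 is injective, as -2 is not an eigenvalue, and maps
      the kernel \<open>Z\<close> of \<open>E i\<close> into itself, hence onto itself. Since it
      sends \<open>x\<close> into \<open>Z\<close>, \<open>x\<close> is already in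
      \<open>Z\<close>.\<close>
    define Z where "Z = {v. e i v = 0}"
    define g where "g = (\<lambda>v. K i *v v + 2 *s v)"
    have g: "linear g" "\<And>v. g v = 0 \<Longrightarrow> v = 0"
    proof -
      show "linear g" unfolding g_def
        by (rule linearI) (simp_all add: vector_linear_simps flip: vector_scale_of_real)
      fix v assume "g v = 0"
      then have "K i *v v = (- 2) *s v" by (simp add: g_def add_eq_0_iff)
      then show "v = 0" using none by fastforce
    qed
    have Z: "subspace Z" unfolding Z_def subspace_def
      by (auto simp: matrix_vector_right_distrib vector_scalar_commute simp flip: vector_scale_of_real)
    have gZ: "g ` Z \<subseteq> Z"
      by (auto simp: Z_def g_def eh matrix_vector_right_distrib vector_scalar_commute)
    have injg: "inj g" using g linear_injective_0 by blast
    have "g ` Z = Z"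
    proof (rule subspace_dim_equal)
      show "subspace (g ` Z)" using linear_subspace_image[OF g(1) Z] .
      show "dim Z \<le> dim (g ` Z)" using dim_image_eq[OF g(1), of Z] injg by (simp add: inj_on_subset)
    qed (use Z gZ in auto)
    moreover have "g x \<in> Z" using \<open>e i (K i *v x + 2 *s x) = 0\<close> by (simp add: Z_def g_def)
    ultimately have "x \<in> Z" using injg by (metis image_iff injD)
    then show False using x by (simp add: Z_def)
  qed
  then obtain v0 l0 where v0: "v0 \<noteq> 0" "K i *v v0 = l0 *s v0" "l0 \<noteq> 0" by blast
  define S where "S = {v. K i *v v = l0 *s v}"
  have "vec.subspace S" unfolding S_def vec.subspace_def by (auto simp: vector_linear_simps)
  moreover have "K j *v v \<in> S" if "j < r" "v \<in> S" for j v
    using bracket_vector[of "K i" "K j" v] KK[OF i that(1)] that by (simp add: S_def vector_scalar_commute)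
  ultimately obtain w l where w: "w \<in> S" "w \<noteq> 0" "\<And>j. j < r \<Longrightarrow> K j *v w = l j *s w"
    using common_eigenvector[of r K S v0] KK v0 by (auto simp: S_def)
  have "\<forall>j. \<exists>m. j < r \<longrightarrow> l j = of_int m" using integral_eigenvalue w by blast
  then obtain m where m: "\<And>j. j < r \<Longrightarrow> l j = of_int (m j)" by metis
  have "wt m w" using w m by (simp add: wt_def)
  moreover have "l i = l0" using w i by (auto simp: S_def)
  ultimately show ?thesis using w v0 m[OF i] by (intro exI[of _ m] exI[of _ w]) auto
qed

end

section \<open>Short roots among the weights\<close>

locale cartan_rep = cartan_datum M D d r i0 ws C + chevalley_rep r C E F K
  for M D :: "int list list" and d :: "nat \<Rightarrow> int" and r i0 :: nat and ws :: "nat list"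
    and C :: "nat \<Rightarrow> nat \<Rightarrow> int" and E F K :: "nat \<Rightarrow> complex^'n^'n" +
  assumes E_nz: "E i0 \<noteq> 0"
begin

text \<open>The weights, in root coordinates, satisfy the hypotheses of
  \<open>short_root_in_saturated\<close>: lowering uses the injectivity of \<open>f i\<close>, and
  the nonzero element is a nonzero weight rewritten by means of \<open>D\<close>.\<close>

lemma short_root_weight: "\<exists>v. v \<noteq> 0 \<and> wt (C i0) v"
proof -
  \<comment> \<open>Setting the coordinates from \<open>r\<close> on to 0 makes \<open>a\<close>
    unique for its weight, without which \<open>W\<close> would not be finite.\<close>
  define W where "W = {a. (\<forall>i\<ge>r. a i = 0) \<and> (\<exists>v. v \<noteq> 0 \<and> wt (pr a) v)}"
  have "finite W"
  proof (rule finite_subset)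
    define B where "B j = {m :: int. \<exists>v. v \<noteq> 0 \<and> K j *v v = of_int m *s (v :: complex^'n)}" for j
    let ?h = "\<lambda>m i. if i < r then \<Sum>j<r. m j * D ! j ! i else 0"
    show "finite (?h ` PiE {..<r} B)"
      by (intro finite_imageI finite_PiE) (auto simp: B_def finite_integer_eigenvalues)
    show "W \<subseteq> ?h ` PiE {..<r} B"
    proof
      fix a assume a: "a \<in> W"
      then obtain v where v: "v \<noteq> 0" "wt (pr a) v" by (auto simp: W_def)
      have "a = ?h (restrict (pr a) {..<r})"
        using from_pairing[of _ a] a by (auto simp: W_def fun_eq_iff)
      moreover have "restrict (pr a) {..<r} \<in> PiE {..<r} B" using v by (auto simp: B_def wt_def intro!: exI[of _ v])
      ultimately show "a \<in> ?h ` PiE {..<r} B" by blast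
    qed
  qed
  moreover have "rfl i a \<in> W" if a: "a \<in> W" "i < r" for a i
  proof -
    obtain v where "v \<noteq> 0" "wt (pr a) v" using a by (auto simp: W_def)
    moreover have "pr (rfl i a) = (\<lambda>j. pr a j - pr a i * C i j)"
      by (rule ext) (rule pairing_reflection[OF a(2)])
    ultimately obtain w where "w \<noteq> 0" "wt (pr (rfl i a)) w"
      using weight_reflection[of "pr a" v i] a(2) by auto
    moreover have "rfl i a k = 0" if "k \<ge> r" for k
      using that \<open>a \<in> W\<close> \<open>i < r\<close> by (auto simp: W_def reflection_def)
    ultimately show ?thesis by (auto simp: W_def)
  qed
  moreover have "a(i := a i - 1) \<in> W" if a: "a \<in> W" "i < r" "pr a i \<ge> 1" for a i
  proof -
    obtain v where v: "v \<noteq> 0" "wt (pr a) v" using a by (auto simp: W_def)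
    have "f i v \<noteq> 0" using f_inj v a by force
    moreover have "wt (pr (a(i := a i - 1))) (f i v)"
      using wt_cong[OF wt_f[OF v(2) a(2)]] pairing_update[OF a(2), of C a "- 1"] by simp
    ultimately show ?thesis using a by (auto simp: W_def)
  qed
  moreover obtain a0 where "a0 \<in> W" "a0 \<noteq> (\<lambda>_. 0)"
  proof -
    obtain m v where m: "v \<noteq> 0" "wt m v" "m i0 \<noteq> 0" using nonzero_weight_exists[OF i0 E_nz] by blast
    define a where "a i = (if i < r then \<Sum>k<r. m k * D ! k ! i else 0)" for i
    have pa: "pr a j = m j" if "j < r" for j
      using to_pairing[OF that, of m] by (simp add: pairing_def a_def)
    then have "wt (pr a) v" using wt_cong[OF m(2)] by simp
    then have "a \<in> W" using m by (auto simp: W_def a_def)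
    moreover have "a \<noteq> (\<lambda>_. 0)" using pa[OF i0] m(3) by (auto simp: pairing_def)
    ultimately show thesis using that by blast
  qed
  ultimately have "unit_root i0 \<in> W" by (intro short_root_in_saturated[of W]) (auto simp: W_def)
  then obtain v where "v \<noteq> 0" "wt (pr (unit_root i0)) v" by (auto simp: W_def)
  moreover have "pr (unit_root i0) = C i0" by (rule ext) (rule pairing_unit[OF i0])
  ultimately show ?thesis by auto
qed

text \<open>Raising by \<open>e j\<close> gives a weight vector for the sum of the two roots, which
  takes the value 1 on coroot \<open>i\<close>, so lowering by \<open>f i\<close> is again
  injective.\<close>

lemma root_weight_neighbour:
  assumes "v \<noteq> 0" "wt (C i) v" "i < r" "j < r" "C i j = -1" "C j i = -1"
  shows "\<exists>w. w \<noteq> 0 \<and> wt (C j) w"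
proof -
  have w: "wt (\<lambda>k. C i k + C j k) (e j v)" by (rule wt_e) (use assms in auto)
  have "e j v \<noteq> 0" using e_inj[OF assms(2), of j] assms by auto
  then have "f i (e j v) \<noteq> 0" using f_inj[OF w, of i] assms C_diag by auto
  moreover have "wt (C j) (f i (e j v))" using wt_cong[OF wt_f[OF w, of i]] assms by simp
  ultimately show ?thesis by blast
qed

text \<open>Lowering a vector of weight \<open>C i\<close> by \<open>f i\<close> gives a nonzero
  vector of weight 0, hence a multiple of \<open>u\<close>, and \<open>e i\<close> does not kill it.
  So \<open>e i u\<close> is nonzero for every simple root that is a weight.\<close>

lemma zero_lineI:
  assumes "thin (\<lambda>_. 0)"
  shows "\<exists>u. zero_line r C E F K u \<and> (\<forall>i v. i < r \<longrightarrow> v \<noteq> 0 \<longrightarrow> wt (C i) v \<longrightarrow> E i *v u \<noteq> 0)"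
proof -
  have f0: "wt (\<lambda>_. 0) (f i v) \<and> f i v \<noteq> 0 \<and> e i (f i v) \<noteq> 0" if "i < r" "v \<noteq> 0" "wt (C i) v" for i v
    using wt_cong[OF wt_f[OF that(3,1)]] f_inj[OF that(3,1)] ef_inj[OF that(3,1)] that C_diag by auto
  obtain v where v: "v \<noteq> 0" "wt (C i0) v" using short_root_weight by blast
  define u where "u = f i0 v"
  have u: "wt (\<lambda>_. 0) u" "u \<noteq> 0" using f0[OF i0 v] by (auto simp: u_def)
  have "zero_line r C E F K u" by unfold_locales (use u assms in auto)
  moreover have "e i u \<noteq> 0" if i: "i < r" "w \<noteq> 0" "wt (C i) w" for i w
  proof -
    obtain c where "f i w = c *s u" using thinD[OF assms u(1) _ u(2)] f0[OF i] by blast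
    then show ?thesis using f0[OF i] by (auto simp: vector_scalar_commute)
  qed
  ultimately show ?thesis by blast
qed

end

section \<open>The Cartan data of E8 and F4\<close>

definition e8_inverse :: "int list list" where
  "e8_inverse =
    [[4, 5, 7, 10, 8, 6, 4, 2], [5, 8, 10, 15, 12, 9, 6, 3], [7, 10, 14, 20, 16, 12, 8, 4],
     [10, 15, 20, 30, 24, 18, 12, 6], [8, 12, 16, 24, 20, 15, 10, 5], [6, 9, 12, 18, 15, 12, 8, 4],
     [4, 6, 8, 12, 10, 8, 6, 3], [2, 3, 4, 6, 5, 4, 3, 2]]"

definition f4_inverse :: "int list list" where
  "f4_inverse = [[2, 3, 4, 2], [3, 6, 8, 4], [2, 4, 6, 3], [1, 2, 3, 2]]"

lemma all_less_Suc: "(\<forall>i<Suc n. P i) \<longleftrightarrow> P n \<and> (\<forall>i<n. P i)"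
  by (auto simp: less_Suc_eq)

lemmas small_numerals = eval_nat_numeral all_less_Suc

text \<open>Index 3 is the branch vertex. The word acts from its right end; the highest root has
  height 29, and each of the 28 reflections raises the height by one.\<close>

lemma cartan_datum_E8:
  "cartan_datum cartan_E8 e8_inverse (\<lambda>_. 1) 3
    [7, 6, 5, 4, 3, 2, 1, 3, 4, 5, 6, 7, 0, 2, 3, 4, 5, 6, 1, 3, 4, 5, 2, 3, 4, 0, 2, 1]"
proof -
  have l: "length cartan_E8 = 8" by (simp add: cartan_E8_def)
  have "\<forall>i<8. length (cartan_E8 ! i) = 8" "\<forall>i<8. cartan_E8 ! i ! i = 2"
    "\<forall>i<8. \<forall>j<8. cartan_E8 ! i ! j = cartan_E8 ! j ! i"
    "\<forall>i<8. \<forall>j<8. (\<Sum>k<8. cartan_E8 ! i ! k * e8_inverse ! k ! j) = (if i = j then 1 else 0)"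
    "\<forall>i<8. \<forall>j<8. (\<Sum>k<8. e8_inverse ! i ! k * cartan_E8 ! k ! j) = (if i = j then 1 else 0)"
    by (simp_all add: small_numerals cartan_E8_def e8_inverse_def)
  moreover have "\<forall>j<8. foldr (coreflection cartan_E8)
    [7, 6, 5, 4, 3, 2, 1, 3, 4, 5, 6, 7, 0, 2, 3, 4, 5, 6, 1, 3, 4, 5, 2, 3, 4, 0, 2, 1]
      ((replicate 8 0)[3 := 1]) ! j \<ge> 2"
    by (simp add: coreflection_def cartan_E8_def small_numerals)
  ultimately show ?thesis unfolding cartan_datum_def l by auto
qed

text \<open>Index 2 is the short root at the double edge. Its coroot is long in the dual system, and
  the word, read from the right, takes it to the coroot with coordinates 2, 4, 3, 2.\<close>

lemma cartan_datum_F4: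
  "cartan_datum cartan_F4 f4_inverse (\<lambda>i. if i < 2 then 2 else 1) 2 [3, 2, 1, 2, 3, 0, 1]"
proof -
  have l: "length cartan_F4 = 4" by (simp add: cartan_F4_def)
  have "\<forall>i<4. length (cartan_F4 ! i) = 4" "\<forall>i<4. cartan_F4 ! i ! i = 2"
    "\<forall>i<4. \<forall>j<4. cartan_F4 ! i ! j * (if j < 2 then 2 else 1) = cartan_F4 ! j ! i * (if i < 2 then 2 else 1)"
    "\<forall>i<4. \<forall>j<4. (\<Sum>k<4. cartan_F4 ! i ! k * f4_inverse ! k ! j) = (if i = j then 1 else 0)"
    "\<forall>i<4. \<forall>j<4. (\<Sum>k<4. f4_inverse ! i ! k * cartan_F4 ! k ! j) = (if i = j then 1 else 0)"
    by (simp_all add: small_numerals cartan_F4_def f4_inverse_def)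
  moreover have "\<forall>j<4. foldr (coreflection cartan_F4) [3, 2, 1, 2, 3, 0, 1] ((replicate 4 0)[2 := 1]) ! j \<ge> 2"
    by (simp add: coreflection_def cartan_F4_def small_numerals)
  ultimately show ?thesis unfolding cartan_datum_def l by auto
qed

text \<open>For E8 the excluded configuration is vertex 3 with its neighbours 1, 2, 4. For F4 it is
  the chain 1, 2, 3 with 1 long; only the short roots 2 and 3 have to be weights.\<close>

lemma zero_weight_multiplicity:
  fixes E F K :: "nat \<Rightarrow> complex^'n^'n"
  assumes M: "M = cartan_E8 \<or> M = cartan_F4"
    and rep: "chevalley_rep (length M) (\<lambda>i j. M ! i ! j) E F K"
    and E: "\<And>i. i < length M \<Longrightarrow> E i \<noteq> 0"
  shows "\<exists>v w. v \<noteq> 0 \<and> (\<forall>c. w \<noteq> c *s v) \<and> (\<forall>j<length M. K j *v v = 0 \<and> K j *v w = 0)"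
proof -
  interpret chevalley_rep "length M" "\<lambda>i j. M ! i ! j" E F K by (rule rep)
  have "\<not> thin (\<lambda>_. 0)"
  proof
    assume thin: "thin (\<lambda>_. 0)"
    from M show False
    proof
      assume M: "M = cartan_E8"
      have l: "length M = 8" by (simp add: M cartan_E8_def)
      note entries = M cartan_E8_def eval_nat_numeral
      interpret cartan_rep M e8_inverse "\<lambda>_. 1" "length M" 3
        "[7, 6, 5, 4, 3, 2, 1, 3, 4, 5, 6, 7, 0, 2, 3, 4, 5, 6, 1, 3, 4, 5, 2, 3, 4, 0, 2, 1]"
        "\<lambda>i j. M ! i ! j" E F K
        using cartan_datum_E8 rep E by (simp add: M cartan_rep_def cartan_rep_axioms_def l[unfolded M])
      obtain u where u: "zero_line (length M) (\<lambda>i j. M ! i ! j) E F K u"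
        "\<And>i v. i < length M \<Longrightarrow> v \<noteq> 0 \<Longrightarrow> wt ((!) (M ! i)) v \<Longrightarrow> E i *v u \<noteq> 0"
        using zero_lineI[OF thin] by blast
      obtain v where v: "v \<noteq> 0" "wt ((!) (M ! 3)) v" using short_root_weight by blast
      have nb: "E i *v u \<noteq> 0" if "i \<in> {1, 2, 4}" for i
        using root_weight_neighbour[OF v, of i] u(2)[of i] that l by (auto simp: entries)
      have "E 3 *v u \<noteq> 0" using u(2)[of 3 v] v l by simp
      then show False
        by (rule zero_line.no_D4[OF u(1), where j = 3 and ?i1.0 = 1 and ?i2.0 = 2 and ?i3.0 = 4, rotated -2])
          (use nb l in \<open>auto simp: entries\<close>)
    next
      assume M: "M = cartan_F4"
      have l: "length M = 4" by (simp add: M cartan_F4_def)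
      note entries = M cartan_F4_def eval_nat_numeral
      interpret cartan_rep M f4_inverse "\<lambda>i. if i < 2 then 2 else 1" "length M" 2
        "[3, 2, 1, 2, 3, 0, 1]" "\<lambda>i j. M ! i ! j" E F K
        using cartan_datum_F4 rep E by (simp add: M cartan_rep_def cartan_rep_axioms_def l[unfolded M])
      obtain u where u: "zero_line (length M) (\<lambda>i j. M ! i ! j) E F K u"
        "\<And>i v. i < length M \<Longrightarrow> v \<noteq> 0 \<Longrightarrow> wt ((!) (M ! i)) v \<Longrightarrow> E i *v u \<noteq> 0"
        using zero_lineI[OF thin] by blast
      obtain v where v: "v \<noteq> 0" "wt ((!) (M ! 2)) v" using short_root_weight by blast
      have "E 3 *v u \<noteq> 0"
        using root_weight_neighbour[OF v, of 3] u(2)[of 3] l by (auto simp: entries)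
      moreover have "E 2 *v u \<noteq> 0" using u(2)[of 2 v] v l by simp
      ultimately show False
        using zero_line.no_double_edge_chain[OF u(1), of 1 2 3] l by (simp add: entries)
    qed
  qed
  then obtain v w where "wt (\<lambda>_. 0) v" "wt (\<lambda>_. 0) w" "v \<noteq> 0" "\<forall>c. w \<noteq> c *s v"
    unfolding thin_def by blast
  then show ?thesis by (intro exI[of _ v] exI[of _ w]) (simp add: wt_def)
qed

section \<open>Invariant polynomial functions\<close>

inductive_set poly_fun :: "(complex^'n^'n \<Rightarrow> complex) set" where
  const: "(\<lambda>X. c) \<in> poly_fun"
| entry: "(\<lambda>X. X $ i $ j) \<in> poly_fun"
| add: "p \<in> poly_fun \<Longrightarrow> q \<in> poly_fun \<Longrightarrow> (\<lambda>X. p X + q X) \<in> poly_fun"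
| mult: "p \<in> poly_fun \<Longrightarrow> q \<in> poly_fun \<Longrightarrow> (\<lambda>X. p X * q X) \<in> poly_fun"

lemma poly_fun_sum: "(\<And>i. i \<in> S \<Longrightarrow> p i \<in> poly_fun) \<Longrightarrow> (\<lambda>X. \<Sum>i\<in>S. p i X) \<in> poly_fun"
  by (induction S rule: infinite_finite_induct) (simp_all add: poly_fun.const poly_fun.add)

lemma poly_fun_prod: "(\<And>i. i \<in> S \<Longrightarrow> p i \<in> poly_fun) \<Longrightarrow> (\<lambda>X. \<Prod>i\<in>S. p i X) \<in> poly_fun"
  by (induction S rule: infinite_finite_induct) (simp_all add: poly_fun.const poly_fun.mult)

lemma poly_fun_det: "det \<in> poly_fun"
  unfolding det_def
  by (rule poly_fun_sum, rule poly_fun.mult[OF poly_fun.const], rule poly_fun_prod, rule poly_fun.entry)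

lemma poly_fun_diff: "p \<in> poly_fun \<Longrightarrow> q \<in> poly_fun \<Longrightarrow> (\<lambda>X. p X - q X) \<in> poly_fun"
  using poly_fun.add[OF _ poly_fun.mult[OF poly_fun.const[of "-1"]], of p q] by simp

section \<open>Directional derivatives and derivatives along the adjoint action\<close>

definition dderiv :: "complex^'n^'n \<Rightarrow> (complex^'n^'n \<Rightarrow> complex) \<Rightarrow> complex^'n^'n \<Rightarrow> complex" where
  "dderiv Z f X = deriv (\<lambda>s. f (X + s *\<^sub>M Z)) 0"

lemma has_dderiv_at:
  assumes "f \<in> poly_fun"
  shows "((\<lambda>s. f (X + s *\<^sub>M Z)) has_field_derivative dderiv Z f (X + s *\<^sub>M Z)) (at s)"
proof -
  have "(\<lambda>s. f (X + s *\<^sub>M Z)) field_differentiable at s" for X s using assms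
  proof induction
    case (entry i j)
    have "((\<lambda>s. X $ i $ j + s * Z $ i $ j) has_field_derivative Z $ i $ j) (at s)"
      by (auto intro!: derivative_eq_intros)
    then show ?case by (auto simp: field_differentiable_def)
  qed (auto intro!: derivative_intros field_differentiable_add field_differentiable_mult)
  then have "((\<lambda>h. f ((X + s *\<^sub>M Z) + h *\<^sub>M Z)) has_field_derivative dderiv Z f (X + s *\<^sub>M Z)) (at 0)"
    by (simp add: dderiv_def DERIV_deriv_iff_field_differentiable)
  moreover have "(X + s *\<^sub>M Z) + h *\<^sub>M Z = X + (h + s) *\<^sub>M Z" for h
    by (simp add: cmat.scale_left_distrib)
  ultimately show ?thesis
    using DERIV_shift[of "\<lambda>h. f (X + h *\<^sub>M Z)" "dderiv Z f (X + s *\<^sub>M Z)" 0 s] by simp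
qed

lemma has_dderiv:
  "f \<in> poly_fun \<Longrightarrow> ((\<lambda>s. f (X + s *\<^sub>M Z)) has_field_derivative dderiv Z f X) (at 0)"
  using has_dderiv_at[of f X Z 0] by simp

lemma dderiv_eqI: "((\<lambda>s. f (X + s *\<^sub>M Z)) has_field_derivative d) (at 0) \<Longrightarrow> dderiv Z f X = d"
  by (simp add: dderiv_def DERIV_imp_deriv)

lemma dderiv_const: "dderiv Z (\<lambda>X. c) = (\<lambda>X. 0)"
  by (simp add: dderiv_def fun_eq_iff)

lemma dderiv_entry: "dderiv Z (\<lambda>X. X $ i $ j) = (\<lambda>X. Z $ i $ j)"
  by (rule ext, rule dderiv_eqI) (auto intro!: derivative_eq_intros)

lemma dderiv_add:
  "p \<in> poly_fun \<Longrightarrow> q \<in> poly_fun \<Longrightarrow>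
    dderiv Z (\<lambda>X. p X + q X) = (\<lambda>X. dderiv Z p X + dderiv Z q X)"
  by (rule ext, rule dderiv_eqI) (intro DERIV_add has_dderiv)

lemma dderiv_mult:
  "p \<in> poly_fun \<Longrightarrow> q \<in> poly_fun \<Longrightarrow>
    dderiv Z (\<lambda>X. p X * q X) = (\<lambda>X. dderiv Z p X * q X + p X * dderiv Z q X)"
  by (rule ext, rule dderiv_eqI) (auto intro!: derivative_eq_intros has_dderiv)

lemmas dderiv_rules = dderiv_const dderiv_entry dderiv_add dderiv_mult

lemma poly_fun_dderiv: "f \<in> poly_fun \<Longrightarrow> dderiv Z f \<in> poly_fun"
  by (induction rule: poly_fun.induct) (simp_all add: dderiv_rules poly_fun.intros)

lemma dderiv_plus: "f \<in> poly_fun \<Longrightarrow> dderiv (A + B) f X = dderiv A f X + dderiv B f X"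
  by (induction rule: poly_fun.induct) (auto simp: dderiv_rules algebra_simps)

lemma dderiv_minus: "f \<in> poly_fun \<Longrightarrow> dderiv (A - B) f X = dderiv A f X - dderiv B f X"
  using dderiv_plus[of f "A - B" B X] by simp

text \<open>The derivative along the vector field generated by conjugation; invariance of
  \<open>f\<close> is expressed by its vanishing.\<close>

definition ad_deriv :: "complex^'n^'n \<Rightarrow> (complex^'n^'n \<Rightarrow> complex) \<Rightarrow> complex^'n^'n \<Rightarrow> complex" where
  "ad_deriv Y f X = dderiv (bracket Y X) f X"

lemma ad_deriv_rules:
  "ad_deriv Y (\<lambda>X. c) = (\<lambda>X. 0)"
  "ad_deriv Y (\<lambda>X. X $ i $ j) = (\<lambda>X. bracket Y X $ i $ j)"
  "p \<in> poly_fun \<Longrightarrow> q \<in> poly_fun \<Longrightarrow>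
    ad_deriv Y (\<lambda>X. p X + q X) = (\<lambda>X. ad_deriv Y p X + ad_deriv Y q X)"
  "p \<in> poly_fun \<Longrightarrow> q \<in> poly_fun \<Longrightarrow>
    ad_deriv Y (\<lambda>X. p X * q X) = (\<lambda>X. ad_deriv Y p X * q X + p X * ad_deriv Y q X)"
  by (simp_all add: ad_deriv_def dderiv_rules fun_eq_iff)

lemma bracket_entry:
  "bracket Y X $ i $ j = (\<Sum>k\<in>UNIV. Y $ i $ k * X $ k $ j) - (\<Sum>k\<in>UNIV. X $ i $ k * Y $ k $ j)"
  by (simp add: bracket_def matrix_matrix_mult_def)

lemma poly_fun_bracket_entry: "(\<lambda>X. bracket Y X $ i $ j) \<in> poly_fun"
  unfolding bracket_entry
  by (intro poly_fun_diff poly_fun_sum poly_fun.mult[OF poly_fun.const poly_fun.entry]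
      poly_fun.mult[OF poly_fun.entry poly_fun.const])

lemma bracket_add: "bracket Y (A + B) = bracket Y A + bracket Y B"
  by (rule linear_add[OF linear_bracket])

lemma dderiv_bracket_entry: "dderiv Z (\<lambda>X. bracket Y X $ i $ j) X = bracket Y Z $ i $ j"
  by (rule dderiv_eqI) (auto simp: bracket_add bracket_mscale intro!: derivative_eq_intros)

lemma poly_fun_ad_deriv: "f \<in> poly_fun \<Longrightarrow> ad_deriv Y f \<in> poly_fun"
  by (induction rule: poly_fun.induct)
    (simp_all add: ad_deriv_rules poly_fun_bracket_entry poly_fun.const poly_fun.add poly_fun.mult)

text \<open>The adjoint vector field is linear in the point, so its commutator with the constant
  field \<open>Z\<close> is the constant field \<open>bracket Y Z\<close>.\<close>

lemma dderiv_ad_deriv: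
  "f \<in> poly_fun \<Longrightarrow> dderiv Z (ad_deriv Y f) X = ad_deriv Y (dderiv Z f) X + dderiv (bracket Y Z) f X"
  by (induction rule: poly_fun.induct)
    (simp_all add: ad_deriv_rules dderiv_rules dderiv_bracket_entry poly_fun_dderiv poly_fun_ad_deriv
      poly_fun.mult algebra_simps)

lemma poly_fun_foldr: "f \<in> poly_fun \<Longrightarrow> foldr dderiv zs f \<in> poly_fun"
  by (induction zs) (auto intro: poly_fun_dderiv)

text \<open>
  An infinitesimal version of Chevalley restriction: all iterated derivatives of \<open>f\<close> at the points
  of \<open>R\<close> vanish, along \<open>R\<close> because \<open>f\<close> is zero there and along \<open>[L, T]\<close> by invariance.
\<close>

lemma invariant_poly_fun_vanishes:
  fixes L R :: "(complex^'n^'n) set"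
  assumes f: "f \<in> poly_fun"
    and inv: "\<And>Y X. ad_deriv Y f X = 0"
    and f0: "\<And>T. T \<in> R \<Longrightarrow> f T = 0"
    and dec: "\<And>T Z. T \<in> R \<Longrightarrow> Z \<in> L \<Longrightarrow>
       \<exists>Z' Y. Y \<in> L \<and> Z = Z' + bracket Y T \<and> (\<forall>\<^sub>F s in nhds 0. T + s *\<^sub>M Z' \<in> R)"
    and L: "\<And>X Y. X \<in> L \<Longrightarrow> Y \<in> L \<Longrightarrow> bracket X Y \<in> L"
    and T: "T \<in> R" and Z: "Z \<in> L"
  shows "f (T + Z) = 0"
proof -
  have main: "\<forall>zs. set zs \<subseteq> L \<longrightarrow> length zs = k \<longrightarrow> (\<forall>T\<in>R. foldr dderiv zs f T = 0)" for k
  proof (induction k)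
    case 0 then show ?case using f0 by simp
  next
    case (Suc k)
    show ?case
    proof (intro allI impI ballI)
      fix zs T assume zs: "set zs \<subseteq> L" "length zs = Suc k" and T: "T \<in> R"
      then obtain z vs where zv: "zs = z # vs" "z \<in> L" "set vs \<subseteq> L" "length vs = k"
        by (cases zs) auto
      define g where "g = foldr dderiv vs f"
      have g: "g \<in> poly_fun" unfolding g_def by (rule poly_fun_foldr[OF f])
      obtain Z' Y where ZY: "Y \<in> L" "z = Z' + bracket Y T" "\<forall>\<^sub>F s in nhds 0. T + s *\<^sub>M Z' \<in> R"
        using dec[OF T zv(2)] by blast
      \<comment> \<open>Along \<open>Z'\<close> the points stay in \<open>R\<close>, where
        \<open>g\<close> is 0 by the induction hypothesis for all points of \<open>R\<close> at
        once.\<close>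
      have "\<forall>\<^sub>F s in nhds 0. g (T + s *\<^sub>M Z') = 0"
        using ZY(3) by eventually_elim (use Suc zv in \<open>auto simp: g_def\<close>)
      then have "deriv (\<lambda>s. g (T + s *\<^sub>M Z')) 0 = deriv (\<lambda>s. 0) 0" by (rule deriv_cong_ev) simp
      then have "dderiv Z' g T = 0" by (simp add: dderiv_def)
      \<comment> \<open>\<open>ys\<close> are the derivatives already moved outside
        \<open>ad_deriv Y\<close>, \<open>xs\<close> those still inside. Each exchange costs a term
        with \<open>k\<close> derivatives of \<open>f\<close>, which is 0 by the outer induction;
        once \<open>xs\<close> is empty, invariance applies to \<open>f\<close> itself.\<close>
      moreover have "foldr dderiv ys (ad_deriv Y (foldr dderiv xs f)) T = 0"
        if "set ys \<subseteq> L" "set xs \<subseteq> L" "length ys + length xs = k" for ys xs using that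
      proof (induction xs arbitrary: ys)
        case Nil
        have "foldr dderiv ys (\<lambda>X. 0) = (\<lambda>X. 0)" by (induction ys) (simp_all add: dderiv_const)
        then show ?case using inv by simp
      next
        case (Cons x xs)
        let ?h = "foldr dderiv xs f"
        have h: "?h \<in> poly_fun" by (rule poly_fun_foldr[OF f])
        have lin: "foldr dderiv ys (\<lambda>X. p X + q X) = (\<lambda>X. foldr dderiv ys p X + foldr dderiv ys q X)"
          if "p \<in> poly_fun" "q \<in> poly_fun" for p q
          by (induction ys) (simp_all add: dderiv_add poly_fun_foldr that)
        have "dderiv x (ad_deriv Y ?h) = (\<lambda>X. ad_deriv Y (dderiv x ?h) X + dderiv (bracket Y x) ?h X)"
          using dderiv_ad_deriv[OF h] by (simp add: fun_eq_iff)
        then have "foldr dderiv (ys @ [x]) (ad_deriv Y ?h) T =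
            foldr dderiv ys (ad_deriv Y (dderiv x ?h)) T + foldr dderiv (ys @ bracket Y x # xs) f T"
          using lin h by (simp add: poly_fun_dderiv poly_fun_ad_deriv)
        moreover have "foldr dderiv (ys @ [x]) (ad_deriv Y ?h) T = 0"
          using Cons.IH[of "ys @ [x]"] Cons.prems by simp
        moreover have "set (ys @ bracket Y x # xs) \<subseteq> L" "length (ys @ bracket Y x # xs) = k"
          using Cons.prems L[OF ZY(1)] by auto
        then have "foldr dderiv (ys @ bracket Y x # xs) f T = 0" using Suc T by blast
        ultimately show ?case by simp
      qed
      from this[of "[]" vs] have "dderiv (bracket Y T) g T = 0"
        using zv by (simp add: g_def ad_deriv_def)
      ultimately show "foldr dderiv zs f T = 0"
        using dderiv_plus[OF g] by (simp add: zv(1) ZY(2) g_def)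
    qed
  qed
  \<comment> \<open>On the complex line from \<open>T\<close> to \<open>T + Z\<close> the function
    is entire and all its derivatives at 0 vanish.\<close>
  define h where "h = (\<lambda>s. f (T + s *\<^sub>M Z))"
  have hk: "(deriv ^^ k) h = (\<lambda>s. foldr dderiv (replicate k Z) f (T + s *\<^sub>M Z))" for k
  proof (induction k)
    case (Suc k)
    show ?case
      using DERIV_imp_deriv[OF has_dderiv_at[OF poly_fun_foldr[OF f], of "replicate k Z" T Z]] by (simp add: Suc)
  qed (simp add: h_def)
  have "h 1 = 0"
  proof (rule holomorphic_fun_eq_0_on_connected[where f = h and S = UNIV and z = 0 and w = 1])
    show "h holomorphic_on UNIV"
      unfolding h_def holomorphic_on_def field_differentiable_def using has_dderiv_at[OF f] by blast
    show "(deriv ^^ n) h 0 = 0" for n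
    proof -
      have "set (replicate n Z) \<subseteq> L" using Z by auto
      then show ?thesis using main[of n] T by (simp add: hk del: foldr_replicate)
    qed
  qed auto
  then show ?thesis by (simp add: h_def)
qed

text \<open>Differentiate \<open>f (X ** (1 + s Y)) = f ((1 + s Y) ** X)\<close> at
  \<open>s = 0\<close>, where \<open>1 + s Y\<close> is invertible for small
  \<open>s\<close>.\<close>

lemma ad_deriv_eq_0:
  assumes f: "f \<in> poly_fun" and sym: "\<And>A B. invertible B \<Longrightarrow> f (A ** B) = f (B ** A)"
  shows "ad_deriv Y f X = 0"
proof -
  have "isCont (\<lambda>s. det (mat 1 + s *\<^sub>M Y)) 0"
    using has_dderiv[OF poly_fun_det] DERIV_isCont by blast
  then have "\<forall>\<^sub>F s in nhds 0. det (mat 1 + s *\<^sub>M Y) \<noteq> 0"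
    by (intro tendsto_imp_eventually_ne[where c = "det (mat 1 :: complex^'n^'n)"])
      (auto simp: isCont_def tendsto_nhds_iff)
  then have "\<forall>\<^sub>F s in nhds 0. f (X + s *\<^sub>M (X ** Y)) = f (X + s *\<^sub>M (Y ** X))"
  proof eventually_elim
    case (elim s)
    have "f (X ** (mat 1 + s *\<^sub>M Y)) = f ((mat 1 + s *\<^sub>M Y) ** X)"
      using sym elim by (simp add: invertible_det_nz)
    then show ?case by (simp add: matrix_diff_distribs mscale_matrix_mult)
  qed
  then have "deriv (\<lambda>s. f (X + s *\<^sub>M (X ** Y))) 0 = deriv (\<lambda>s. f (X + s *\<^sub>M (Y ** X))) 0"
    by (rule deriv_cong_ev) simp
  then have "dderiv (X ** Y) f X = dderiv (Y ** X) f X" by (simp add: dderiv_def)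
  then show ?thesis by (simp add: ad_deriv_def bracket_def dderiv_minus[OF f])
qed

section \<open>The order of vanishing of \<open>det (X + t)\<close> at 0\<close>

lemma det_shift_commute:
  fixes A B :: "complex^'n^'n"
  assumes "invertible B"
  shows "det (A ** B + t *\<^sub>M mat 1) = det (B ** A + t *\<^sub>M mat 1)"
proof -
  have "B ** (A ** B + t *\<^sub>M mat 1) = (B ** A + t *\<^sub>M mat 1) ** B"
    by (simp add: matrix_diff_distribs mscale_matrix_mult matrix_mul_assoc)
  then have "det B * det (A ** B + t *\<^sub>M mat 1) = det (B ** A + t *\<^sub>M mat 1) * det B"
    by (metis det_mul)
  then show ?thesis using assms by (simp add: invertible_det_nz)
qed

lemma ad_deriv_det: "ad_deriv Y det X = 0"
  by (rule ad_deriv_eq_0[OF poly_fun_det]) (simp add: det_mul)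

lemma ad_deriv_dderiv_det: "ad_deriv Y (dderiv (mat 1) det) X = 0"
proof (rule ad_deriv_eq_0[OF poly_fun_dderiv[OF poly_fun_det]])
  fix A B :: "complex^'n^'n" assume B: "invertible B"
  show "dderiv (mat 1) det (A ** B) = dderiv (mat 1) det (B ** A)"
    unfolding dderiv_def by (simp only: det_shift_commute[OF B, of A])
qed

text \<open>In a basis with two vectors from the kernel, two columns of \<open>T + t\<close> are
  divisible by \<open>t\<close>. The diagonal factor \<open>D t\<close> collects this and has
  determinant \<open>t * t\<close>.\<close>

lemma det_vanishes_to_order_2:
  fixes T :: "complex^'n^'n"
  assumes v: "T *v v = 0" "v \<noteq> 0" and w: "T *v w = 0" "\<And>c. w \<noteq> c *s v"
  shows "det T = 0" "dderiv (mat 1) det T = 0"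
proof -
  \<comment> \<open>\<open>k\<close> and \<open>l\<close> are pivot coordinates: \<open>v\<close> is
    nonzero at \<open>k\<close>, while \<open>w'\<close> is 0 at \<open>k\<close> and nonzero at
    \<open>l\<close>. The identity with columns \<open>k\<close> and \<open>l\<close> replaced by
    \<open>v\<close> and \<open>w'\<close> is therefore invertible.\<close>
  obtain k where k: "v $ k \<noteq> 0" using v(2) by (auto simp: vec_eq_iff)
  define w' where "w' = w - (w $ k / v $ k) *s v"
  have w'k: "w' $ k = 0" using k by (simp add: w'_def)
  have "w' \<noteq> 0" using w(2) by (auto simp: w'_def)
  then obtain l where l: "w' $ l \<noteq> 0" by (auto simp: vec_eq_iff)
  have kl: "k \<noteq> l" using w'k l by auto
  have Tw': "T *v w' = 0" using v w by (simp add: w'_def matrix_vector_mult_diff_distrib vector_scalar_commute)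
  define P :: "complex^'n^'n" where
    "P = (\<chi> i j. if j = k then v $ i else if j = l then w' $ i else if i = j then 1 else 0)"
  define N where "N t = (\<chi> i j. if j = k then v $ i else if j = l then w' $ i else ((T + t *\<^sub>M mat 1) ** P) $ i $ j)" for t
  define D :: "complex \<Rightarrow> complex^'n^'n" where "D t = (\<chi> i j. if i = j then (if i = k \<or> i = l then t else 1) else 0)" for t
  have colk: "column k P = v" "column l P = w'" using kl by (auto simp: column_def P_def vec_eq_iff)
  have mul: "(T + t *\<^sub>M mat 1) ** P = N t ** D t" for t
  proof -
    have "((T + t *\<^sub>M mat 1) ** P) $ i $ j = N t $ i $ j * (if j = k \<or> j = l then t else 1)" for i j
    proof -
      have "((T + t *\<^sub>M mat 1) ** P) $ i $ j = ((T + t *\<^sub>M mat 1) *v column j P) $ i"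
        by (simp add: matrix_matrix_mult_def matrix_vector_mult_def column_def)
      then show ?thesis
        using kl v Tw' by (auto simp: N_def colk matrix_vector_mult_add_rdistrib mscale_vector_mult)
    qed
    moreover have "(N t ** D t) $ i $ j = N t $ i $ j * (if j = k \<or> j = l then t else 1)" for i j
      by (simp add: matrix_matrix_mult_def D_def if_distrib cong: if_cong)
    ultimately show ?thesis by (simp add: vec_eq_iff)
  qed
  have "(\<Prod>i\<in>UNIV. D t $ i $ i) = (\<Prod>i\<in>{k, l}. t)" for t
    by (rule prod.mono_neutral_cong_right) (auto simp: D_def)
  then have "det (D t) = t * t" for t using kl by (subst det_diagonal) (auto simp: D_def)
  then have d: "det (T + t *\<^sub>M mat 1) * det P = det (N t) * (t * t)" for t
    using arg_cong[OF mul[of t], of det] by (simp add: det_mul)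
  have "det P \<noteq> 0"
  proof -
    have "x = 0" if x: "P *v x = 0" for x
    proof -
      have "(\<Sum>j\<in>UNIV. P $ i $ j * x $ j) = v $ i * x $ k + w' $ i * x $ l + (if i = k \<or> i = l then 0 else x $ i)" for i
      proof -
        have "(\<Sum>j\<in>UNIV. P $ i $ j * x $ j) = (\<Sum>j\<in>UNIV. (if j = k then v $ i * x $ k else 0)
            + (if j = l then w' $ i * x $ l else 0) + (if j = i then (if i = k \<or> i = l then 0 else x $ i) else 0))"
          by (rule sum.cong) (use kl in \<open>auto simp: P_def\<close>)
        then show ?thesis by (simp add: sum.distrib)
      qed
      then have *: "v $ i * x $ k + w' $ i * x $ l + (if i = k \<or> i = l then 0 else x $ i) = 0" for i
        using arg_cong[OF x, of "\<lambda>y. y $ i"] by (simp add: matrix_vector_mult_def)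
      have xk: "x $ k = 0" using *[of k] w'k k by simp
      then have xl: "x $ l = 0" using *[of l] l by simp
      have "x $ i = 0" for i using *[of i] xk xl by (cases "i = k \<or> i = l") auto
      then show ?thesis by (simp add: vec_eq_iff)
    qed
    then show ?thesis
      by (simp add: invertible_left_inverse matrix_left_invertible_ker flip: invertible_det_nz)
  qed
  define N0 where "N0 = (\<chi> i j. if j = k then v $ i else if j = l then w' $ i else (T ** P) $ i $ j)"
  define N1 where "N1 = (\<chi> i j. if j = k \<or> j = l then 0 else P $ i $ j)"
  have Nt: "N t = N0 + t *\<^sub>M N1" for t
    by (auto simp: vec_eq_iff N_def N0_def N1_def matrix_diff_distribs mscale_matrix_mult)
  have eq: "det (T + t *\<^sub>M mat 1) = det (N0 + t *\<^sub>M N1) / det P * (t * t)" for t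
    using d[of t] \<open>det P \<noteq> 0\<close> by (simp add: Nt field_simps)
  show "det T = 0" using eq[of 0] by simp
  have "((\<lambda>t. det (N0 + t *\<^sub>M N1) / det P * (t * t)) has_field_derivative 0) (at 0)"
    by (rule derivative_eq_intros has_dderiv[OF poly_fun_det] refl | use \<open>det P \<noteq> 0\<close> in simp)+
  then show "dderiv (mat 1) det T = 0" by (intro dderiv_eqI) (simp add: eq)
qed

text \<open>\<open>det (A + t)\<close> is the product of the \<open>d i + t\<close>, in which at
  most one factor vanishes at \<open>t = 0\<close>.\<close>

lemma simple_spectrum_det:
  fixes A P :: "complex^'n^'n"
  assumes P: "invertible P" and AP: "A ** P = P ** (\<chi> i j. if i = j then d i else 0)" and d: "inj d"
  shows "\<not> (det A = 0 \<and> dderiv (mat 1) det A = 0)"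
proof
  assume z: "det A = 0 \<and> dderiv (mat 1) det A = 0"
  define Dg :: "complex^'n^'n" where "Dg = (\<chi> i j. if i = j then d i else 0)"
  have "det (Dg + t *\<^sub>M mat 1) = (\<Prod>i\<in>UNIV. d i + t)" for t
    by (subst det_diagonal) (auto simp: Dg_def mat_def)
  moreover have "(A + t *\<^sub>M mat 1) ** P = P ** (Dg + t *\<^sub>M mat 1)" for t
    using AP by (simp add: Dg_def matrix_diff_distribs mscale_matrix_mult)
  then have "det (A + t *\<^sub>M mat 1) * det P = det P * det (Dg + t *\<^sub>M mat 1)" for t
    by (metis det_mul)
  ultimately have eq: "det (A + t *\<^sub>M mat 1) = (\<Prod>i\<in>UNIV. d i + t)" for t
    using P by (simp add: invertible_det_nz)
  have "(\<Prod>i\<in>UNIV. d i) = 0" using eq[of 0] z by simp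
  then obtain k where k: "d k = 0" by auto
  have eq': "det (A + t *\<^sub>M mat 1) = t * (\<Prod>i\<in>UNIV - {k}. d i + t)" for t
    using eq k by (simp add: prod.remove[of UNIV k])
  have "(\<lambda>t. \<Prod>i\<in>UNIV - {k}. d i + t) holomorphic_on UNIV" by (intro holomorphic_intros)
  then have "(\<lambda>t. \<Prod>i\<in>UNIV - {k}. d i + t) field_differentiable at 0"
    by (simp add: holomorphic_on_def)
  then obtain g' where "((\<lambda>t. \<Prod>i\<in>UNIV - {k}. d i + t) has_field_derivative g') (at 0)"
    by (auto simp: field_differentiable_def)
  then have "((\<lambda>t. t * (\<Prod>i\<in>UNIV - {k}. d i + t)) has_field_derivative (\<Prod>i\<in>UNIV - {k}. d i)) (at 0)"
    by (auto intro!: derivative_eq_intros)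
  then have "dderiv (mat 1) det A = (\<Prod>i\<in>UNIV - {k}. d i)" by (intro dderiv_eqI) (simp add: eq')
  then obtain i where "i \<noteq> k" "d i = 0" using z by auto
  then show False using k d by (auto simp: inj_def)
qed

section \<open>Cartan subalgebras and roots\<close>

lemma bracket_simps:
  fixes A B C :: "complex^'n^'n"
  shows "bracket (A + B) C = bracket A C + bracket B C" "bracket A (B + C) = bracket A B + bracket A C"
    "bracket (A - B) C = bracket A C - bracket B C" "bracket A (B - C) = bracket A B - bracket A C"
    "bracket 0 A = 0" "bracket A 0 = 0" "bracket (- A) B = - bracket A B" "bracket A (- B) = - bracket A B"
    "bracket A A = 0" by (simp_all add: bracket_def matrix_diff_distribs)

lemma bracket_commute: "bracket A B = - bracket B A" for A B :: "complex^'n^'n"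
  by (simp add: bracket_def)

lemma bracket_sum: "bracket A (sum f S) = (\<Sum>x\<in>S. bracket A (f x))" for A :: "complex^'n^'n"
  by (induction S rule: infinite_finite_induct) (simp_all add: bracket_simps)

lemma bracket_eigenvectors_sum_zero:
  fixes A :: "complex^'n^'n"
  assumes "finite S" "\<And>c. c \<in> S \<Longrightarrow> bracket A (y c) = c *\<^sub>M y c" "(\<Sum>c\<in>S. y c) = 0"
  shows "\<forall>c\<in>S. y c = 0"
  using assms
proof (induction S arbitrary: y rule: finite_induct)
  case empty then show ?case by simp
next
  case (insert a S)
  have s: "y a + (\<Sum>c\<in>S. y c) = 0" using insert by simp
  then have "bracket A (y a + (\<Sum>c\<in>S. y c)) = 0" by (simp add: bracket_simps)
  then have "a *\<^sub>M y a + (\<Sum>c\<in>S. c *\<^sub>M y c) = 0"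
    using insert.prems by (simp add: bracket_simps bracket_sum)
  moreover have "a *\<^sub>M (y a + (\<Sum>c\<in>S. y c)) = 0" using s by simp
  then have "a *\<^sub>M y a + (\<Sum>c\<in>S. a *\<^sub>M y c) = 0" by (simp add: cmat.scale_right_distrib cmat.scale_sum_right)
  ultimately have "(\<Sum>c\<in>S. c *\<^sub>M y c) - (\<Sum>c\<in>S. a *\<^sub>M y c) = 0" by (simp add: add_eq_0_iff)
  then have "(\<Sum>c\<in>S. (c - a) *\<^sub>M y c) = 0" by (simp add: cmat.scale_left_diff_distrib sum_subtractf)
  then have "\<forall>c\<in>S. (c - a) *\<^sub>M y c = 0"
    using insert.prems by (intro insert.IH) (auto simp: bracket_mscale cmat.scale_left_commute)
  then have "\<forall>c\<in>S. y c = 0" using insert.hyps by auto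
  then show ?case using s by simp
qed

text \<open>Indexing the components by their eigenvalues collects equal ones, so that
  \<open>bracket_eigenvectors_sum_zero\<close> can be applied to them.\<close>

lemma eigenvector_decomposition:
  fixes A :: "complex^'n^'n"
  assumes "X \<in> cmat.span {X \<in> L. \<exists>c. bracket A X = c *\<^sub>M X}" and L: "cmat.subspace L"
  shows "\<exists>S y. finite S \<and> X = (\<Sum>c\<in>S. y c) \<and> (\<forall>c. y c \<in> L \<and> bracket A (y c) = c *\<^sub>M y c)"
  using assms(1)
proof (induction rule: cmat.span_induct_alt)
  case base
  show ?case by (intro exI[of _ "{}"] exI[of _ "\<lambda>_. 0"]) (auto simp: bracket_simps cmat.subspace_0[OF L])
next
  case (step k X Z)
  then obtain c0 where X: "X \<in> L" "bracket A X = c0 *\<^sub>M X" by auto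
  obtain S y where S: "finite S" "Z = (\<Sum>c\<in>S. y c)" "\<forall>c. y c \<in> L \<and> bracket A (y c) = c *\<^sub>M y c"
    using step.IH by blast
  define y' where "y' c = (if c \<in> S then y c else 0) + (if c = c0 then k *\<^sub>M X else 0)" for c
  have "(\<Sum>c\<in>insert c0 S. y' c) = (\<Sum>c\<in>insert c0 S. if c \<in> S then y c else 0) + k *\<^sub>M X"
    using S(1) by (simp add: y'_def sum.distrib)
  also have "(\<Sum>c\<in>insert c0 S. if c \<in> S then y c else 0) = (\<Sum>c\<in>S. y c)"
    by (rule sum.mono_neutral_cong_right) (use S(1) in auto)
  finally have "k *\<^sub>M X + Z = (\<Sum>c\<in>insert c0 S. y' c)" using S(2) by (simp add: add.commute)
  moreover have "y' c \<in> L \<and> bracket A (y' c) = c *\<^sub>M y' c" for c using S(3) X L unfolding y'_def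
    by (auto simp: bracket_simps bracket_mscale cmat.scale_right_distrib cmat.scale_left_commute
        intro!: cmat.subspace_add cmat.subspace_scale cmat.subspace_0)
  ultimately show ?case using S(1) by blast
qed

locale cartan_setup =
  fixes M D :: "int list list" and L H :: "(complex^'m^'m) set"
    and \<alpha> :: "nat \<Rightarrow> complex^'m^'m \<Rightarrow> complex" and T :: "nat \<Rightarrow> complex^'m^'m"
    and r :: nat
  defines "r \<equiv> length M"
  assumes simple: "simple_lie_algebra L" and cartan: "cartan_subalgebra H L"
    and base: "root_base L H r \<alpha>" and coroot: "\<And>j. j < r \<Longrightarrow> is_coroot L H (\<alpha> j) (T j)"
    and pair: "\<And>i j. i < r \<Longrightarrow> j < r \<Longrightarrow> \<alpha> i (T j) = of_int (M ! i ! j)"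
    and inv: "\<And>i j. i < r \<Longrightarrow> j < r \<Longrightarrow> (\<Sum>k<r. M ! i ! k * D ! k ! j) = (if i = j then 1 else 0)"
begin

lemma L_sub: "cmat.subspace L" and L_bracket: "X \<in> L \<Longrightarrow> Y \<in> L \<Longrightarrow> bracket X Y \<in> L"
  using simple by (auto simp: simple_lie_algebra_def lie_subalgebra_def)

lemma H_sub: "cmat.subspace H" and HL: "X \<in> H \<Longrightarrow> X \<in> L" and HH: "X \<in> H \<Longrightarrow> Y \<in> H \<Longrightarrow> bracket X Y = 0"
  using cartan by (auto simp: cartan_subalgebra_def)

lemmas H_0 = cmat.subspace_0[OF H_sub]
  and H_add = cmat.subspace_add[OF H_sub]
  and H_scale = cmat.subspace_scale[OF H_sub]
  and H_sum = cmat.subspace_sum[OF H_sub]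
  and L_0 = cmat.subspace_0[OF L_sub]
  and L_add = cmat.subspace_add[OF L_sub]
  and L_diff = cmat.subspace_diff[OF L_sub]
  and L_scale = cmat.subspace_scale[OF L_sub]

text \<open>The definition of a Cartan subalgebra diagonalizes each element separately. Since
  elements of \<open>H\<close> commute, the components of a joint eigenvector with respect to one
  more element remain eigenvectors for the earlier ones.\<close>

lemma joint_eigenvectors_span:
  assumes "finite B" "B \<subseteq> H"
  shows "L \<subseteq> cmat.span {X \<in> L. \<forall>S\<in>B. \<exists>c. bracket S X = c *\<^sub>M X}"
  using assms
proof (induction B rule: finite_induct)
  case empty then show ?case using cmat.span_superset[of L] by simp
next
  case (insert S B)
  have "{X \<in> L. \<forall>S\<in>B. \<exists>c. bracket S X = c *\<^sub>M X}
      \<subseteq> cmat.span {X \<in> L. \<forall>S\<in>insert S B. \<exists>c. bracket S X = c *\<^sub>M X}" (is "?A \<subseteq> cmat.span ?B")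
  proof
    fix X assume X: "X \<in> ?A"
    have "X \<in> cmat.span {X \<in> L. \<exists>c. bracket S X = c *\<^sub>M X}"
      using cartan insert.prems X by (auto simp: cartan_subalgebra_def)
    then obtain F y where F: "finite F" "X = (\<Sum>c\<in>F. y c)" "\<And>c. y c \<in> L" "\<And>c. bracket S (y c) = c *\<^sub>M y c"
      using eigenvector_decomposition[OF _ L_sub] by blast
    have "y c \<in> ?B" if c: "c \<in> F" for c
    proof -
      have "\<exists>a. bracket S' (y c) = a *\<^sub>M y c" if S': "S' \<in> B" for S'
      proof -
        obtain a where a: "bracket S' X = a *\<^sub>M X" using X S' by blast
        have SS': "bracket S S' = 0" using HH insert.prems S' by auto
        have "(\<Sum>c\<in>F. bracket S' (y c) - a *\<^sub>M y c) = 0"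
          using a by (simp add: F(2) bracket_sum sum_subtractf cmat.scale_sum_right)
        moreover have "bracket S (bracket S' (y c) - a *\<^sub>M y c) = c *\<^sub>M (bracket S' (y c) - a *\<^sub>M y c)" for c
          using bracket_jacobi[of S S' "y c"] SS'
          by (simp add: bracket_simps bracket_mscale F(4) cmat.scale_right_diff_distrib cmat.scale_left_commute)
        ultimately have "bracket S' (y c) - a *\<^sub>M y c = 0"
          using bracket_eigenvectors_sum_zero[OF F(1), of S "\<lambda>c. bracket S' (y c) - a *\<^sub>M y c"] c by blast
        then show ?thesis by auto
      qed
      then show ?thesis using F(3,4) by auto
    qed
    then show "X \<in> cmat.span ?B" unfolding F(2) by (intro cmat.span_sum cmat.span_base)
  qed
  then have "cmat.span ?A \<subseteq> cmat.span ?B" by (rule cmat.span_minimal) (rule cmat.subspace_span)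
  then show ?case using insert by auto
qed

definition root_vector :: "(complex^'m^'m \<Rightarrow> complex) \<Rightarrow> complex^'m^'m \<Rightarrow> bool" where
  "root_vector \<beta> X \<longleftrightarrow> X \<in> L \<and> (\<forall>S\<in>H. bracket S X = \<beta> S *\<^sub>M X)"

text \<open>A finite real basis of \<open>H\<close> is enough, because the elements for which a
  given \<open>X\<close> is an eigenvector form a real subspace.\<close>

lemma root_vectors_span: "L \<subseteq> cmat.span {X. \<exists>\<beta>. root_vector \<beta> X}"
proof -
  obtain B where B: "B \<subseteq> H" "independent B" "H \<subseteq> span B" using basis_exists[of H] by metis
  have "{X \<in> L. \<forall>S\<in>B. \<exists>c. bracket S X = c *\<^sub>M X} \<subseteq> {X. \<exists>\<beta>. root_vector \<beta> X}"
  proof safe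
    fix X assume X: "X \<in> L" "\<forall>S\<in>B. \<exists>c. bracket S X = c *\<^sub>M X"
    have "subspace {S. \<exists>c. bracket S X = c *\<^sub>M X}" unfolding subspace_def
    proof (safe)
      show "\<exists>c. bracket 0 X = c *\<^sub>M X" by (intro exI[of _ 0]) (simp add: bracket_simps)
    next
      fix S S' c c' assume "bracket S X = c *\<^sub>M X" "bracket S' X = c' *\<^sub>M X"
      then show "\<exists>c. bracket (S + S') X = c *\<^sub>M X"
        by (intro exI[of _ "c + c'"]) (simp add: bracket_simps cmat.scale_left_distrib)
    next
      fix a S c assume "bracket S X = c *\<^sub>M X"
      then show "\<exists>c. bracket (a *\<^sub>R S) X = c *\<^sub>M X"
        by (intro exI[of _ "of_real a * c"]) (simp add: bracket_mscale flip: mscale_of_real)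
    qed
    then have "span B \<subseteq> {S. \<exists>c. bracket S X = c *\<^sub>M X}" using X(2) by (intro span_minimal) auto
    then have "\<forall>S\<in>H. \<exists>c. bracket S X = c *\<^sub>M X" using B(3) by blast
    then obtain \<beta> where "\<forall>S\<in>H. bracket S X = \<beta> S *\<^sub>M X" by metis
    then show "\<exists>\<beta>. root_vector \<beta> X" using X(1) by (auto simp: root_vector_def)
  qed
  then show ?thesis
    using joint_eigenvectors_span[OF independent_imp_finite[OF B(2)] B(1)] cmat.span_mono by blast
qed

lemma root_vector_cases:
  assumes "root_vector \<beta> X" "X \<noteq> 0"
  shows "(X \<in> H \<and> (\<forall>S\<in>H. \<beta> S = 0)) \<or>
    (\<exists>\<epsilon>::complex. \<exists>k::nat \<Rightarrow> nat. (\<epsilon> = 1 \<or> \<epsilon> = -1) \<and> (\<exists>i<r. k i \<noteq> 0) \<and>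
      (\<forall>S\<in>H. \<beta> S = \<epsilon> * (\<Sum>i<r. of_nat (k i) * \<alpha> i S)))"
proof (cases "\<forall>S\<in>H. \<beta> S = 0")
  case True
  then have "X \<in> H" using assms cartan by (auto simp: root_vector_def cartan_subalgebra_def)
  then show ?thesis using True by blast
next
  case False
  then have "is_root L H \<beta>" using assms by (auto simp: is_root_def root_vector_def root_space_def)
  then obtain k :: "nat \<Rightarrow> nat" where
    k: "(\<forall>T\<in>H. \<beta> T = (\<Sum>i<r. of_nat (k i) * \<alpha> i T)) \<or> (\<forall>T\<in>H. \<beta> T = - (\<Sum>i<r. of_nat (k i) * \<alpha> i T))"
    using base unfolding root_base_def by blast
  have "\<exists>\<epsilon>::complex. (\<epsilon> = 1 \<or> \<epsilon> = -1) \<and> (\<forall>S\<in>H. \<beta> S = \<epsilon> * (\<Sum>i<r. of_nat (k i) * \<alpha> i S))"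
    using k by (elim disjE) (intro exI[of _ 1], simp, intro exI[of _ "-1"], simp)
  then obtain \<epsilon> :: complex where \<epsilon>: "\<epsilon> = 1 \<or> \<epsilon> = -1" "\<forall>S\<in>H. \<beta> S = \<epsilon> * (\<Sum>i<r. of_nat (k i) * \<alpha> i S)"
    by blast
  moreover have "\<exists>i<r. k i \<noteq> 0"
  proof (rule ccontr)
    assume "\<not> ?thesis"
    then have "(\<Sum>i<r. of_nat (k i) * \<alpha> i S) = 0" for S by (intro sum.neutral) auto
    then show False using False \<epsilon>(2) by simp
  qed
  ultimately show ?thesis by blast
qed

section \<open>Simple roots and coroots on the Cartan subalgebra\<close>

lemma alpha_linear:
  assumes "i < r" "S \<in> H" "S' \<in> H"
  shows "\<alpha> i (S + S') = \<alpha> i S + \<alpha> i S'" "\<alpha> i (c *\<^sub>M S) = c * \<alpha> i S"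
proof -
  obtain X where X: "X \<noteq> 0" "\<And>S. S \<in> H \<Longrightarrow> bracket S X = \<alpha> i S *\<^sub>M X"
  proof -
    have "is_root L H (\<alpha> i)" using base assms by (simp add: root_base_def)
    then show thesis using that by (auto simp: is_root_def root_space_def)
  qed
  have "\<alpha> i (S + S') *\<^sub>M X = (\<alpha> i S + \<alpha> i S') *\<^sub>M X"
    using X(2)[of "S + S'"] X(2)[of S] X(2)[of S'] assms H_add
    by (simp add: bracket_simps cmat.scale_left_distrib)
  then show "\<alpha> i (S + S') = \<alpha> i S + \<alpha> i S'" using X(1) by (simp only: cmat.scale_cancel_right) simp
  have "\<alpha> i (c *\<^sub>M S) *\<^sub>M X = bracket (c *\<^sub>M S) X" using X(2)[of "c *\<^sub>M S"] assms H_scale by simp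
  also have "\<dots> = (c * \<alpha> i S) *\<^sub>M X" using X(2)[of S] assms by (simp add: bracket_mscale)
  finally have "\<alpha> i (c *\<^sub>M S) *\<^sub>M X = (c * \<alpha> i S) *\<^sub>M X" .
  then show "\<alpha> i (c *\<^sub>M S) = c * \<alpha> i S" using X(1) by (simp only: cmat.scale_cancel_right) simp
qed

lemma T_in_H: "j < r \<Longrightarrow> T j \<in> H"
  using coroot by (auto simp: is_coroot_def)

lemma alpha_0: "i < r \<Longrightarrow> \<alpha> i 0 = 0"
  using alpha_linear(2)[of i 0 0 0] H_0 by simp

lemma coroot_combination:
  assumes "J \<subseteq> {..<r}"
  shows "(\<Sum>j\<in>J. c j *\<^sub>M T j) \<in> H"
    and "i < r \<Longrightarrow> \<alpha> i (\<Sum>j\<in>J. c j *\<^sub>M T j) = (\<Sum>j\<in>J. c j * of_int (M ! i ! j))"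
proof -
  have *: "(\<Sum>j\<in>J. c j *\<^sub>M T j) \<in> H" if "J \<subseteq> {..<r}" for J
    by (intro H_sum H_scale T_in_H) (use that in auto)
  then show "(\<Sum>j\<in>J. c j *\<^sub>M T j) \<in> H" using assms .
  assume i: "i < r"
  have "finite J" using assms finite_subset by blast
  then show "\<alpha> i (\<Sum>j\<in>J. c j *\<^sub>M T j) = (\<Sum>j\<in>J. c j * of_int (M ! i ! j))" using assms
  proof (induction J rule: finite_induct)
    case empty then show ?case using alpha_0 i by simp
  next
    case (insert j J)
    have "\<alpha> i (c j *\<^sub>M T j + (\<Sum>j\<in>J. c j *\<^sub>M T j)) = \<alpha> i (c j *\<^sub>M T j) + \<alpha> i (\<Sum>j\<in>J. c j *\<^sub>M T j)"
      by (rule alpha_linear(1)) (use i insert.prems * T_in_H H_scale in auto)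
    then show ?case using insert i alpha_linear(2)[OF i T_in_H T_in_H] pair by simp
  qed
qed

lemma solve_alpha: "\<exists>c. \<forall>i<r. \<alpha> i (\<Sum>j<r. c j *\<^sub>M T j) = x i"
proof -
  define c where "c j = (\<Sum>k<r. of_int (D ! j ! k) * x k)" for j
  have "\<alpha> i (\<Sum>j<r. c j *\<^sub>M T j) = x i" if i: "i < r" for i
  proof -
    have "\<alpha> i (\<Sum>j<r. c j *\<^sub>M T j) = (\<Sum>j<r. c j * of_int (M ! i ! j))"
      using coroot_combination(2)[of "{..<r}" i c] i by simp
    also have "\<dots> = (\<Sum>k<r. of_int (\<Sum>j<r. M ! i ! j * D ! j ! k) * x k)"
      unfolding c_def sum_distrib_right of_int_sum by (subst sum.swap) (simp add: mult_ac)
    also have "\<dots> = (\<Sum>k<r. (if i = k then x k else 0))" by (rule sum.cong) (use i inv in auto)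
    also have "\<dots> = x i" using i by simp
    finally show ?thesis .
  qed
  then show ?thesis by blast
qed

lemma center_trivial:
  assumes Z: "Z \<in> L" "\<And>X. X \<in> L \<Longrightarrow> bracket Z X = 0" shows "Z = 0"
proof -
  define I where "I = {Z \<in> L. \<forall>X\<in>L. bracket Z X = 0}"
  have "lie_ideal I L" unfolding lie_ideal_def
  proof (intro conjI ballI)
    show "cmat.subspace I" unfolding I_def cmat.subspace_def using L_add L_scale L_0
      by (auto simp: bracket_simps bracket_mscale)
    show "bracket X Y \<in> I" if "X \<in> L" "Y \<in> I" for X Y
      using that bracket_commute[of X Y] L_0 by (auto simp: I_def bracket_simps)
  qed (auto simp: I_def)
  then have "I = {0} \<or> I = L" using simple by (auto simp: simple_lie_algebra_def)
  moreover have "I \<noteq> L" using simple by (auto simp: simple_lie_algebra_def I_def)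
  ultimately show ?thesis using Z by (auto simp: I_def)
qed

text \<open>Some combination of coroots has the same values under the simple roots as
  \<open>S\<close>. The difference is killed by all roots, hence central, hence 0.\<close>

lemma H_span_T:
  assumes S: "S \<in> H" shows "\<exists>c. S = (\<Sum>j<r. c j *\<^sub>M T j)"
proof -
  obtain c where c: "\<forall>i<r. \<alpha> i (\<Sum>j<r. c j *\<^sub>M T j) = \<alpha> i S" using solve_alpha[of "\<lambda>i. \<alpha> i S"] by blast
  define U where "U = (\<Sum>j<r. c j *\<^sub>M T j)"
  have U: "U \<in> H" unfolding U_def by (rule coroot_combination(1)) simp
  define Z where "Z = S + (-1) *\<^sub>M U"
  have mU: "(-1) *\<^sub>M U \<in> H" using U H_scale by blast
  have Z: "Z \<in> H" unfolding Z_def using S mU H_add by blast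
  have aZ: "\<alpha> i Z = 0" if "i < r" for i
    using c that alpha_linear(1)[OF that S mU] alpha_linear(2)[OF that U U, of "-1"]
    by (simp add: Z_def U_def)
  have "{X. \<exists>\<beta>. root_vector \<beta> X} \<subseteq> {X. bracket Z X = 0}"
  proof safe
    fix X \<beta> assume X: "root_vector \<beta> X"
    show "bracket Z X = 0"
    proof (cases "X = 0")
      case False
      have "\<beta> Z = 0" using root_vector_cases[OF X False] Z aZ by auto
      then show ?thesis using X Z by (simp add: root_vector_def)
    qed (simp add: bracket_simps)
  qed
  moreover have "cmat.subspace {X. bracket Z X = 0}"
    unfolding cmat.subspace_def by (auto simp: bracket_simps bracket_mscale)
  ultimately have "L \<subseteq> {X. bracket Z X = 0}" using root_vectors_span cmat.span_minimal by blast
  then have "Z = 0" using center_trivial[OF HL[OF Z]] by blast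
  then show ?thesis by (intro exI[of _ c]) (simp add: Z_def U_def)
qed

text \<open>An open chamber. Every root is a combination of simple roots with coefficients of one
  sign, so none vanishes here, and the finitely many conditions make openness in \<open>H\<close>
  immediate.\<close>

definition regular :: "(complex^'m^'m) set" where
  "regular = {S \<in> H. \<forall>i<r. Re (\<alpha> i S) > 0}"

lemma regular_nonempty: "\<exists>S. S \<in> regular"
proof -
  obtain c where "\<forall>i<r. \<alpha> i (\<Sum>j<r. c j *\<^sub>M T j) = 1" using solve_alpha[of "\<lambda>_. 1"] by blast
  then show ?thesis using coroot_combination(1)[of "{..<r}" c] by (auto simp: regular_def)
qed

lemma regular_open:
  assumes S: "S \<in> regular" and Z: "Z \<in> H"
  shows "\<forall>\<^sub>F s in nhds 0. S + s *\<^sub>M Z \<in> regular"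
proof -
  have S': "S \<in> H" "\<And>i. i < r \<Longrightarrow> Re (\<alpha> i S) > 0" using S by (auto simp: regular_def)
  have sZ: "s *\<^sub>M Z \<in> H" for s using Z H_scale by blast
  have "\<forall>\<^sub>F s in nhds 0. Re (\<alpha> i S + s * \<alpha> i Z) > 0" if i: "i < r" for i
  proof (rule order_tendstoD(1)[OF _ S'(2)[OF i]])
    have "((\<lambda>s. Re (\<alpha> i S + s * \<alpha> i Z)) \<longlongrightarrow> Re (\<alpha> i S + 0 * \<alpha> i Z)) (nhds 0)"
      by (intro tendsto_intros filterlim_ident)
    then show "((\<lambda>s. Re (\<alpha> i S + s * \<alpha> i Z)) \<longlongrightarrow> Re (\<alpha> i S)) (nhds 0)" by simp
  qed
  then have "\<forall>\<^sub>F s in nhds 0. \<forall>i\<in>{..<r}. Re (\<alpha> i S + s * \<alpha> i Z) > 0"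
    by (intro eventually_ball_finite) auto
  then show ?thesis
  proof eventually_elim
    case (elim s)
    then show ?case using S'(1) sZ alpha_linear(1)[OF _ S'(1) sZ] alpha_linear(2)[OF _ Z Z] H_add
      by (simp add: regular_def)
  qed
qed

text \<open>A root vector \<open>X\<close> whose root is nonzero at \<open>S\<close> is the bracket
  of a multiple of \<open>X\<close> with \<open>S\<close>; those of weight 0 lie in
  \<open>H\<close>.\<close>

lemma regular_decomposition:
  assumes S: "S \<in> regular" and Z: "Z \<in> L"
  shows "\<exists>Z'\<in>H. \<exists>Y\<in>L. Z = Z' + bracket Y S"
proof -
  have SH: "S \<in> H" using S by (simp add: regular_def)
  define W where "W = {Z' + bracket Y S | Z' Y. Z' \<in> H \<and> Y \<in> L}"
  have WI: "X \<in> W" if "X = Z' + bracket Y S" "Z' \<in> H" "Y \<in> L" for X Z' Y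
    using that by (auto simp: W_def)
  have 0: "0 \<in> H" "0 \<in> L" using cmat.subspace_0 H_sub L_sub by auto
  have "cmat.subspace W" unfolding cmat.subspace_def
  proof (intro conjI ballI allI)
    show "0 \<in> W" by (rule WI[of _ 0 0]) (simp_all add: 0 bracket_simps)
  next
    fix A B assume "A \<in> W" "B \<in> W"
    then obtain A' B' Y Y' where AB: "A = A' + bracket Y S" "B = B' + bracket Y' S" "A' \<in> H" "B' \<in> H" "Y \<in> L" "Y' \<in> L"
      by (auto simp: W_def)
    show "A + B \<in> W" by (rule WI[of _ "A' + B'" "Y + Y'"])
        (use AB cmat.subspace_add H_sub L_sub in \<open>auto simp: bracket_simps\<close>)
  next
    fix c A assume "A \<in> W"
    then obtain A' Y where A: "A = A' + bracket Y S" "A' \<in> H" "Y \<in> L" by (auto simp: W_def)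
    show "c *\<^sub>M A \<in> W" by (rule WI[of _ "c *\<^sub>M A'" "c *\<^sub>M Y"])
        (use A cmat.subspace_scale H_sub L_sub in \<open>auto simp: bracket_mscale cmat.scale_right_distrib\<close>)
  qed
  moreover have "{X. \<exists>\<beta>. root_vector \<beta> X} \<subseteq> W"
  proof safe
    fix X \<beta> assume X: "root_vector \<beta> X"
    consider "X = 0" | "X \<in> H" | \<epsilon> k where "X \<noteq> 0" "\<epsilon> = 1 \<or> \<epsilon> = - 1" "\<exists>i<r. k i \<noteq> (0::nat)"
        "\<forall>S\<in>H. \<beta> S = \<epsilon> * (\<Sum>i<r. of_nat (k i) * \<alpha> i S)" using root_vector_cases[OF X] by blast
    then show "X \<in> W"
    proof cases
      case 1
      then show ?thesis using \<open>cmat.subspace W\<close> cmat.subspace_0 by blast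
    next
      case 2
      then show ?thesis using 0 by (intro WI[of _ X 0]) (simp_all add: bracket_simps)
    next
      case 3
      obtain i where i: "i < r" "k i \<noteq> 0" using 3 by blast
      have "Re (\<Sum>i<r. of_nat (k i) * \<alpha> i S) = (\<Sum>i<r. of_nat (k i) * Re (\<alpha> i S))" by simp
      also have "\<dots> > 0"
      proof (rule sum_pos2[of _ i])
        have pos: "Re (\<alpha> l S) > 0" if "l < r" for l using S that by (simp add: regular_def)
        show "0 < of_nat (k i) * Re (\<alpha> i S)" using i pos by simp
        show "0 \<le> of_nat (k l) * Re (\<alpha> l S)" if "l \<in> {..<r}" for l
          using pos[of l] that by (intro mult_nonneg_nonneg) auto
      qed (use i in auto)
      finally have "Re (\<Sum>i<r. of_nat (k i) * \<alpha> i S) > 0" .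
      then have "(\<Sum>i<r. of_nat (k i) * \<alpha> i S) \<noteq> 0" by (metis less_irrefl zero_complex.simps(1))
      then have b: "\<beta> S \<noteq> 0" using 3 SH by auto
      define Y where "Y = (- 1 / \<beta> S) *\<^sub>M X"
      have "Y \<in> L" using X L_scale unfolding Y_def root_vector_def by blast
      moreover have "bracket Y S = X"
        using bracket_commute[of X S] X SH b by (simp add: Y_def bracket_mscale bracket_simps root_vector_def)
      ultimately show ?thesis using 0 by (intro WI[of _ 0 Y]) simp_all
    qed
  qed
  ultimately have "L \<subseteq> W" using root_vectors_span cmat.span_minimal by blast
  then have "Z \<in> W" using Z by blast
  then show ?thesis unfolding W_def by blast
qed

text \<open>For \<open>i\<close> and \<open>j\<close> different, the bracket of \<open>X i\<close>
  and \<open>Y j\<close> would have as weight a difference of two simple roots. By independence this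
  is neither 0 nor a combination with coefficients of one sign.\<close>

lemma chevalley_generators:
  obtains X Y where "\<And>i. i < r \<Longrightarrow> X i \<in> L" "\<And>i. i < r \<Longrightarrow> Y i \<in> L" "\<And>i. i < r \<Longrightarrow> X i \<noteq> 0"
    "\<And>i j. i < r \<Longrightarrow> j < r \<Longrightarrow> bracket (T j) (X i) = of_int (M ! i ! j) *\<^sub>M X i"
    "\<And>i j. i < r \<Longrightarrow> j < r \<Longrightarrow> bracket (T j) (Y i) = of_int (- (M ! i ! j)) *\<^sub>M Y i"
    "\<And>i j. i < r \<Longrightarrow> j < r \<Longrightarrow> bracket (X i) (Y j) = (if i = j then T i else 0)"
proof -
  have "\<forall>i. \<exists>X Y. i < r \<longrightarrow> X \<in> root_space L H (\<alpha> i) \<and> Y \<in> root_space L H (\<lambda>S. - \<alpha> i S) \<and> bracket X Y = T i"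
    using coroot by (fastforce simp: is_coroot_def)
  then obtain X Y where XY: "\<And>i. i < r \<Longrightarrow> X i \<in> root_space L H (\<alpha> i)"
    "\<And>i. i < r \<Longrightarrow> Y i \<in> root_space L H (\<lambda>S. - \<alpha> i S)" "\<And>i. i < r \<Longrightarrow> bracket (X i) (Y i) = T i"
    by metis
  have X: "X i \<in> L" "\<And>S. S \<in> H \<Longrightarrow> bracket S (X i) = \<alpha> i S *\<^sub>M X i" if "i < r" for i
    using XY(1)[OF that] by (auto simp: root_space_def)
  have Y: "Y i \<in> L" "\<And>S. S \<in> H \<Longrightarrow> bracket S (Y i) = (- \<alpha> i S) *\<^sub>M Y i" if "i < r" for i
    using XY(2)[OF that] by (auto simp: root_space_def)
  have "X i \<noteq> 0" if i: "i < r" for i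
  proof
    assume "X i = 0"
    then have "T i = 0" using XY(3)[OF i] by (simp add: bracket_simps)
    then show False using coroot[OF i] alpha_0[OF i] by (simp add: is_coroot_def)
  qed
  moreover have "bracket (X i) (Y j) = 0" if ij: "i < r" "j < r" "i \<noteq> j" for i j
  proof (rule ccontr)
    assume nz: "bracket (X i) (Y j) \<noteq> 0"
    have "bracket S (bracket (X i) (Y j)) = (\<alpha> i S - \<alpha> j S) *\<^sub>M bracket (X i) (Y j)" if "S \<in> H" for S
      using bracket_jacobi[of S "X i" "Y j"] X(2)[OF ij(1) that] Y(2)[OF ij(2) that]
      by (simp add: bracket_mscale cmat.scale_left_diff_distrib bracket_simps)
    then have "root_vector (\<lambda>S. \<alpha> i S - \<alpha> j S) (bracket (X i) (Y j))"
      using L_bracket X(1) Y(1) ij by (simp add: root_vector_def)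
    from root_vector_cases[OF this nz] obtain \<epsilon> :: complex and k :: "nat \<Rightarrow> nat"
      where k: "\<epsilon> = 1 \<or> \<epsilon> = -1" "\<forall>S\<in>H. \<alpha> i S - \<alpha> j S = \<epsilon> * (\<Sum>l<r. of_nat (k l) * \<alpha> l S)"
    proof
      assume a: "bracket (X i) (Y j) \<in> H \<and> (\<forall>S\<in>H. \<alpha> i S - \<alpha> j S = 0)"
      \<comment> \<open>Weight 0 is treated as the combination with all coefficients 0, so that the
        comparison below covers both cases.\<close>
      show thesis by (rule that[of 1 "\<lambda>_. 0"]) (use a in simp_all)
    qed blast
    define c where "c l = (if l = i then 1 else if l = j then -1 else 0) - \<epsilon> * of_nat (k l)" for l
    have "(\<Sum>l<r. c l * \<alpha> l S) = 0" if S: "S \<in> H" for S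
    proof -
      have "(\<Sum>l<r. (if l = i then 1 else if l = j then -1 else 0) * \<alpha> l S)
          = (\<Sum>l\<in>{i, j}. (if l = i then 1 else if l = j then -1 else 0) * \<alpha> l S)"
        by (rule sum.mono_neutral_right) (use ij in auto)
      also have "\<dots> = \<alpha> i S - \<alpha> j S" using ij by simp
      finally show ?thesis
        using k(2) S by (simp add: c_def left_diff_distrib sum_subtractf sum_distrib_left mult.assoc)
    qed
    then have "\<forall>l<r. c l = 0" using base unfolding root_base_def by blast
    then have "c i = 0" "c j = 0" using ij by auto
    then have eq: "1 = \<epsilon> * of_nat (k i)" "- 1 = \<epsilon> * of_nat (k j)" using ij by (auto simp: c_def)
    have no: "\<not> (- 1 = (of_nat n :: complex))" for n
      using of_nat_neq_0[of n, where 'a = complex] by (metis of_nat_Suc add.right_inverse)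
    from k(1) show False
    proof
      assume "\<epsilon> = 1"
      then show False using eq(2) no[of "k j"] by (metis mult_1)
    next
      assume "\<epsilon> = -1"
      then show False using eq(1) no[of "k i"] by (metis mult_minus1 minus_minus)
    qed
  qed
  ultimately show thesis using X Y XY(3) T_in_H pair by (intro that[of X Y]) auto
qed

end

text \<open>Both functions are invariant under all of \<open>End(V)\<close>, so the vanishing
  principle can be used for the image of \<open>L\<close> with the image of the chamber as
  \<open>R\<close>. Injectivity of \<open>\<rho>\<close> keeps the Chevalley generators
  nonzero.\<close>

lemma exceptional_singular:
  fixes \<rho> :: "complex^'m^'m \<Rightarrow> complex^'n^'n"
  assumes M: "M = cartan_E8 \<or> M = cartan_F4" and L: "simple_of_type M L"
    and add: "\<And>X Y. X \<in> L \<Longrightarrow> Y \<in> L \<Longrightarrow> \<rho> (X + Y) = \<rho> X + \<rho> Y"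
    and scale: "\<And>c X. X \<in> L \<Longrightarrow> \<rho> (c *\<^sub>M X) = c *\<^sub>M \<rho> X"
    and br: "\<And>X Y. X \<in> L \<Longrightarrow> Y \<in> L \<Longrightarrow> \<rho> (bracket X Y) = bracket (\<rho> X) (\<rho> Y)"
    and inj: "inj_on \<rho> L" and X0: "X0 \<in> L"
  shows "det (\<rho> X0) = 0" "dderiv (mat 1) det (\<rho> X0) = 0"
proof -
  let ?r = "length M"
  obtain H \<alpha> T where H: "simple_lie_algebra L" "cartan_subalgebra H L" "root_base L H (?r) \<alpha>"
    "\<And>j. j < ?r \<Longrightarrow> is_coroot L H (\<alpha> j) (T j)"
    "\<And>i j. i < ?r \<Longrightarrow> j < ?r \<Longrightarrow> \<alpha> i (T j) = of_int (M ! i ! j)"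
    using L unfolding simple_of_type_def by blast
  obtain D where D: "\<And>i j. i < ?r \<Longrightarrow> j < ?r \<Longrightarrow> (\<Sum>k<?r. M ! i ! k * D ! k ! j) = (if i = j then 1 else 0)"
    using M cartan_datum.inv(1)[OF cartan_datum_E8] cartan_datum.inv(1)[OF cartan_datum_F4] by blast
  interpret cartan_setup M D L H \<alpha> T "?r" by unfold_locales (use H D in auto)
  have \<rho>0: "\<rho> 0 = 0" using scale[of 0 0] L_0 by simp
  have diff: "\<rho> (X - Y) = \<rho> X - \<rho> Y" if "X \<in> L" "Y \<in> L" for X Y
    using add[OF that(1), of "(-1) *\<^sub>M Y"] scale[OF that(2), of "-1"] L_scale[OF that(2), of "-1"]
    by simp
  obtain X Y where XY: "\<And>i. i < ?r \<Longrightarrow> X i \<in> L" "\<And>i. i < ?r \<Longrightarrow> Y i \<in> L"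
    "\<And>i. i < ?r \<Longrightarrow> X i \<noteq> 0"
    "\<And>i j. i < ?r \<Longrightarrow> j < ?r \<Longrightarrow> bracket (T j) (X i) = of_int (M ! i ! j) *\<^sub>M X i"
    "\<And>i j. i < ?r \<Longrightarrow> j < ?r \<Longrightarrow> bracket (T j) (Y i) = of_int (- (M ! i ! j)) *\<^sub>M Y i"
    "\<And>i j. i < ?r \<Longrightarrow> j < ?r \<Longrightarrow> bracket (X i) (Y j) = (if i = j then T i else 0)"
    by (rule chevalley_generators, rule that; assumption)
  have TL: "j < ?r \<Longrightarrow> T j \<in> L" for j using T_in_H HL by blast
  have rep: "chevalley_rep (?r) (\<lambda>i j. M ! i ! j) (\<rho> \<circ> X) (\<rho> \<circ> Y) (\<rho> \<circ> T)"
  proof (rule chevalley_rep.intro)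
    show "M ! i ! i = 2" if "i < ?r" for i
      using M that cartan_datum.diag[OF cartan_datum_E8, of i] cartan_datum.diag[OF cartan_datum_F4, of i] by blast
    show "bracket ((\<rho> \<circ> T) i) ((\<rho> \<circ> T) j) = 0" if "i < ?r" "j < ?r" for i j
      using br[OF TL TL, of i j] HH[OF T_in_H T_in_H, of i j] that \<rho>0 by simp
    show "bracket ((\<rho> \<circ> T) j) ((\<rho> \<circ> X) i) = of_int (M ! i ! j) *\<^sub>M (\<rho> \<circ> X) i"
      if "i < ?r" "j < ?r" for i j
      using br[OF TL XY(1), of j i] XY(4)[of i j] scale[OF XY(1)[of i]] that by simp
    show "bracket ((\<rho> \<circ> T) j) ((\<rho> \<circ> Y) i) = of_int (- (M ! i ! j)) *\<^sub>M (\<rho> \<circ> Y) i"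
      if "i < ?r" "j < ?r" for i j
      using br[OF TL XY(2), of j i] XY(5)[of i j] scale[OF XY(2)[of i], of "of_int (- (M ! i ! j))"] that
      by simp
    show "bracket ((\<rho> \<circ> X) i) ((\<rho> \<circ> Y) j) = (if i = j then (\<rho> \<circ> T) i else 0)"
      if "i < ?r" "j < ?r" for i j
      using br[OF XY(1) XY(2), of i j] XY(6)[of i j] \<rho>0 that by (simp split: if_splits)
  qed
  have "(\<rho> \<circ> X) i \<noteq> 0" if "i < ?r" for i
    using inj_onD[OF inj, of "X i" 0] XY(1,3)[OF that] L_0 \<rho>0 by auto
  from zero_weight_multiplicity[OF M rep this] obtain v w where
    vw: "v \<noteq> 0" "\<And>c. w \<noteq> c *s v" "\<And>j. j < ?r \<Longrightarrow> \<rho> (T j) *v v = 0 \<and> \<rho> (T j) *v w = 0" by auto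
  have sum: "\<rho> (\<Sum>j\<in>J. c j *\<^sub>M T j) *v x = (\<Sum>j\<in>J. c j *s (\<rho> (T j) *v x)) \<and> (\<Sum>j\<in>J. c j *\<^sub>M T j) \<in> L"
    if "finite J" "J \<subseteq> {..<?r}" for J c x using that
  proof (induction J rule: finite_induct)
    case empty then show ?case using \<rho>0 L_0 by simp
  next
    case (insert j J)
    have j: "T j \<in> L" "c j *\<^sub>M T j \<in> L" using insert.prems TL L_scale by auto
    then show ?case using insert add[OF j(2)] scale[OF j(1)] L_add[OF j(2)]
      by (simp add: matrix_vector_mult_add_rdistrib mscale_vector_mult)
  qed
  have kill: "\<rho> S *v v = 0 \<and> \<rho> S *v w = 0" if S: "S \<in> H" for S
  proof -
    obtain c where "S = (\<Sum>j<?r. c j *\<^sub>M T j)" using H_span_T[OF S] by blast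
    then show ?thesis using sum[of "{..<?r}" c] vw(3) by simp
  qed
  obtain S0 where S0: "S0 \<in> regular" using regular_nonempty by blast
  then have S0L: "S0 \<in> L" using HL by (simp add: regular_def)
  have van: "f (\<rho> X0) = 0"
    if f: "f \<in> poly_fun" "\<And>Y X. ad_deriv Y f X = 0" and f0: "\<And>S. S \<in> H \<Longrightarrow> f (\<rho> S) = 0" for f
  proof -
    \<comment> \<open>An arbitrary \<open>X0\<close> is reached on the straight line from one
      regular element.\<close>
    have "f (\<rho> S0 + (\<rho> X0 - \<rho> S0)) = 0"
    proof (rule invariant_poly_fun_vanishes[OF f, where R = "\<rho> ` regular" and L = "\<rho> ` L"])
      show "f A = 0" if "A \<in> \<rho> ` regular" for A using that f0 by (auto simp: regular_def)
      show "bracket A B \<in> \<rho> ` L" if "A \<in> \<rho> ` L" "B \<in> \<rho> ` L" for A B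
        using that br L_bracket by (auto simp flip: br)
      show "\<rho> S0 \<in> \<rho> ` regular" using S0 by blast
      show "\<rho> X0 - \<rho> S0 \<in> \<rho> ` L" using diff[OF X0 S0L] L_diff[OF X0 S0L] by (metis imageI)
      fix A Z assume "A \<in> \<rho> ` regular" "Z \<in> \<rho> ` L"
      then obtain S Z0 where SZ: "A = \<rho> S" "S \<in> regular" "Z = \<rho> Z0" "Z0 \<in> L" by blast
      then have SL: "S \<in> L" using HL by (simp add: regular_def)
      obtain Z' Y0 where ZY: "Z' \<in> H" "Y0 \<in> L" "Z0 = Z' + bracket Y0 S"
        using regular_decomposition[OF SZ(2,4)] by blast
      have "Z = \<rho> Z' + bracket (\<rho> Y0) A"
        using add[OF HL[OF ZY(1)] L_bracket[OF ZY(2) SL]] br[OF ZY(2) SL] by (simp add: SZ ZY(3))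
      moreover have "\<forall>\<^sub>F s in nhds 0. A + s *\<^sub>M \<rho> Z' \<in> \<rho> ` regular"
        using regular_open[OF SZ(2) ZY(1)]
      proof eventually_elim
        case (elim s)
        have "A + s *\<^sub>M \<rho> Z' = \<rho> (S + s *\<^sub>M Z')"
          using add[OF SL L_scale[OF HL[OF ZY(1)]]] scale[OF HL[OF ZY(1)]] by (simp add: SZ)
        then show ?case using elim by blast
      qed
      ultimately show "\<exists>Z' Y. Y \<in> \<rho> ` L \<and> Z = Z' + bracket Y A \<and> (\<forall>\<^sub>F s in nhds 0. A + s *\<^sub>M Z' \<in> \<rho> ` regular)"
        using ZY(2) by blast
    qed
    then show ?thesis by simp
  qed
  show "det (\<rho> X0) = 0"
    by (rule van[OF poly_fun_det ad_deriv_det]) (use kill vw det_vanishes_to_order_2(1) in blast)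
  show "dderiv (mat 1) det (\<rho> X0) = 0"
    by (rule van[OF poly_fun_dderiv[OF poly_fun_det] ad_deriv_dderiv_det])
      (use kill vw det_vanishes_to_order_2(2) in blast)
qed

section \<open>The differential of a representation\<close>

text \<open>A derivative of the underlying real map that is complex linear. It can be used along
  complex lines, as in the tangent space, and along real curves, as for the circle.\<close>

definition clinear_deriv :: "(complex^'m^'m \<Rightarrow> complex) \<Rightarrow> (complex^'m^'m \<Rightarrow> complex) \<Rightarrow> complex^'m^'m \<Rightarrow> bool" where
  "clinear_deriv F F' g \<longleftrightarrow> (F has_derivative F') (at g) \<and> (\<forall>c Z. F' (c *\<^sub>M Z) = c * F' Z)"

lemma clinear_deriv_rules:
  fixes g :: "complex^'m^'m"
  shows "clinear_deriv (\<lambda>g. c) (\<lambda>Z. 0) g"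
  "clinear_deriv (\<lambda>g. g $ i $ j) (\<lambda>Z. Z $ i $ j) g"
  "clinear_deriv p p' g \<Longrightarrow> clinear_deriv q q' g \<Longrightarrow> clinear_deriv (\<lambda>g. p g + q g) (\<lambda>Z. p' Z + q' Z) g"
  "clinear_deriv p p' g \<Longrightarrow> clinear_deriv q q' g \<Longrightarrow>
    clinear_deriv (\<lambda>g. p g * q g) (\<lambda>Z. p g * q' Z + p' Z * q g) g"
  "clinear_deriv p p' g \<Longrightarrow> p g \<noteq> 0 \<Longrightarrow>
    clinear_deriv (\<lambda>g. inverse (p g)) (\<lambda>Z. - (inverse (p g) * p' Z * inverse (p g))) g"
proof -
  show "clinear_deriv (\<lambda>g. c) (\<lambda>Z. 0) g" by (simp add: clinear_deriv_def)
  have "bounded_linear (\<lambda>g :: complex^'m^'m. g $ i $ j)"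
    by (rule bounded_linear_compose[OF bounded_linear_vec_nth bounded_linear_vec_nth])
  then show "clinear_deriv (\<lambda>g. g $ i $ j) (\<lambda>Z. Z $ i $ j) g"
    by (simp add: clinear_deriv_def bounded_linear_imp_has_derivative)
  show "clinear_deriv (\<lambda>g. p g + q g) (\<lambda>Z. p' Z + q' Z) g"
    if "clinear_deriv p p' g" "clinear_deriv q q' g"
    using that by (auto simp: clinear_deriv_def algebra_simps intro: has_derivative_add)
  show "clinear_deriv (\<lambda>g. p g * q g) (\<lambda>Z. p g * q' Z + p' Z * q g) g"
    if "clinear_deriv p p' g" "clinear_deriv q q' g"
    using that by (auto simp: clinear_deriv_def algebra_simps intro: has_derivative_mult[THEN has_derivative_eq_rhs])
  show "clinear_deriv (\<lambda>g. inverse (p g)) (\<lambda>Z. - (inverse (p g) * p' Z * inverse (p g))) g"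
    if "clinear_deriv p p' g" "p g \<noteq> 0"
    using that by (auto simp: clinear_deriv_def algebra_simps intro: Deriv.has_derivative_inverse[THEN has_derivative_eq_rhs])
qed

lemma poly_fun_clinear_deriv: "p \<in> poly_fun \<Longrightarrow> \<exists>p'. clinear_deriv p p' g"
  by (induction rule: poly_fun.induct) (blast intro: clinear_deriv_rules)+

lemma regular_fun_clinear_deriv: "F \<in> regular_fun K \<Longrightarrow> det g \<noteq> 0 \<Longrightarrow> \<exists>F'. clinear_deriv F F' g"
proof (induction rule: regular_fun.induct)
  case inv_det
  then show ?case using poly_fun_clinear_deriv[OF poly_fun_det, of g] clinear_deriv_rules(5) by blast
qed (blast intro: clinear_deriv_rules)+

lemma clinear_deriv_line:
  assumes "clinear_deriv F F' g"
  shows "((\<lambda>s. F (g + s *\<^sub>M Z)) has_field_derivative F' Z) (at 0)"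
proof -
  have lin: "((\<lambda>s. g + s *\<^sub>M Z) has_derivative (\<lambda>s. s *\<^sub>M Z)) (at 0)"
  proof -
    have "bounded_linear (\<lambda>s. s *\<^sub>M Z)"
      by (rule linear_conv_bounded_linear[THEN iffD1], rule linearI)
        (simp_all add: vec_eq_iff distrib_right)
    then show ?thesis by (auto intro!: derivative_eq_intros bounded_linear_imp_has_derivative)
  qed
  have "(F has_derivative F') (at (g + 0 *\<^sub>M Z))" using assms by (simp add: clinear_deriv_def)
  from has_derivative_compose[OF lin this]
  have "((\<lambda>s. F (g + s *\<^sub>M Z)) has_derivative (\<lambda>s. F' (s *\<^sub>M Z))) (at 0)" .
  moreover have "(\<lambda>s. F' (s *\<^sub>M Z)) = (*) (F' Z)"
    using assms by (simp add: clinear_deriv_def fun_eq_iff mult.commute)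
  ultimately show ?thesis by (simp add: has_field_derivative_def)
qed

lemma clinear_deriv_dderiv: "clinear_deriv F F' g \<Longrightarrow> dderiv Z F g = F' Z"
  by (rule dderiv_eqI[OF clinear_deriv_line])

lemma regular_fun_line:
  assumes "F \<in> regular_fun K" "det g \<noteq> 0"
  shows "((\<lambda>s. F (g + s *\<^sub>M Z)) has_field_derivative dderiv Z F g) (at 0)"
  using regular_fun_clinear_deriv[OF assms] clinear_deriv_line clinear_deriv_dderiv by metis

lemma regular_fun_dderiv_linear:
  assumes "F \<in> regular_fun K" "det g \<noteq> 0"
  shows "dderiv (X + Y) F g = dderiv X F g + dderiv Y F g" "dderiv (c *\<^sub>M X) F g = c * dderiv X F g"
proof -
  obtain F' where F': "clinear_deriv F F' g" using regular_fun_clinear_deriv[OF assms] by blast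
  then have "linear F'" unfolding clinear_deriv_def using has_derivative_linear by blast
  then show "dderiv (X + Y) F g = dderiv X F g + dderiv Y F g"
    by (simp add: clinear_deriv_dderiv[OF F'] linear_add)
  show "dderiv (c *\<^sub>M X) F g = c * dderiv X F g"
    using F' by (simp add: clinear_deriv_dderiv[OF F'] clinear_deriv_def)
qed

lemma regular_fun_curve:
  assumes F: "F \<in> regular_fun K" and \<gamma>: "(\<gamma> has_vector_derivative X) (at 0)" "\<gamma> 0 = mat 1"
  shows "((\<lambda>t. F (\<gamma> t)) has_vector_derivative dderiv X F (mat 1)) (at 0)"
proof -
  obtain F' where F': "clinear_deriv F F' (mat 1)" using regular_fun_clinear_deriv[OF F, of "mat 1"] by auto
  then have "(F has_derivative F') (at (\<gamma> 0))" "linear F'"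
    using \<gamma>(2) has_derivative_linear by (auto simp: clinear_deriv_def)
  from has_derivative_compose[OF \<gamma>(1)[unfolded has_vector_derivative_def] this(1)] this(2)
  show ?thesis by (simp add: has_vector_derivative_def linear_scale clinear_deriv_dderiv[OF F'])
qed

section \<open>Closure properties of regular functions\<close>

lemma regular_fun_mono: "F \<in> regular_fun \<rat> \<Longrightarrow> F \<in> regular_fun UNIV"
  by (induction rule: regular_fun.induct) (auto intro: regular_fun.const regular_fun.entry
      regular_fun.inv_det regular_fun.add regular_fun.mult)

lemma regular_fun_sum:
  "(\<And>i. i \<in> S \<Longrightarrow> p i \<in> regular_fun UNIV) \<Longrightarrow> (\<lambda>g. \<Sum>i\<in>S. p i g) \<in> regular_fun UNIV"
  by (induction S rule: infinite_finite_induct) (simp_all add: regular_fun.const regular_fun.add)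

lemma regular_fun_cmult: "p \<in> regular_fun UNIV \<Longrightarrow> (\<lambda>g. c * p g) \<in> regular_fun UNIV"
  by (rule regular_fun.mult[OF regular_fun.const]) auto

lemma regular_fun_diff:
  "p \<in> regular_fun UNIV \<Longrightarrow> q \<in> regular_fun UNIV \<Longrightarrow> (\<lambda>g. p g - q g) \<in> regular_fun UNIV"
  using regular_fun.add[OF _ regular_fun_cmult[of q "-1"], of p] by simp

lemma regular_fun_translate:
  "F \<in> regular_fun UNIV \<Longrightarrow> (\<lambda>h. F (g ** h)) \<in> regular_fun UNIV"
proof (induction rule: regular_fun.induct)
  case (const c) then show ?case using regular_fun.const by blast
next
  case (entry i j)
  have "(\<lambda>h. \<Sum>k\<in>UNIV. g $ i $ k * h $ k $ j) \<in> regular_fun UNIV"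
    by (intro regular_fun_sum regular_fun_cmult regular_fun.entry)
  then show ?case by (simp add: matrix_matrix_mult_def)
next
  case inv_det
  have "(\<lambda>h. inverse (det g) * inverse (det h)) \<in> regular_fun UNIV"
    by (intro regular_fun_cmult regular_fun.inv_det)
  then show ?case by (simp add: det_mul)
next
  case (add p q) then show ?case using regular_fun.add by blast
next
  case (mult p q) then show ?case using regular_fun.mult by blast
qed

text \<open>Identities between regular functions are meaningful only on invertible matrices; these
  form a neighbourhood of the identity, so derivatives there agree.\<close>

lemma dderiv_cong_invertible:
  assumes "\<And>g. det g \<noteq> 0 \<Longrightarrow> F g = F' g"
  shows "dderiv X F (mat 1) = dderiv X F' (mat 1)"
proof -
  have "isCont (\<lambda>s. det (mat 1 + s *\<^sub>M X)) 0"
    using has_dderiv[OF poly_fun_det] DERIV_isCont by blast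
  then have "\<forall>\<^sub>F s in nhds 0. det (mat 1 + s *\<^sub>M X) \<noteq> 0"
    by (intro tendsto_imp_eventually_ne[where c = "det (mat 1 :: complex^'a^'a)"])
      (auto simp: isCont_def tendsto_nhds_iff)
  then have "\<forall>\<^sub>F s in nhds 0. F (mat 1 + s *\<^sub>M X) = F' (mat 1 + s *\<^sub>M X)"
    by eventually_elim (rule assms)
  then show ?thesis unfolding dderiv_def by (rule deriv_cong_ev) simp
qed

text \<open>This is \<open>trace [Y, X] = 0\<close>. Invariance of \<open>det\<close> at
  \<open>1 + t X\<close> gives \<open>t\<close> times its derivative along \<open>[Y, X]\<close>
  equal to 0; divide by \<open>t\<close> and let \<open>t\<close> tend to 0.\<close>

lemma dderiv_det_bracket: "dderiv (bracket Y X) det (mat 1) = 0"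
proof -
  let ?g = "dderiv (bracket Y X) det"
  have "?g (mat 1 + t *\<^sub>M X) = 0" if "t \<noteq> 0" for t
  proof -
    have "bracket Y (mat 1 + t *\<^sub>M X) = t *\<^sub>M bracket Y X"
      by (simp add: bracket_simps bracket_mscale) (simp add: bracket_def)
    then have "dderiv (t *\<^sub>M bracket Y X) det (mat 1 + t *\<^sub>M X) = 0"
      using ad_deriv_det[of Y "mat 1 + t *\<^sub>M X"] by (simp add: ad_deriv_def)
    moreover obtain p' where "clinear_deriv det p' (mat 1 + t *\<^sub>M X)"
      using poly_fun_clinear_deriv[OF poly_fun_det] by blast
    then have "dderiv (t *\<^sub>M bracket Y X) det (mat 1 + t *\<^sub>M X) = t * ?g (mat 1 + t *\<^sub>M X)"
      by (simp add: clinear_deriv_dderiv) (simp add: clinear_deriv_def)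
    ultimately show ?thesis using that by simp
  qed
  then have "((\<lambda>t. ?g (mat 1 + t *\<^sub>M X)) \<longlongrightarrow> 0) (at 0)"
    by (intro tendsto_eventually) (auto simp: eventually_at_filter)
  moreover have "((\<lambda>t. ?g (mat 1 + t *\<^sub>M X)) \<longlongrightarrow> ?g (mat 1)) (at 0)"
    using DERIV_isCont[OF has_dderiv[OF poly_fun_dderiv[OF poly_fun_det], of _ "mat 1" X]]
    by (simp add: isCont_def)
  ultimately show ?thesis using LIM_unique by blast
qed

text \<open>The left invariant vector field with value \<open>Y\<close> at the identity.\<close>

definition left_deriv :: "complex^'m^'m \<Rightarrow> (complex^'m^'m \<Rightarrow> complex) \<Rightarrow> complex^'m^'m \<Rightarrow> complex" where
  "left_deriv Y F g = dderiv (g ** Y) F g"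

lemma left_deriv_1: "left_deriv Y F (mat 1) = dderiv Y F (mat 1)"
  by (simp add: left_deriv_def)

lemma left_deriv_det:
  fixes g Y :: "complex^'m^'m"
  shows "left_deriv Y det g = det g * dderiv Y det (mat 1)"
proof -
  have "det (g + s *\<^sub>M (g ** Y)) = det g * det (mat 1 + s *\<^sub>M Y)" for s
    by (simp add: matrix_diff_distribs mscale_matrix_mult flip: det_mul)
  then show ?thesis unfolding left_deriv_def
    by (intro dderiv_eqI) (simp add: DERIV_cmult has_dderiv[OF poly_fun_det])
qed

lemma left_deriv_rules:
  fixes g Y :: "complex^'m^'m"
  assumes g: "det g \<noteq> 0"
  shows "left_deriv Y (\<lambda>g. c) g = 0"
    "left_deriv Y (\<lambda>g. g $ i $ j) g = (\<Sum>k\<in>UNIV. Y $ k $ j * g $ i $ k)"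
    "left_deriv Y (\<lambda>g. inverse (det g)) g = - dderiv Y det (mat 1) * inverse (det g)"
    "p \<in> regular_fun K \<Longrightarrow> q \<in> regular_fun K \<Longrightarrow>
      left_deriv Y (\<lambda>g. p g + q g) g = left_deriv Y p g + left_deriv Y q g"
    "p \<in> regular_fun K \<Longrightarrow> q \<in> regular_fun K \<Longrightarrow>
      left_deriv Y (\<lambda>g. p g * q g) g = left_deriv Y p g * q g + p g * left_deriv Y q g"
proof -
  show "left_deriv Y (\<lambda>g. c) g = 0" by (simp add: left_deriv_def dderiv_const)
  show "left_deriv Y (\<lambda>g. g $ i $ j) g = (\<Sum>k\<in>UNIV. Y $ k $ j * g $ i $ k)"
    by (simp add: left_deriv_def dderiv_entry matrix_matrix_mult_def mult.commute)
  have "((\<lambda>s. det (g + s *\<^sub>M (g ** Y))) has_field_derivative det g * dderiv Y det (mat 1)) (at 0)"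
    using has_dderiv[OF poly_fun_det, of g "g ** Y"] left_deriv_det[of Y g] by (simp add: left_deriv_def)
  then have "((\<lambda>s. inverse (det (g + s *\<^sub>M (g ** Y)))) has_field_derivative
      - (inverse (det g) * (det g * dderiv Y det (mat 1)) * inverse (det g))) (at 0)"
    using DERIV_inverse'[of "\<lambda>s. det (g + s *\<^sub>M (g ** Y))" _ 0] g by simp
  then show "left_deriv Y (\<lambda>g. inverse (det g)) g = - dderiv Y det (mat 1) * inverse (det g)"
    unfolding left_deriv_def using g by (intro dderiv_eqI) (simp add: field_simps)
  assume p: "p \<in> regular_fun K" and q: "q \<in> regular_fun K"
  note d = regular_fun_line[OF p g, of "g ** Y"] regular_fun_line[OF q g, of "g ** Y"]
  show "left_deriv Y (\<lambda>g. p g + q g) g = left_deriv Y p g + left_deriv Y q g"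
    unfolding left_deriv_def by (intro dderiv_eqI DERIV_add d)
  show "left_deriv Y (\<lambda>g. p g * q g) g = left_deriv Y p g * q g + p g * left_deriv Y q g"
    unfolding left_deriv_def using DERIV_mult[OF d] by (intro dderiv_eqI) (simp add: mult.commute)
qed

lemma left_deriv_regular:
  "F \<in> regular_fun UNIV \<Longrightarrow> \<exists>F'\<in>regular_fun UNIV. \<forall>g. det g \<noteq> 0 \<longrightarrow> left_deriv Y F g = F' g"
proof (induction rule: regular_fun.induct)
  case (const c)
  show ?case by (intro bexI[of _ "\<lambda>g. 0"] regular_fun.const) (auto simp: left_deriv_rules)
next
  case (entry i j)
  show ?case
    by (intro bexI[of _ "\<lambda>g. \<Sum>k\<in>UNIV. Y $ k $ j * g $ i $ k"] regular_fun_sum regular_fun_cmult regular_fun.entry)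
      (auto simp: left_deriv_rules)
next
  case inv_det
  show ?case
    by (intro bexI[of _ "\<lambda>g. - dderiv Y det (mat 1) * inverse (det g)"] regular_fun_cmult regular_fun.inv_det)
      (auto simp: left_deriv_rules)
next
  case (add p q)
  then obtain p' q' where "p' \<in> regular_fun UNIV" "q' \<in> regular_fun UNIV"
    "\<forall>g. det g \<noteq> 0 \<longrightarrow> left_deriv Y p g = p' g" "\<forall>g. det g \<noteq> 0 \<longrightarrow> left_deriv Y q g = q' g" by blast
  then show ?case using add.hyps
    by (intro bexI[of _ "\<lambda>g. p' g + q' g"] regular_fun.add) (auto simp: left_deriv_rules)
next
  case (mult p q)
  then obtain p' q' where "p' \<in> regular_fun UNIV" "q' \<in> regular_fun UNIV"
    "\<forall>g. det g \<noteq> 0 \<longrightarrow> left_deriv Y p g = p' g" "\<forall>g. det g \<noteq> 0 \<longrightarrow> left_deriv Y q g = q' g" by blast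
  then show ?case using mult.hyps
    by (intro bexI[of _ "\<lambda>g. p' g * q g + p g * q' g"] regular_fun.add regular_fun.mult)
      (auto simp: left_deriv_rules)
qed

lemma dderiv_regular_rules:
  assumes "p \<in> regular_fun K" "q \<in> regular_fun K"
  shows "dderiv X (\<lambda>g. p g + q g) (mat 1) = dderiv X p (mat 1) + dderiv X q (mat 1)"
    "dderiv X (\<lambda>g. p g * q g) (mat 1) = dderiv X p (mat 1) * q (mat 1) + p (mat 1) * dderiv X q (mat 1)"
  using left_deriv_rules(4,5)[OF _ assms, of "mat 1" X] by (simp_all add: left_deriv_1)

text \<open>\<open>left_deriv Y p\<close> is controlled only on invertible matrices, so it is
  replaced by a regular function with the same germ at the identity.\<close>

lemma left_deriv_representative:
  assumes "p \<in> regular_fun UNIV"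
  obtains p' where "p' \<in> regular_fun UNIV" "\<And>g. det g \<noteq> 0 \<Longrightarrow> left_deriv Y p g = p' g"
    "p' (mat 1) = dderiv Y p (mat 1)" "\<And>X. dderiv X p' (mat 1) = dderiv X (left_deriv Y p) (mat 1)"
proof -
  obtain p' where p': "p' \<in> regular_fun UNIV" "\<And>g. det g \<noteq> 0 \<Longrightarrow> left_deriv Y p g = p' g"
    using left_deriv_regular[OF assms] by blast
  show thesis
    by (rule that[OF p']) (use p'(2)[of "mat 1"] in \<open>simp_all add: left_deriv_1 dderiv_cong_invertible[OF p'(2)]\<close>)
qed

lemma dderiv_left_deriv_add:
  assumes p: "p \<in> regular_fun UNIV" and q: "q \<in> regular_fun UNIV"
  shows "dderiv X (left_deriv Y (\<lambda>g. p g + q g)) (mat 1)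
    = dderiv X (left_deriv Y p) (mat 1) + dderiv X (left_deriv Y q) (mat 1)"
proof -
  obtain p' where p': "p' \<in> regular_fun UNIV" "\<And>g. det g \<noteq> 0 \<Longrightarrow> left_deriv Y p g = p' g"
    "\<And>X. dderiv X p' (mat 1) = dderiv X (left_deriv Y p) (mat 1)"
    using left_deriv_representative[OF p] by blast
  obtain q' where q': "q' \<in> regular_fun UNIV" "\<And>g. det g \<noteq> 0 \<Longrightarrow> left_deriv Y q g = q' g"
    "\<And>X. dderiv X q' (mat 1) = dderiv X (left_deriv Y q) (mat 1)"
    using left_deriv_representative[OF q] by blast
  have "dderiv X (left_deriv Y (\<lambda>g. p g + q g)) (mat 1) = dderiv X (\<lambda>g. p' g + q' g) (mat 1)"
    by (rule dderiv_cong_invertible) (simp add: left_deriv_rules(4)[OF _ p q] p' q')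
  then show ?thesis by (simp add: dderiv_regular_rules(1)[OF p'(1) q'(1)] p'(3) q'(3))
qed

lemma dderiv_left_deriv_mult:
  assumes p: "p \<in> regular_fun UNIV" and q: "q \<in> regular_fun UNIV"
  shows "dderiv X (left_deriv Y (\<lambda>g. p g * q g)) (mat 1) =
    dderiv X (left_deriv Y p) (mat 1) * q (mat 1) + dderiv Y p (mat 1) * dderiv X q (mat 1)
    + (dderiv X p (mat 1) * dderiv Y q (mat 1) + p (mat 1) * dderiv X (left_deriv Y q) (mat 1))"
proof -
  obtain p' where p': "p' \<in> regular_fun UNIV" "\<And>g. det g \<noteq> 0 \<Longrightarrow> left_deriv Y p g = p' g"
    "p' (mat 1) = dderiv Y p (mat 1)" "\<And>X. dderiv X p' (mat 1) = dderiv X (left_deriv Y p) (mat 1)"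
    using left_deriv_representative[OF p] by blast
  obtain q' where q': "q' \<in> regular_fun UNIV" "\<And>g. det g \<noteq> 0 \<Longrightarrow> left_deriv Y q g = q' g"
    "q' (mat 1) = dderiv Y q (mat 1)" "\<And>X. dderiv X q' (mat 1) = dderiv X (left_deriv Y q) (mat 1)"
    using left_deriv_representative[OF q] by blast
  have "dderiv X (left_deriv Y (\<lambda>g. p g * q g)) (mat 1) = dderiv X (\<lambda>g. p' g * q g + p g * q' g) (mat 1)"
    by (rule dderiv_cong_invertible) (simp add: left_deriv_rules(5)[OF _ p q] p' q')
  also have "\<dots> = (dderiv X p' (mat 1) * q (mat 1) + p' (mat 1) * dderiv X q (mat 1))
      + (dderiv X p (mat 1) * q' (mat 1) + p (mat 1) * dderiv X q' (mat 1))"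
    by (simp add: dderiv_regular_rules[of _ UNIV] regular_fun.mult p q p'(1) q'(1))
  finally show ?thesis by (simp only: p'(3,4) q'(3,4))
qed

text \<open>The commutator of two left invariant fields is the field of the bracket. In the product
  case the mixed first order terms are symmetric in \<open>X\<close> and \<open>Y\<close> and
  cancel.\<close>

lemma left_deriv_commutator:
  fixes X Y :: "complex^'m^'m"
  assumes "F \<in> regular_fun UNIV"
  shows "dderiv X (left_deriv Y F) (mat 1) - dderiv Y (left_deriv X F) (mat 1) = dderiv (bracket X Y) F (mat 1)"
  using assms
proof (induction rule: regular_fun.induct)
  case (const c)
  have "left_deriv Z (\<lambda>g. c) = (\<lambda>g. 0)" for Z :: "complex^'m^'m"
    by (simp add: left_deriv_def dderiv_const fun_eq_iff)
  then show ?case by (simp add: dderiv_const)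
next
  case (entry i j)
  have ld: "left_deriv Z (\<lambda>g. g $ i $ j) = (\<lambda>g. (g ** Z) $ i $ j)" for Z :: "complex^'m^'m"
    by (simp add: left_deriv_def dderiv_entry fun_eq_iff)
  have "dderiv W (\<lambda>g. (g ** Z) $ i $ j) (mat 1) = (W ** Z) $ i $ j" for W Z :: "complex^'m^'m"
    by (rule dderiv_eqI) (auto simp: matrix_diff_distribs mscale_matrix_mult intro!: derivative_eq_intros)
  then show ?case by (simp add: ld dderiv_entry bracket_def)
next
  case inv_det
  let ?d = "\<lambda>g :: complex^'m^'m. inverse (det g)"
  have d: "?d \<in> regular_fun UNIV" by (rule regular_fun.inv_det)
  have 1: "dderiv Z ?d (mat 1) = - dderiv Z det (mat 1)" for Z :: "complex^'m^'m"
    using left_deriv_rules(3)[of "mat 1" Z] by (simp add: left_deriv_1)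
  \<comment> \<open>The second derivative is symmetric in \<open>W\<close> and \<open>Z\<close>, so
    the commutator vanishes, in accordance with \<open>dderiv_det_bracket\<close>.\<close>
  have "dderiv W (left_deriv Z ?d) (mat 1) = dderiv W det (mat 1) * dderiv Z det (mat 1)" for W Z :: "complex^'m^'m"
  proof -
    have "dderiv W (left_deriv Z ?d) (mat 1) = dderiv W (\<lambda>g. (- dderiv Z det (mat 1)) * ?d g) (mat 1)"
      by (rule dderiv_cong_invertible) (simp add: left_deriv_rules(3))
    also have "\<dots> = dderiv W det (mat 1) * dderiv Z det (mat 1)"
      using dderiv_regular_rules(2)[OF regular_fun.const[of "- dderiv Z det (mat 1)" UNIV, OF UNIV_I] d, where X = W]
      by (simp add: dderiv_const 1)
    finally show ?thesis .
  qed
  then show ?case by (simp add: 1 dderiv_det_bracket mult.commute)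
next
  case (add p q)
  show ?case
    unfolding dderiv_left_deriv_add[OF add.hyps] dderiv_regular_rules(1)[OF add.hyps] add.IH[symmetric]
    by simp
next
  case (mult p q)
  show ?case
    unfolding dderiv_left_deriv_mult[OF mult.hyps] dderiv_regular_rules(2)[OF mult.hyps] mult.IH[symmetric]
    by (simp add: algebra_simps)
qed

section \<open>The differential is a representation of the Lie algebra\<close>

locale group_rep =
  fixes G :: "(complex^'m^'m) set" and \<pi> :: "complex^'m^'m \<Rightarrow> complex^'n^'n"
    and F :: "'n \<Rightarrow> 'n \<Rightarrow> complex^'m^'m \<Rightarrow> complex"
  assumes G_inv: "g \<in> G \<Longrightarrow> det g \<noteq> 0" and G_mult: "g \<in> G \<Longrightarrow> h \<in> G \<Longrightarrow> g ** h \<in> G"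
    and hom: "g \<in> G \<Longrightarrow> h \<in> G \<Longrightarrow> \<pi> (g ** h) = \<pi> g ** \<pi> h"
    and F: "F i j \<in> regular_fun UNIV" "g \<in> G \<Longrightarrow> \<pi> g $ i $ j = F i j g"
begin

abbreviation "L \<equiv> lie_algebra_of G"
abbreviation "\<rho> \<equiv> differential_at_1 G \<pi>"

lemma lie_algebra_dderiv: "X \<in> L \<Longrightarrow> f \<in> regular_fun UNIV \<Longrightarrow> (\<And>g. g \<in> G \<Longrightarrow> f g = 0) \<Longrightarrow> dderiv X f (mat 1) = 0"
  by (intro dderiv_eqI) (auto simp: lie_algebra_of_def)

text \<open>Derivatives along tangent vectors depend only on the values on \<open>G\<close>. This
  makes the definite description in the differential well defined.\<close>

lemma lie_algebra_dderiv_cong: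
  assumes "X \<in> L" "p \<in> regular_fun UNIV" "q \<in> regular_fun UNIV" "\<And>g. g \<in> G \<Longrightarrow> p g = q g"
  shows "dderiv X p (mat 1) = dderiv X q (mat 1)"
proof -
  have "dderiv X (\<lambda>g. p g - q g) (mat 1) = 0"
    by (rule lie_algebra_dderiv) (use assms regular_fun_diff in auto)
  moreover have "dderiv X (\<lambda>g. p g - q g) (mat 1) = dderiv X p (mat 1) - dderiv X q (mat 1)"
    by (intro dderiv_eqI DERIV_diff regular_fun_line[of _ UNIV]) (use assms in auto)
  ultimately show ?thesis by simp
qed

lemma differential_entry: "X \<in> L \<Longrightarrow> \<rho> X $ i $ j = dderiv X (F i j) (mat 1)"
proof -
  assume X: "X \<in> L"
  have "(THE c. \<exists>f \<in> regular_fun UNIV. (\<forall>g\<in>G. f g = \<pi> g $ i $ j) \<and>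
               ((\<lambda>t. f (mat 1 + t *\<^sub>M X)) has_field_derivative c) (at 0)) = dderiv X (F i j) (mat 1)"
  proof (rule the_equality)
    show "\<exists>f \<in> regular_fun UNIV. (\<forall>g\<in>G. f g = \<pi> g $ i $ j) \<and>
       ((\<lambda>t. f (mat 1 + t *\<^sub>M X)) has_field_derivative dderiv X (F i j) (mat 1)) (at 0)"
      using F regular_fun_line[OF F(1), of "mat 1"] by (intro bexI[of _ "F i j"]) auto
  next
    fix c assume "\<exists>f \<in> regular_fun UNIV. (\<forall>g\<in>G. f g = \<pi> g $ i $ j) \<and>
               ((\<lambda>t. f (mat 1 + t *\<^sub>M X)) has_field_derivative c) (at 0)"
    then obtain f where f: "f \<in> regular_fun UNIV" "\<forall>g\<in>G. f g = \<pi> g $ i $ j"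
      "((\<lambda>t. f (mat 1 + t *\<^sub>M X)) has_field_derivative c) (at 0)" by blast
    then have "c = dderiv X f (mat 1)" using dderiv_eqI by metis
    also have "\<dots> = dderiv X (F i j) (mat 1)"
      by (rule lie_algebra_dderiv_cong[OF X f(1) F(1)]) (use f F in auto)
    finally show "c = dderiv X (F i j) (mat 1)" .
  qed
  then show ?thesis by (simp add: differential_at_1_def)
qed

lemma lie_algebra_subspace: "cmat.subspace L"
  unfolding cmat.subspace_def
proof (intro conjI ballI allI)
  have LI: "X \<in> L" if "\<And>f. f \<in> regular_fun UNIV \<Longrightarrow> \<forall>g\<in>G. f g = 0 \<Longrightarrow> dderiv X f (mat 1) = 0" for X
    unfolding lie_algebra_of_def using that regular_fun_line[of _ UNIV "mat 1" X] by force
  have lin: "dderiv (X + Y) f (mat 1) = dderiv X f (mat 1) + dderiv Y f (mat 1)"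
    "dderiv (c *\<^sub>M X) f (mat 1) = c * dderiv X f (mat 1)" if "f \<in> regular_fun UNIV" for f X Y c
    using regular_fun_dderiv_linear[OF that, of "mat 1"] by auto
  show "0 \<in> L" by (rule LI) (use lin(2)[of _ 0 0] in auto)
  show "X + Y \<in> L" if "X \<in> L" "Y \<in> L" for X Y
    by (rule LI) (simp add: lin(1) that lie_algebra_dderiv)
  show "c *\<^sub>M X \<in> L" if "X \<in> L" for X c by (rule LI) (simp add: lin(2) that lie_algebra_dderiv)
qed

lemma differential_linear:
  assumes "X \<in> L" "Y \<in> L"
  shows "\<rho> (X + Y) = \<rho> X + \<rho> Y" "\<rho> (c *\<^sub>M X) = c *\<^sub>M \<rho> X"
  using assms cmat.subspace_add[OF lie_algebra_subspace] cmat.subspace_scale[OF lie_algebra_subspace]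
    regular_fun_dderiv_linear[OF F(1), of "mat 1"] by (simp_all add: vec_eq_iff differential_entry)

text \<open>Differentiating the homomorphism law in its second argument along \<open>Y\<close> gives
  \<open>F\<close> times \<open>\<rho> Y\<close>. This holds on \<open>G\<close> only, but the outer
  derivative is along \<open>X\<close>, which is tangent to \<open>G\<close>.\<close>

lemma dderiv_left_deriv_F:
  assumes X: "X \<in> L" and Y: "Y \<in> L"
  shows "dderiv X (left_deriv Y (F i j)) (mat 1) = (\<rho> X ** \<rho> Y) $ i $ j"
proof -
  have on_G: "left_deriv Y (F i j) g = (\<Sum>k\<in>UNIV. \<rho> Y $ k $ j * F i k g)" if g: "g \<in> G" for g
  proof -
    have "dderiv Y (\<lambda>h. F i j (g ** h)) (mat 1) = dderiv Y (\<lambda>h. \<Sum>k\<in>UNIV. F i k g * F k j h) (mat 1)"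
    proof (rule lie_algebra_dderiv_cong[OF Y])
      show "(\<lambda>h. F i j (g ** h)) \<in> regular_fun UNIV" by (rule regular_fun_translate[OF F(1)])
      show "(\<lambda>h. \<Sum>k\<in>UNIV. F i k g * F k j h) \<in> regular_fun UNIV"
        by (intro regular_fun_sum regular_fun_cmult F(1))
      show "F i j (g ** h) = (\<Sum>k\<in>UNIV. F i k g * F k j h)" if h: "h \<in> G" for h
        using hom[OF g h] g h G_mult[OF g h] by (simp add: F(2)[symmetric] matrix_matrix_mult_def)
    qed
    moreover have "dderiv Y (\<lambda>h. F i j (g ** h)) (mat 1) = left_deriv Y (F i j) g"
      by (simp add: left_deriv_def dderiv_def matrix_diff_distribs mscale_matrix_mult)
    moreover have "dderiv Y (\<lambda>h. \<Sum>k\<in>UNIV. F i k g * F k j h) (mat 1) = (\<Sum>k\<in>UNIV. F i k g * dderiv Y (F k j) (mat 1))"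
      by (intro dderiv_eqI DERIV_sum DERIV_cmult regular_fun_line[OF F(1)]) simp
    ultimately show ?thesis by (simp add: differential_entry[OF Y] mult.commute)
  qed
  obtain f where f: "f \<in> regular_fun UNIV" "\<And>g. det g \<noteq> 0 \<Longrightarrow> left_deriv Y (F i j) g = f g"
    using left_deriv_regular[OF F(1)] by blast
  have "dderiv X (left_deriv Y (F i j)) (mat 1) = dderiv X f (mat 1)"
    by (rule dderiv_cong_invertible) (rule f(2))
  also have "\<dots> = dderiv X (\<lambda>g. \<Sum>k\<in>UNIV. \<rho> Y $ k $ j * F i k g) (mat 1)"
    by (rule lie_algebra_dderiv_cong[OF X f(1)])
      (use on_G f(2) G_inv in \<open>auto intro!: regular_fun_sum regular_fun_cmult F(1)\<close>)
  also have "\<dots> = (\<Sum>k\<in>UNIV. \<rho> Y $ k $ j * dderiv X (F i k) (mat 1))"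
    by (intro dderiv_eqI DERIV_sum DERIV_cmult regular_fun_line[OF F(1)]) simp
  finally show ?thesis by (simp add: matrix_matrix_mult_def differential_entry[OF X] mult.commute)
qed

lemma differential_bracket:
  assumes "X \<in> L" "Y \<in> L" "bracket X Y \<in> L"
  shows "\<rho> (bracket X Y) = bracket (\<rho> X) (\<rho> Y)"
  using left_deriv_commutator[OF F(1)]
  by (simp add: vec_eq_iff differential_entry assms dderiv_left_deriv_F bracket_def[of "\<rho> X"] flip: left_deriv_commutator[OF F(1)])

end

section \<open>Circle representations\<close>

lemma has_vector_derivative_matrixI:
  fixes \<gamma> :: "real \<Rightarrow> complex^'m^'n"
  assumes "\<And>i j. ((\<lambda>t. \<gamma> t $ i $ j) has_vector_derivative X $ i $ j) (at a)"
  shows "(\<gamma> has_vector_derivative X) (at a)"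
  unfolding has_vector_derivative_def
proof (subst has_derivative_componentwise_within, rule ballI)
  fix B :: "complex^'m^'n" assume "B \<in> Basis"
  then obtain i j b where B: "B = axis i (axis j b)" by (auto simp: Basis_vec_def)
  have "((\<lambda>t. \<gamma> t $ i $ j \<bullet> b) has_derivative (\<lambda>x. (x *\<^sub>R X $ i $ j) \<bullet> b)) (at a)"
    using has_derivative_inner_left[OF assms[of i j, unfolded has_vector_derivative_def]] .
  then show "((\<lambda>x. \<gamma> x \<bullet> B) has_derivative (\<lambda>x. x *\<^sub>R X \<bullet> B)) (at a)" by (simp add: B inner_axis)
qed

text \<open>On the circle \<open>cnj z\<close> is \<open>1 / z\<close>, so real and imaginary part
  are Laurent polynomials in \<open>z\<close>; \<open>N\<close> clears the denominator.\<close>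

lemma real_polynomial_circle_laurent:
  fixes p :: "complex \<Rightarrow> real"
  assumes "real_polynomial_function p"
  shows "\<exists>N P. \<forall>z\<in>sphere 0 1. z ^ N * of_real (p z) = poly P z"
  using assms
proof (induction rule: real_polynomial_function.induct)
  case (linear f)
  interpret bounded_linear f by (rule linear)
  have fz: "f z = Re z * f 1 + Im z * f \<i>" for z
  proof -
    have "z = Re z *\<^sub>R 1 + Im z *\<^sub>R \<i>" by (simp add: complex_eq_iff)
    then have "f z = f (Re z *\<^sub>R 1 + Im z *\<^sub>R \<i>)" by simp
    then show ?thesis by (simp add: add scaleR)
  qed
  define P where "P = [: of_real (f 1) / 2 - of_real (f \<i>) / (2 * \<i>), 0, of_real (f 1) / 2 + of_real (f \<i>) / (2 * \<i>) :]"
  have "z * of_real (f z) = poly P z" if z: "z \<in> sphere 0 1" for z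
  proof -
    have zz: "z * cnj z = 1" using z complex_norm_square[of z] by simp
    have r: "of_real (Re z) = (z + cnj z) / 2" "of_real (Im z) = (z - cnj z) / (2 * \<i>)"
      by (simp_all add: complex_eq_iff)
    have "z * of_real (f z) = (z * z + z * cnj z) / 2 * of_real (f 1) + (z * z - z * cnj z) / (2 * \<i>) * of_real (f \<i>)"
      by (subst fz) (simp only: of_real_add of_real_mult r, simp add: field_simps)
    also have "\<dots> = poly P z" unfolding zz P_def by (simp add: field_simps)
    finally show ?thesis .
  qed
  then show ?case by (intro exI[of _ 1] exI[of _ P]) simp
next
  case (const c)
  show ?case by (intro exI[of _ 0] exI[of _ "[:of_real c:]"]) simp
next
  case (add f g)
  then obtain N P M Q where *: "\<forall>z\<in>sphere 0 1. z ^ N * of_real (f z) = poly P z"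
    "\<forall>z\<in>sphere 0 1. z ^ M * of_real (g z) = poly Q z" by blast
  have "z ^ (N + M) * of_real (f z + g z) = poly (monom 1 M * P + monom 1 N * Q) z" if "z \<in> sphere 0 1" for z
    using * that by (simp add: poly_monom power_add flip: *(1)[rule_format] *(2)[rule_format]) (simp add: algebra_simps)
  then show ?case by blast
next
  case (mult f g)
  then obtain N P M Q where *: "\<forall>z\<in>sphere 0 1. z ^ N * of_real (f z) = poly P z"
    "\<forall>z\<in>sphere 0 1. z ^ M * of_real (g z) = poly Q z" by blast
  have "z ^ (N + M) * of_real (f z * g z) = poly (P * Q) z" if "z \<in> sphere 0 1" for z
    using that by (simp add: power_add flip: *(1)[rule_format] *(2)[rule_format])
  then show ?case by blast
qed

lemma infinite_circle: "infinite (sphere 0 1 :: complex set)"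
proof
  assume fin: "finite (sphere 0 1 :: complex set)"
  have "connected (sphere 0 1 :: complex set)" by (rule connected_sphere) simp
  from connected_finite_iff_sing[OF this] fin
  have "sphere 0 1 = {} \<or> (\<exists>a::complex. sphere 0 1 = {a})" by simp
  moreover have "1 \<in> sphere (0::complex) 1" "-1 \<in> sphere (0::complex) 1" by auto
  ultimately obtain a :: complex where "1 = a" "-1 = a" by blast
  then show False by simp
qed

section \<open>Weight decomposition of a representation of the circle\<close>

definition circle_weight_space :: "(complex \<Rightarrow> complex^'n^'n) \<Rightarrow> int \<Rightarrow> (complex^'n) set" where
  "circle_weight_space \<psi> k = {v. \<forall>z\<in>sphere 0 1. \<psi> z *v v = z powi k *s v}"

text \<open>The \<open>A k\<close> are the coefficients of \<open>z ^ m * \<psi> z\<close>.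
  Comparing coefficients in \<open>w\<close> in the law for \<open>\<psi> (z * w)\<close> shows that
  \<open>A k\<close> has its image in weight \<open>k - m\<close>, and at \<open>z = 1\<close> they
  sum to the identity.\<close>

lemma circle_weight_spaces_span:
  fixes \<psi> :: "complex \<Rightarrow> complex^'n^'n"
  assumes mult: "\<And>z w. z \<in> sphere 0 1 \<Longrightarrow> w \<in> sphere 0 1 \<Longrightarrow> \<psi> (z * w) = \<psi> z ** \<psi> w"
    and one: "\<psi> 1 = mat 1"
    and poly: "\<And>i j. \<exists>p. real_polynomial_function p \<and> (\<forall>z \<in> sphere 0 1. \<psi> z $ i $ j = of_real (p z))"
  shows "v \<in> vec.span (\<Union>k. circle_weight_space \<psi> k)"
proof -
  have "\<forall>i j. \<exists>N P. \<forall>z\<in>sphere 0 1. z ^ N * \<psi> z $ i $ j = poly P z"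
    using poly real_polynomial_circle_laurent by metis
  then obtain N P where NP: "\<And>i j z. z \<in> sphere 0 1 \<Longrightarrow> z ^ N i j * \<psi> z $ i $ j = poly (P i j) z" by metis
  define m where "m = Max (range (\<lambda>(i, j). N i j))"
  have Nm: "N i j \<le> m" for i j
    unfolding m_def by (rule Max_ge) (auto intro: image_eqI[of _ _ "(i, j)"])
  define Q where "Q i j = P i j * monom 1 (m - N i j)" for i j
  have Q: "z ^ m * \<psi> z $ i $ j = poly (Q i j) z" if z: "z \<in> sphere 0 1" for z i j
  proof -
    have "z ^ m = z ^ N i j * z ^ (m - N i j)" using Nm[of i j] by (simp flip: power_add)
    then show ?thesis by (simp add: Q_def poly_monom flip: NP[OF z])
  qed
  define d where "d = Max (range (\<lambda>(i, j). degree (Q i j)))"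
  have Qd: "degree (Q i j) \<le> d" for i j
    unfolding d_def by (rule Max_ge) (auto intro: image_eqI[of _ _ "(i, j)"])
  define A :: "nat \<Rightarrow> complex^'n^'n" where "A k = (\<chi> i j. coeff (Q i j) k)" for k
  have key: "z ^ k *\<^sub>M A k = z ^ m *\<^sub>M (\<psi> z ** A k)" if z: "z \<in> sphere 0 1" for z k
  proof -
    have "z ^ k * coeff (Q i j) k = z ^ m * (\<Sum>l\<in>UNIV. \<psi> z $ i $ l * coeff (Q l j) k)" for i j
    proof -
      \<comment> \<open>For fixed \<open>z\<close> this is the difference of both sides as a
        polynomial in \<open>w\<close>. It vanishes on the infinite circle, hence
        identically.\<close>
      define R where "R = pcompose (Q i j) [:0, z:] - (\<Sum>l\<in>UNIV. smult (z ^ m * \<psi> z $ i $ l) (Q l j))"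
      have "poly R w = 0" if w: "w \<in> sphere 0 1" for w
      proof -
        have zw: "z * w \<in> sphere 0 1" using z w by (simp add: norm_mult)
        have "poly (Q i j) (z * w) = (z * w) ^ m * (\<Sum>l\<in>UNIV. \<psi> z $ i $ l * \<psi> w $ l $ j)"
          using Q[OF zw, of i j] mult[OF z w] by (simp add: matrix_matrix_mult_def)
        also have "\<dots> = (\<Sum>l\<in>UNIV. z ^ m * \<psi> z $ i $ l * (w ^ m * \<psi> w $ l $ j))"
          by (simp add: sum_distrib_left power_mult_distrib mult_ac)
        also have "\<dots> = (\<Sum>l\<in>UNIV. z ^ m * \<psi> z $ i $ l * poly (Q l j) w)" by (simp only: Q[OF w])
        finally show ?thesis by (simp add: R_def poly_pcompose poly_sum mult.commute)
      qed
      then have "infinite {w. poly R w = 0}"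
        using infinite_circle by (metis (mono_tags, lifting) finite_subset mem_Collect_eq subsetI)
      then have "R = 0" using poly_roots_finite by blast
      then have "coeff R k = 0" by simp
      then show ?thesis
        by (simp add: R_def coeff_pcompose_linear coeff_sum sum_distrib_left mult.assoc)
    qed
    then show ?thesis by (simp add: vec_eq_iff A_def matrix_matrix_mult_def)
  qed
  have "A k *v v \<in> circle_weight_space \<psi> (int k - int m)" for k unfolding circle_weight_space_def
  proof (intro CollectI ballI)
    fix z :: complex assume z: "z \<in> sphere 0 1"
    then have z0: "z \<noteq> 0" by auto
    have "z ^ m *s (\<psi> z *v (A k *v v)) = z ^ k *s (A k *v v)"
      using key[OF z, of k] by (metis matrix_vector_mul_assoc mscale_vector_mult)
    then have "(1 / z ^ m) *s (z ^ m *s (\<psi> z *v (A k *v v))) = (1 / z ^ m) *s (z ^ k *s (A k *v v))" by simp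
    then show "\<psi> z *v (A k *v v) = z powi (int k - int m) *s (A k *v v)"
      using z0 by (simp add: vector_smult_assoc power_int_diff)
  qed
  then have "(\<Sum>k\<le>d. A k *v v) \<in> vec.span (\<Union>k. circle_weight_space \<psi> k)"
    by (intro vec.span_sum vec.span_base) blast
  moreover have "v = (\<Sum>k\<le>d. A k *v v)"
  proof -
    have "\<psi> 1 $ i $ j = (\<Sum>k\<le>d. A k $ i $ j)" for i j
    proof -
      have "\<psi> 1 $ i $ j = poly (Q i j) 1" using Q[of 1 i j] by simp
      also have "\<dots> = (\<Sum>k\<le>degree (Q i j). coeff (Q i j) k)" by (simp add: poly_altdef)
      also have "\<dots> = (\<Sum>k\<le>d. coeff (Q i j) k)"
        by (rule sum.mono_neutral_left) (use Qd[of i j] in \<open>auto intro: coeff_eq_0\<close>)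
      finally show ?thesis by (simp add: A_def)
    qed
    then have "mat 1 = (\<Sum>k\<le>d. A k)" by (simp add: vec_eq_iff flip: one)
    then have "v = (\<Sum>k\<le>d. A k) *v v" by (metis matrix_vector_mul_lid)
    also have "\<dots> = (\<Sum>k\<le>d. A k *v v)"
      by (induction d) (simp_all add: matrix_vector_mult_add_rdistrib)
    finally show ?thesis .
  qed
  ultimately show ?thesis by (rule ssubst[where P = "\<lambda>x. x \<in> vec.span _", rotated])
qed

text \<open>A basis can be chosen inside the union of the \<open>V k\<close>. Two of its members in
  one \<open>V k\<close> would contradict dimension 1, so the eigenvalues are distinct.\<close>

lemma diagonalizable_simple_spectrum_det:
  fixes A :: "complex^'n^'n" and V :: "int \<Rightarrow> (complex^'n) set"
  assumes span: "\<And>v. v \<in> vec.span (\<Union>k. V k)"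
    and eig: "\<And>k v. v \<in> V k \<Longrightarrow> A *v v = (\<i> * of_int k) *s v"
    and dim: "\<And>k. V k \<noteq> {0} \<Longrightarrow> V k \<noteq> {} \<Longrightarrow> vec.dim (V k) = 1"
  shows "\<not> (det A = 0 \<and> dderiv (mat 1) det A = 0)"
proof -
  obtain B where B: "B \<subseteq> (\<Union>k. V k)" "vec.independent B" "(\<Union>k. V k) \<subseteq> vec.span B"
    using vec.maximal_independent_subset by blast
  have spB: "vec.span B = UNIV" using span vec.span_minimal[OF B(3) vec.subspace_span] by blast
  have "card B = CARD('n)"
    using vec.basis_card_eq_dim[of B UNIV] B(2) spB by (simp add: vec_dim_card card_cart_basis)
  moreover have "finite B" using B(2) vec.finiteI_independent by blast
  ultimately obtain f :: "'n \<Rightarrow> complex^'n" where f: "bij_betw f UNIV B"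
    using finite_same_card_bij[of "UNIV :: 'n set" B] by auto
  have fB: "f j \<in> B" for j using f by (auto simp: bij_betw_def)
  have inj: "inj f" using f by (auto simp: bij_betw_def)
  have "\<forall>j. \<exists>k. f j \<in> V k" using fB B(1) by blast
  then obtain k where k: "\<And>j. f j \<in> V (k j)" by metis
  define P :: "complex^'n^'n" where "P = (\<chi> i j. f j $ i)"
  have Px: "P *v x = (\<Sum>j\<in>UNIV. x $ j *s f j)" for x
    by (simp add: vec_eq_iff P_def matrix_vector_mult_def mult.commute)
  have "x = 0" if x: "P *v x = 0" for x
  proof -
    have "(\<Sum>b\<in>B. x $ (inv f b) *s b) = (\<Sum>j\<in>UNIV. x $ j *s f j)"
      by (rule sum.reindex_bij_betw[OF f, symmetric, THEN trans]) (simp add: inv_f_f[OF inj])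
    then have "(\<Sum>b\<in>B. x $ (inv f b) *s b) = 0" using x Px by simp
    then have "x $ (inv f b) = 0" if "b \<in> B" for b
      using vec.independentD[OF B(2) \<open>finite B\<close> order_refl, of "\<lambda>b. x $ (inv f b)" b] that by blast
    then have "x $ j = 0" for j using fB[of j] inv_f_f[OF inj, of j] by metis
    then show ?thesis by (simp add: vec_eq_iff)
  qed
  then have P: "invertible P" by (simp add: invertible_left_inverse matrix_left_invertible_ker)
  have "(A ** P) $ i $ j = (P ** (\<chi> i j. if i = j then \<i> * of_int (k i) else 0)) $ i $ j" for i j
  proof -
    have "(A ** P) $ i $ j = (A *v f j) $ i"
      by (simp add: matrix_matrix_mult_def matrix_vector_mult_def P_def)
    also have "\<dots> = \<i> * of_int (k j) * f j $ i" using eig[OF k] by simp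
    finally show ?thesis by (simp add: matrix_matrix_mult_def P_def if_distrib mult.commute cong: if_cong)
  qed
  then have AP: "A ** P = P ** (\<chi> i j. if i = j then \<i> * of_int (k i) else 0)" by (simp add: vec_eq_iff)
  have "inj (\<lambda>j. \<i> * of_int (k j))"
  proof (rule injI, rule ccontr)
    fix a b assume ab: "\<i> * complex_of_int (k a) = \<i> * of_int (k b)" "a \<noteq> b"
    then have kk: "k a = k b" by simp
    have "vec.independent {f a, f b}" by (rule vec.independent_mono[OF B(2)]) (use fB in auto)
    moreover have "{f a, f b} \<subseteq> V (k a)" using k[of a] k[of b] kk by simp
    ultimately have "card {f a, f b} \<le> vec.dim (V (k a))" by (intro vec.independent_card_le_dim)
    moreover have "card {f a, f b} = 2" using ab(2) inj_eq[OF inj, of a b] by simp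
    moreover have "f a \<noteq> 0" using vec.dependent_zero B(2) fB by metis
    ultimately show False using dim[of "k a"] k[of a] by force
  qed
  from simple_spectrum_det[OF P AP this] show ?thesis .
qed

theorem corollary2p15:
  fixes G :: "(complex^'m^'m) set"
  assumes "rational_algebraic_group G"
    and "simple_of_type cartan_E8 (lie_algebra_of G) \<or> simple_of_type cartan_F4 (lie_algebra_of G)"
  shows "\<not> (\<exists>(w :: int) (Q :: 'n::finite form) \<pi> \<phi>.
             hodge_representation G w Q \<pi> \<phi> \<and> principal_hodge w (\<pi> \<circ> \<phi>))"
proof (intro notI, elim exE conjE)
  fix w :: int and Q :: "'n form" and \<pi> \<phi>
  assume rep: "hodge_representation G w Q \<pi> \<phi>" and principal: "principal_hodge w (\<pi> \<circ> \<phi>)"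
  define \<psi> where "\<psi> = \<pi> \<circ> \<phi>"
  have hom: "rational_group_hom G (form_aut Q) \<pi>" and inj: "inj_on (differential_at_1 G \<pi>) (lie_algebra_of G)"
    and \<phi>: "circle_hom G \<phi>" and pol: "polarized_hodge_structure w Q \<psi>"
    using rep by (auto simp: hodge_representation_def \<psi>_def)
  have \<psi>: "circle_hom (form_aut Q) \<psi>" and \<psi>_minus: "\<psi> (-1) = (-1) powi w *\<^sub>M mat 1"
    using pol by (auto simp: polarized_hodge_structure_def)
  have G: "\<And>g. g \<in> G \<Longrightarrow> det g \<noteq> 0" "\<And>g h. g \<in> G \<Longrightarrow> h \<in> G \<Longrightarrow> g ** h \<in> G"
    using assms(1) by (auto simp: rational_algebraic_group_def invertible_det_nz)
  have "\<forall>i j. \<exists>F. F \<in> regular_fun \<rat> \<and> (\<forall>g\<in>G. \<pi> g $ i $ j = F g)"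
    using hom unfolding rational_group_hom_def by blast
  then obtain F where F: "\<And>i j. F i j \<in> regular_fun \<rat>" "\<And>i j g. g \<in> G \<Longrightarrow> \<pi> g $ i $ j = F i j g" by metis
  have FU: "F i j \<in> regular_fun UNIV" for i j by (rule regular_fun_mono[OF F(1)])
  interpret group_rep G \<pi> F
    by unfold_locales (use G hom F(2) FU in \<open>auto simp: rational_group_hom_def\<close>)
  \<comment> \<open>A homomorphism of the circle is only required to be multiplicative; its value at
    1 is an invertible idempotent.\<close>
  have idem: "A = mat 1" if "A ** A = A" "det A \<noteq> 0" for A :: "complex^'a^'a"
  proof -
    obtain B where "B ** A = mat 1" using \<open>det A \<noteq> 0\<close> invertible_det_nz invertible_left_inverse by metis
    then show ?thesis using \<open>A ** A = A\<close> by (metis matrix_mul_assoc matrix_mul_lid)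
  qed
  have \<phi>1: "\<phi> 1 = mat 1"
    by (rule idem) (use \<phi> G in \<open>auto simp: circle_hom_def dest!: bspec[of _ _ 1]\<close>)
  have \<psi>1: "\<psi> 1 = mat 1"
    by (rule idem) (use \<psi> in \<open>auto simp: circle_hom_def form_aut_def invertible_det_nz dest!: bspec[of _ _ 1]\<close>)
  have "\<forall>i j. \<exists>x. ((\<lambda>t. \<phi> (cis t) $ i $ j) has_vector_derivative x) (at 0)"
  proof (intro allI)
    fix i j
    obtain p where p: "real_polynomial_function p" "\<And>z. z \<in> sphere 0 1 \<Longrightarrow> \<phi> z $ i $ j = of_real (p z)"
      using \<phi> unfolding circle_hom_def by blast
    obtain p' where p': "(p has_derivative p') (at (cis 0))"
      using differentiable_at_real_polynomial_function[OF p(1), of "cis 0" UNIV] by (auto simp: differentiable_def)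
    have "((\<lambda>t. cis t) has_derivative (\<lambda>t. t *\<^sub>R (\<i> * cis 0))) (at 0)"
      by (auto intro!: derivative_eq_intros)
    from has_derivative_compose[OF this p']
    have "((\<lambda>t. p (cis t)) has_vector_derivative p' (\<i> * cis 0)) (at 0)"
      by (simp add: has_vector_derivative_def linear_scale[OF has_derivative_linear[OF p']])
    then have "((\<lambda>t. complex_of_real (p (cis t))) has_vector_derivative of_real (p' (\<i> * cis 0))) (at 0)"
      by (rule bounded_linear.has_vector_derivative[OF bounded_linear_of_real])
    then show "\<exists>x. ((\<lambda>t. \<phi> (cis t) $ i $ j) has_vector_derivative x) (at 0)" using p(2) by auto
  qed
  then obtain x where x: "\<And>i j. ((\<lambda>t. \<phi> (cis t) $ i $ j) has_vector_derivative x i j) (at 0)" by metis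
  define X where "X = (\<chi> i j. x i j)"
  have X: "((\<lambda>t. \<phi> (cis t)) has_vector_derivative X) (at 0)"
    by (rule has_vector_derivative_matrixI) (simp add: X_def x)
  have \<phi>G: "\<phi> (cis t) \<in> G" for t using \<phi> by (simp add: circle_hom_def)
  have curve: "((\<lambda>t. f (\<phi> (cis t))) has_vector_derivative dderiv X f (mat 1)) (at 0)" if "f \<in> regular_fun UNIV" for f
    by (rule regular_fun_curve[OF that X]) (simp add: \<phi>1)
  \<comment> \<open>A regular function that vanishes on \<open>G\<close> vanishes along the circle,
    so its derivative along the velocity \<open>X\<close> is 0.\<close>
  have XL: "X \<in> lie_algebra_of G" unfolding lie_algebra_of_def
  proof (intro CollectI ballI impI)
    fix f :: "complex^'m^'m \<Rightarrow> complex" assume f: "f \<in> regular_fun UNIV" "\<forall>g\<in>G. f g = 0"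
    have "((\<lambda>t. 0) has_vector_derivative dderiv X f (mat 1)) (at 0)" using curve[OF f(1)] f(2) \<phi>G by simp
    then have "dderiv X f (mat 1) = 0" using vector_derivative_unique_at has_vector_derivative_const by blast
    then show "((\<lambda>t. f (mat 1 + t *\<^sub>M X)) has_field_derivative 0) (at 0)"
      using regular_fun_line[OF f(1), of "mat 1" X] by simp
  qed
  define A where "A = differential_at_1 G \<pi> X"
  have A: "((\<lambda>t. \<psi> (cis t) $ i $ j) has_vector_derivative A $ i $ j) (at 0)" for i j
    using curve[OF FU] F(2) \<phi>G by (simp add: A_def \<psi>_def differential_entry[OF XL])
  let ?V = "circle_weight_space \<psi>"
  have eig: "A *v v = (\<i> * of_int k) *s v" if v: "v \<in> ?V k" for v k
  proof -
    have "(A *v v) $ i = \<i> * of_int k * v $ i" for i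
    proof -
      have "((\<lambda>t. \<Sum>j\<in>UNIV. \<psi> (cis t) $ i $ j * v $ j) has_vector_derivative (\<Sum>j\<in>UNIV. A $ i $ j * v $ j)) (at 0)"
        by (intro has_vector_derivative_sum has_vector_derivative_mult_left A)
      moreover have "(\<lambda>t. \<Sum>j\<in>UNIV. \<psi> (cis t) $ i $ j * v $ j) = (\<lambda>t. cis (of_int k * t) * v $ i)"
      proof
        fix t
        have "(\<psi> (cis t) *v v) $ i = (cis t powi k *s v) $ i" using v by (simp add: circle_weight_space_def)
        then show "(\<Sum>j\<in>UNIV. \<psi> (cis t) $ i $ j * v $ j) = cis (of_int k * t) * v $ i"
          by (simp add: matrix_vector_mult_def cis_power_int)
      qed
      ultimately have "((\<lambda>t. cis (of_int k * t) * v $ i) has_vector_derivative (\<Sum>j\<in>UNIV. A $ i $ j * v $ j)) (at 0)"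
        by simp
      moreover have "((\<lambda>t. cis (of_int k * t) * v $ i) has_vector_derivative \<i> * of_int k * v $ i) (at 0)"
        unfolding has_vector_derivative_def
        by (auto intro!: derivative_eq_intros simp: fun_eq_iff scaleR_conv_of_real)
      ultimately have "(\<Sum>j\<in>UNIV. A $ i $ j * v $ j) = \<i> * of_int k * v $ i"
        by (rule vector_derivative_unique_at)
      then show ?thesis by (simp add: matrix_vector_mult_def)
    qed
    then show ?thesis by (simp add: vec_eq_iff)
  qed
  have sub: "vec.subspace (?V k)" for k unfolding vec.subspace_def circle_weight_space_def
    by (auto simp: vector_linear_simps)
  have V0: "0 \<in> ?V k" for k using vec.subspace_0[OF sub] .
  have summand: "hodge_summand \<psi> p q = ?V (p - q)" for p q
    by (simp add: hodge_summand_def circle_weight_space_def)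
  \<comment> \<open>The prescribed value at -1 forces \<open>k\<close> to have the parity of
    \<open>w\<close>, so that \<open>k\<close> is \<open>p - q\<close> for some
    \<open>p + q = w\<close>.\<close>
  have parity: "\<exists>p q. p + q = w \<and> p - q = k" if k: "?V k \<noteq> {0}" for k
  proof -
    obtain v where v: "v \<in> ?V k" "v \<noteq> 0" using k V0[of k] by blast
    then have "(-1) powi k *s v = ((-1) powi w *\<^sub>M mat 1) *v v"
      unfolding \<psi>_minus[symmetric] by (simp add: circle_weight_space_def)
    then have "(-1::complex) powi k = (-1) powi w" using v(2) by (simp add: mscale_vector_mult)
    then have "even (w + k)" by (auto simp: power_int_minus_left split: if_splits)
    then obtain p where "w + k = 2 * p" by blast
    then show ?thesis by (intro exI[of _ p] exI[of _ "w - p"]) simp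
  qed
  \<comment> \<open>The matrices of \<open>\<psi>\<close> on the circle are real, so conjugation
    exchanges the weights \<open>k\<close> and \<open>-k\<close>. The bound by the highest level
    thus holds for absolute values, as principality requires.\<close>
  have conj: "?V (- k) \<noteq> {0}" if k: "?V k \<noteq> {0}" for k
  proof -
    obtain v where v: "v \<in> ?V k" "v \<noteq> 0" using k V0[of k] by blast
    define v' where "v' = (\<chi> i. cnj (v $ i))"
    have "v' \<in> ?V (- k)" unfolding circle_weight_space_def
    proof (intro CollectI ballI)
      fix z :: complex assume z: "z \<in> sphere 0 1"
      have real: "cnj (\<psi> z $ i $ j) = \<psi> z $ i $ j" for i j
      proof -
        obtain p where "\<And>z. z \<in> sphere 0 1 \<Longrightarrow> \<psi> z $ i $ j = of_real (p z)"
          using \<psi> unfolding circle_hom_def by blast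
        then show ?thesis using z by simp
      qed
      have "z * cnj z = 1" using z complex_norm_square[of z] by simp
      then have cz: "cnj z = inverse z" by (metis inverse_unique)
      have "(\<psi> z *v v') $ i = (z powi (- k) *s v') $ i" for i
      proof -
        have "(\<psi> z *v v') $ i = cnj ((\<psi> z *v v) $ i)"
          by (simp add: matrix_vector_mult_def v'_def real)
        also have "\<dots> = cnj (z powi k) * cnj (v $ i)" using v(1) z by (simp add: circle_weight_space_def)
        also have "cnj (z powi k) = inverse z powi k" unfolding cz[symmetric] by (simp add: power_int_def)
        also have "\<dots> = z powi (- k)" by (simp add: power_int_inverse power_int_minus)
        finally show ?thesis by (simp add: v'_def)
      qed
      then show "\<psi> z *v v' = z powi (- k) *s v'" by (simp add: vec_eq_iff)
    qed
    moreover have "v' \<noteq> 0" using v(2) by (simp add: v'_def vec_eq_iff)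
    ultimately show ?thesis by blast
  qed
  \<comment> \<open>\<open>Max\<close> in the highest level is meaningful only for a finite set; the
    weights are integer eigenvalues of \<open>A\<close> divided by the imaginary unit.\<close>
  have fin: "finite {k. ?V k \<noteq> {0}}"
  proof (rule finite_subset[OF _ finite_integer_eigenvalues[of "(- \<i>) *\<^sub>M A"]], intro subsetI CollectI)
    fix k assume "k \<in> {k. ?V k \<noteq> {0}}"
    then obtain v where v: "v \<in> ?V k" "v \<noteq> 0" using V0[of k] by blast
    then show "\<exists>v. v \<noteq> 0 \<and> ((- \<i>) *\<^sub>M A) *v v = of_int k *s v"
      using eig[OF v(1)] by (intro exI[of _ v]) (simp only: mscale_vector_mult vector_smult_assoc, simp)
  qed
  define S :: "rat set" where "S = {of_int (p - q) / 2 | p q. p + q = w \<and> hodge_summand \<psi> p q \<noteq> {0}}"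
  have "S \<subseteq> (\<lambda>k. of_int k / 2) ` {k. ?V k \<noteq> {0}}" unfolding S_def summand by blast
  then have finS: "finite S" using fin finite_surj by blast
  have level: "of_int k / 2 \<le> highest_level w \<psi>" if k: "?V k \<noteq> {0}" for k
  proof -
    obtain p q where pq: "p + q = w" "p - q = k" using parity[OF k] by blast
    then have "of_int (p - q) / 2 \<in> S" unfolding S_def using k summand[of p q] by blast
    then have "of_int (p - q) / 2 \<le> Max S" by (rule Max_ge[OF finS])
    then show ?thesis using pq by (simp add: highest_level_def S_def)
  qed
  have dim: "vec.dim (?V k) = 1" if k: "?V k \<noteq> {0}" for k
  proof -
    obtain p q where pq: "p + q = w" "p - q = k" using parity[OF k] by blast
    have "\<bar>of_int (p - q) / 2\<bar> \<le> highest_level w \<psi>"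
      using level[OF k] level[OF conj[OF k]] pq(2) by (simp add: abs_le_iff)
    then have "vec.dim (hodge_summand \<psi> p q) = 1"
      using principal pq(1) unfolding principal_hodge_def \<psi>_def by blast
    then show ?thesis using pq summand by simp
  qed
  have "\<not> (det A = 0 \<and> dderiv (mat 1) det A = 0)"
  proof (rule diagonalizable_simple_spectrum_det[of ?V])
    show "v \<in> vec.span (\<Union>k. ?V k)" for v
      by (rule circle_weight_spaces_span) (use \<psi> \<psi>1 in \<open>auto simp: circle_hom_def\<close>)
  qed (use eig dim in auto)
  moreover have "simple_lie_algebra (lie_algebra_of G)"
    using assms(2) by (auto simp: simple_of_type_def)
  then have br: "bracket X Y \<in> lie_algebra_of G" if "X \<in> lie_algebra_of G" "Y \<in> lie_algebra_of G" for X Y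
    using that by (auto simp: simple_lie_algebra_def lie_subalgebra_def)
  obtain M where M: "M = cartan_E8 \<or> M = cartan_F4" "simple_of_type M (lie_algebra_of G)"
    using assms(2) by blast
  have "det A = 0" "dderiv (mat 1) det A = 0" unfolding A_def
    by (rule exceptional_singular[OF M differential_linear(1) differential_linear(2) differential_bracket inj XL];
        use br in blast)+
  ultimately show False by blast
qed

end
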